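(* Let $k$ be an arbitrary field and $T$ an indeterminate. Then each finite embedding problem over $k(T)$ has a regular solution. That is: for every finite group $G$, every finite separable extension $L/k(T)$, and every epimorphism $\alpha : G \rightarrow \mathrm{Aut}(L/k(T))$, there exist a finite separable extension $E/k(T)$ with $L \subseteq E$ and $E \cap \overline{k} = L \cap \overline{k}$, and an isomorphism $\beta : \mathrm{Aut}(E/k(T)) \rightarrow G$, such that every element of $\mathrm{Aut}(E/k(T))$ maps $L$ onto itself and $\alpha(\beta(\sigma)) = \sigma|_L$ for all $\sigma \in \mathrm{Aut}(E/k(T))$.
   Context: For a field extension $F/K$, $\mathrm{Aut}(F/K)$ denotes the group of all field automorphisms of $F$ fixing $K$ pointwise. $\overline{k}$ denotes an algebraic closure of $k$ (inside a fixed algebraic closure of $k(T)$ containing all the fields involved). A finite embedding problem over a field $K$ is an epimorphism $\alpha : G \rightarrow \mathrm{Aut}(L/K)$, where $G$ is a finite group and $L/K$ is a finite separable extension (not necessarily Galois). A solution to $\alpha$ is an isomorphism $\beta : \mathrm{Aut}(E/K) \rightarrow G$, where $E/K$ is a finite separable extension with $L \subseteq E$, such that every element of $\mathrm{Aut}(E/K)$ fixes $L$ setwise and $\alpha\circ\beta$ is the restriction map $\sigma\mapsto\sigma|_L$; $E$ is the solution field. If $K = k(T)$, a solution with solution field $E$ is regular if $E \cap \overline{k} = L \cap \overline{k}$. *)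

theory Defs
  imports
    "HOL-Algebra.Algebraic_Closure_Type"
    "HOL-Algebra.QuotRing"
    "HOL-Algebra.Bij"
begin

section \<open>Automorphism groups of field extensions\<close>

text \<open>The subfields considered are subsets of a field given as a type, regarded as an algebra
  record via \<^const>\<open>ring_of_type_algebra\<close>.\<close>

abbreviation subfield_ring :: "'a::field set \<Rightarrow> 'a ring" where
  "subfield_ring F \<equiv> ring_of_type_algebra\<lparr>carrier := F\<rparr>"

text \<open>Automorphisms are made extensional (undefined outside \<open>F\<close>), as for \<^const>\<open>AutoGroup\<close>, so
  that each automorphism is represented by exactly one function; \<^const>\<open>BijGroup\<close> supplies
  the composition \<open>(\<sigma>, \<tau>) \<mapsto> \<sigma> \<circ> \<tau>\<close>.\<close>

definition field_auts :: "'a::field set \<Rightarrow> 'a set \<Rightarrow> ('a \<Rightarrow> 'a) set" where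
  "field_auts F K =
     {\<sigma> \<in> ring_iso (subfield_ring F) (subfield_ring F) \<inter> extensional F. \<forall>x\<in>K. \<sigma> x = x}"

definition Aut :: "'a::field set \<Rightarrow> 'a set \<Rightarrow> ('a \<Rightarrow> 'a) monoid" where
  "Aut F K = BijGroup F\<lparr>carrier := field_auts F K\<rparr>"

lemma field_auts_iff:
  "\<sigma> \<in> field_auts F K \<longleftrightarrow> \<sigma> \<in> Bij F \<and> (\<forall>x\<in>F. \<forall>y\<in>F. \<sigma> (x + y) = \<sigma> x + \<sigma> y) \<and>
     (\<forall>x\<in>F. \<forall>y\<in>F. \<sigma> (x * y) = \<sigma> x * \<sigma> y) \<and> \<sigma> 1 = 1 \<and> (\<forall>x\<in>K. \<sigma> x = x)"
  by (auto simp: field_auts_def ring_iso_def ring_hom_def ring_of_type_algebra_def Bij_def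
      bij_betw_def)

lemma group_Aut:
  assumes F: "subfield F ring_of_type_algebra" and "K \<subseteq> F"
  shows "group (Aut F K)"
proof -
  have cl: "1 \<in> F" "x + y \<in> F" "x * y \<in> F" if "x \<in> F" "y \<in> F" for x y
    using subringE(3,6,7)[OF subfieldE(1)[OF F]] that by (auto simp: ring_of_type_algebra_def)
  have one: "1 \<in> F"
    using subringE(3)[OF subfieldE(1)[OF F]] by (auto simp: ring_of_type_algebra_def)
  have "subgroup (field_auts F K) (BijGroup F)"
  proof (rule subgroup.intro)
    show "field_auts F K \<subseteq> carrier (BijGroup F)"
      by (auto simp: field_auts_iff BijGroup_def)
    show "\<one>\<^bsub>BijGroup F\<^esub> \<in> field_auts F K"
      using \<open>K \<subseteq> F\<close> one cl by (auto simp: field_auts_iff BijGroup_def id_Bij)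
  next
    fix \<sigma> \<tau> assume *: "\<sigma> \<in> field_auts F K" "\<tau> \<in> field_auts F K"
    then have b: "\<sigma> \<in> Bij F" "\<tau> \<in> Bij F" by (auto simp: field_auts_iff)
    have m: "\<tau> x \<in> F" if "x \<in> F" for x using b(2) that Bij_imp_funcset by blast
    show "\<sigma> \<otimes>\<^bsub>BijGroup F\<^esub> \<tau> \<in> field_auts F K"
      using * b m one cl \<open>K \<subseteq> F\<close> compose_Bij[OF b]
      by (auto simp: field_auts_iff BijGroup_def compose_def subset_iff)
  next
    fix \<sigma> assume *: "\<sigma> \<in> field_auts F K"
    then have b: "\<sigma> \<in> Bij F" by (auto simp: field_auts_iff)
    then have inj: "inj_on \<sigma> F" by (auto simp: Bij_def bij_betw_def)
    have fx: "inv_into F \<sigma> x = x" if "x \<in> F" "\<sigma> x = x" for x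
      using inv_into_f_f[OF inj that(1)] that(2) by simp
    have "(\<lambda>x\<in>F. inv_into F \<sigma> x) \<in> field_auts F K"
      using * b one cl \<open>K \<subseteq> F\<close> restrict_inv_into_Bij[OF b] fx
        Bij_inv_into_lemma[of F \<sigma> "(+)"] Bij_inv_into_lemma[of F \<sigma> "(*)"]
      by (auto simp: field_auts_iff Pi_iff subset_iff)
    then show "inv\<^bsub>BijGroup F\<^esub> \<sigma> \<in> field_auts F K" by (simp add: inv_BijGroup[OF b])
  qed
  then show ?thesis
    unfolding Aut_def using group_BijGroup by (rule subgroup.subgroup_is_group)
qed


section \<open>Finite separable extensions inside an algebraic closure\<close>

text \<open>The base field is the type \<open>'f\<close>, identified with its image in the algebraic closure
  \<open>'f alg_closure\<close>.\<close>

abbreviation base_field :: "'f::field alg_closure set" where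
  "base_field \<equiv> range to_ac"

text \<open>An irreducible polynomial over \<open>'f\<close> with root \<open>x\<close> is the minimal polynomial of \<open>x\<close> up to a
  constant factor; it is separable if it has only simple roots in the algebraic closure.\<close>

definition separable_element :: "'f::field alg_closure \<Rightarrow> bool" where
  "separable_element x \<longleftrightarrow>
     (\<exists>p::'f poly. Factorial_Ring.irreducible p \<and> poly (map_poly to_ac p) x = 0 \<and>
        rsquarefree (map_poly to_ac p))"

definition finite_separable_extension :: "'f::field alg_closure set \<Rightarrow> bool" where
  "finite_separable_extension L \<longleftrightarrow>
     subfield L ring_of_type_algebra \<and> base_field \<subseteq> L \<and>
     ring.finite_dimension ring_of_type_algebra base_field L \<and>
     (\<forall>x\<in>L. separable_element x)"


section \<open>Finite embedding problems\<close>

definition finite_embedding_problem ::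
  "('g, 'm) monoid_scheme \<Rightarrow> 'f::field alg_closure set \<Rightarrow>
     ('g \<Rightarrow> ('f alg_closure \<Rightarrow> 'f alg_closure)) \<Rightarrow> bool" where
  "finite_embedding_problem G L \<alpha> \<longleftrightarrow>
     group G \<and> finite (carrier G) \<and> finite_separable_extension L \<and>
     \<alpha> \<in> epi G (Aut L base_field)"

definition embedding_problem_solution ::
  "('g, 'm) monoid_scheme \<Rightarrow> 'f::field alg_closure set \<Rightarrow>
     ('g \<Rightarrow> ('f alg_closure \<Rightarrow> 'f alg_closure)) \<Rightarrow>
     'f alg_closure set \<Rightarrow> (('f alg_closure \<Rightarrow> 'f alg_closure) \<Rightarrow> 'g) \<Rightarrow> bool" where
  "embedding_problem_solution G L \<alpha> E \<beta> \<longleftrightarrow>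
     finite_separable_extension E \<and> L \<subseteq> E \<and>
     \<beta> \<in> iso (Aut E base_field) G \<and>
     (\<forall>\<sigma>\<in>carrier (Aut E base_field). \<sigma> ` L = L \<and> \<alpha> (\<beta> \<sigma>) = restrict \<sigma> L)"


section \<open>Regularity over rational function fields\<close>

text \<open>\<open>k(T)\<close> is the type \<open>'k poly fract\<close>, so all extensions of it live in
  \<open>'k poly fract alg_closure\<close>; \<open>constant_closure\<close> is the algebraic closure of \<open>k\<close> in that
  field.\<close>

definition const_to_ac :: "'k::field \<Rightarrow> 'k poly fract alg_closure" where
  "const_to_ac c = to_ac (to_fract [:c:])"

definition constant_closure :: "'k::field poly fract alg_closure set" where
  "constant_closure = {x. \<exists>p::'k poly. p \<noteq> 0 \<and> poly (map_poly const_to_ac p) x = 0}"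

definition regular_solution ::
  "('g, 'm) monoid_scheme \<Rightarrow> 'k::field poly fract alg_closure set \<Rightarrow>
     ('g \<Rightarrow> ('k poly fract alg_closure \<Rightarrow> 'k poly fract alg_closure)) \<Rightarrow>
     'k poly fract alg_closure set \<Rightarrow>
     (('k poly fract alg_closure \<Rightarrow> 'k poly fract alg_closure) \<Rightarrow> 'g) \<Rightarrow> bool" where
  "regular_solution G L \<alpha> E \<beta> \<longleftrightarrow>
     embedding_problem_solution G L \<alpha> E \<beta> \<and> E \<inter> constant_closure = L \<inter> constant_closure"

end

(*
Let K = k(T), A its algebraic closure, and let G act on L through \<alpha>. The Galois theory is done with
the automorphisms of A over K, and irreducibility over large subfields of A (those containing the
algebraic closure of k) is checked at places: a place above T = c extends k(T) -> A((X)),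
T |-> c + X, to a homomorphism from A to the algebraic closure of A((X)). The elements mapped into A((X)) form
a field, which contains all constants and, for almost all c, a given finite separable extension.

First, L is enlarged by the roots y_g (g in G) of a polynomial f over k(T) of degree |G|, chosen such
that for each i < |G| there is a place at which f has i unramified roots and an Eisenstein cofactor.
Hence every permutation of the roots is realised while fixing L and the constants, and G acts on
L(y_g : g in G) by \<alpha> on L and by y_g |-> y_(hg).

Second, the remaining automorphisms are destroyed. Choose w in this field such that an automorphism fixing w
acts like an element of G, and an element u of k[T] which is congruent to w, but to no other conjugate
of w, at some place. Adjoin a root z of q(w) = X^m + a/(u - w) X^(m-1) + a. At that place q(w) has exactly
one root in A((X)), and q(w') has none for the other conjugates w' of w; taking the unramified root
for z, an automorphism of the field obtained must fix both w and z. At another place, q(w) is Eisenstein, so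
adjoining z adds no constants and the action of G extends by fixing z.
*)

theory Submission
  imports Defs
begin

section \<open>Intermediate fields and extension of homomorphisms\<close>

text \<open>The field \<open>k\<close> may be finite or imperfect, so \<open>k\<close> itself may
  offer no suitable points. The points are therefore roots \<open>c\<close> in \<open>A\<close> of
  polynomials \<open>P\<close> over \<open>k\<close> with \<open>P'(c) \<noteq> 0\<close>; such a
  \<open>P\<close> has order one at \<open>c\<close>, which is what Eisenstein's criterion asks of a
  constant term. The shape of the trinomial comes from the following. Let \<open>p\<close> be the
  polynomial of \<open>w\<close> over \<open>k[T]\<close>, and let \<open>a = P * p(u)\<close>.
  Since \<open>u - w\<close> divides \<open>p(u)\<close> exactly once at the chosen place,
  \<open>a/(u - w)\<close> is a unit there, while \<open>a/(u - w')\<close> vanishes for every other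
  conjugate \<open>w'\<close>. The exponent \<open>m\<close> is larger than the order of
  \<open>a\<close> by two, so that no root with vanishing residue can lie in \<open>A((X))\<close>.
  The factor \<open>P\<close> is a unit at this place and provides the simple zero needed at the
  Eisenstein place. Only the automorphism group of \<open>E\<close> is prescribed, and
  \<open>E\<close> need not be normal. It is thus enough to control those automorphisms of
  \<open>A\<close> that send \<open>z\<close> back into \<open>E\<close>. New constants are excluded
  because \<open>A((X))\<close> already contains all constants: irreducibility over it yields
  automorphisms that fix them.\<close>

text \<open>The library's algebra theories use the unqualified name for another notion.\<close>

abbreviation irred :: "'a::comm_semiring_1 \<Rightarrow> bool" where
  "irred \<equiv> Factorial_Ring.irreducible"

definition subring_set :: "'a::comm_ring_1 set \<Rightarrow> bool" where
  "subring_set F \<longleftrightarrow> 1 \<in> F \<and> (\<forall>x\<in>F. \<forall>y\<in>F. x - y \<in> F \<and> x * y \<in> F)"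

text \<open>Nothing is demanded outside \<open>F\<close>, so a homomorphism with a small domain is
  still a total function, and extending it means enlarging the set.\<close>

definition hom_on :: "'a::comm_ring_1 set \<Rightarrow> ('a \<Rightarrow> 'b::comm_ring_1) \<Rightarrow> bool" where
  "hom_on F \<phi> \<longleftrightarrow> \<phi> 1 = 1 \<and>
     (\<forall>x\<in>F. \<forall>y\<in>F. \<phi> (x + y) = \<phi> x + \<phi> y \<and> \<phi> (x * y) = \<phi> x * \<phi> y)"

definition poly_over :: "'a::zero set \<Rightarrow> 'a poly \<Rightarrow> bool" where
  "poly_over F p \<longleftrightarrow> (\<forall>i. coeff p i \<in> F)"

lemma subring_set_UNIV [simp]: "subring_set UNIV"
  by (simp add: subring_set_def)

lemma poly_over_UNIV [simp]: "poly_over UNIV p"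
  by (simp add: poly_over_def)

context
  fixes F :: "'a::comm_ring_1 set"
  assumes F: "subring_set F"
begin

lemma subring_set_closed:
  shows subring_set_one: "1 \<in> F" and subring_set_zero: "0 \<in> F"
    and subring_set_diff: "x \<in> F \<Longrightarrow> y \<in> F \<Longrightarrow> x - y \<in> F"
    and subring_set_uminus: "x \<in> F \<Longrightarrow> - x \<in> F"
    and subring_set_add: "x \<in> F \<Longrightarrow> y \<in> F \<Longrightarrow> x + y \<in> F"
    and subring_set_mult: "x \<in> F \<Longrightarrow> y \<in> F \<Longrightarrow> x * y \<in> F"
    and subring_set_power: "x \<in> F \<Longrightarrow> x ^ n \<in> F"
proof -
  show 1: "1 \<in> F" using F by (simp add: subring_set_def)
  show d: "x - y \<in> F" if "x \<in> F" "y \<in> F" for x y using F that by (simp add: subring_set_def)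
  show z: "0 \<in> F" using d[OF 1 1] by simp
  show u: "- x \<in> F" if "x \<in> F" for x using d[OF z that] by simp
  show "x + y \<in> F" if "x \<in> F" "y \<in> F" for x y using d[OF that(1) u[OF that(2)]] by simp
  show m: "x * y \<in> F" if "x \<in> F" "y \<in> F" for x y using F that by (simp add: subring_set_def)
  show "x ^ n \<in> F" if "x \<in> F" for x n using that by (induction n) (auto intro: 1 m)
qed

lemma subring_set_sum: "(\<And>i. i \<in> I \<Longrightarrow> f i \<in> F) \<Longrightarrow> sum f I \<in> F"
  by (induction I rule: infinite_finite_induct) (auto intro: subring_set_closed)

lemma subring_set_prod: "(\<And>i. i \<in> I \<Longrightarrow> f i \<in> F) \<Longrightarrow> prod f I \<in> F"
  by (induction I rule: infinite_finite_induct) (auto intro: subring_set_closed)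

lemma subring_set_poly: "poly_over F p \<Longrightarrow> x \<in> F \<Longrightarrow> poly p x \<in> F"
  unfolding poly_altdef
  by (intro subring_set_sum subring_set_mult subring_set_power) (auto simp: poly_over_def)

lemma poly_over_closed:
  shows poly_over_zero: "poly_over F 0" and poly_over_one: "poly_over F 1"
    and poly_over_add: "poly_over F p \<Longrightarrow> poly_over F q \<Longrightarrow> poly_over F (p + q)"
    and poly_over_diff: "poly_over F p \<Longrightarrow> poly_over F q \<Longrightarrow> poly_over F (p - q)"
    and poly_over_mult: "poly_over F p \<Longrightarrow> poly_over F q \<Longrightarrow> poly_over F (p * q)"
    and poly_over_smult: "c \<in> F \<Longrightarrow> poly_over F p \<Longrightarrow> poly_over F (smult c p)"
    and poly_over_monom: "c \<in> F \<Longrightarrow> poly_over F (monom c n)"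
    and poly_over_pCons: "c \<in> F \<Longrightarrow> poly_over F p \<Longrightarrow> poly_over F (pCons c p)"
  by (auto simp: poly_over_def coeff_mult coeff_pCons
        intro!: subring_set_sum subring_set_closed split: nat.splits)

lemma poly_over_sum: "(\<And>i. i \<in> I \<Longrightarrow> poly_over F (f i)) \<Longrightarrow> poly_over F (sum f I)"
  by (induction I rule: infinite_finite_induct) (auto intro: poly_over_closed)

lemma poly_over_prod: "(\<And>i. i \<in> I \<Longrightarrow> poly_over F (f i)) \<Longrightarrow> poly_over F (prod f I)"
  by (induction I rule: infinite_finite_induct) (auto intro: poly_over_closed)

lemma hom_on_simps:
  assumes \<phi>: "hom_on F \<phi>"
  shows hom_on_one: "\<phi> 1 = 1" and hom_on_zero: "\<phi> 0 = 0"
    and hom_on_add: "x \<in> F \<Longrightarrow> y \<in> F \<Longrightarrow> \<phi> (x + y) = \<phi> x + \<phi> y"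
    and hom_on_mult: "x \<in> F \<Longrightarrow> y \<in> F \<Longrightarrow> \<phi> (x * y) = \<phi> x * \<phi> y"
    and hom_on_uminus: "x \<in> F \<Longrightarrow> \<phi> (- x) = - \<phi> x"
    and hom_on_diff: "x \<in> F \<Longrightarrow> y \<in> F \<Longrightarrow> \<phi> (x - y) = \<phi> x - \<phi> y"
    and hom_on_power: "x \<in> F \<Longrightarrow> \<phi> (x ^ n) = \<phi> x ^ n"
proof -
  show 1: "\<phi> 1 = 1" using \<phi> by (simp add: hom_on_def)
  show a: "\<phi> (x + y) = \<phi> x + \<phi> y" if "x \<in> F" "y \<in> F" for x y
    using \<phi> that by (simp add: hom_on_def)
  show m: "\<phi> (x * y) = \<phi> x * \<phi> y" if "x \<in> F" "y \<in> F" for x y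
    using \<phi> that by (simp add: hom_on_def)
  show z: "\<phi> 0 = 0" using a[OF subring_set_zero subring_set_zero] by simp
  show u: "\<phi> (- x) = - \<phi> x" if "x \<in> F" for x
    using a[OF that subring_set_uminus[OF that]] z by (simp add: eq_neg_iff_add_eq_0 add.commute)
  show "\<phi> (x - y) = \<phi> x - \<phi> y" if "x \<in> F" "y \<in> F" for x y
    using a[OF that(1) subring_set_uminus[OF that(2)]] u[OF that(2)] by simp
  show "\<phi> (x ^ n) = \<phi> x ^ n" if "x \<in> F" for x n
    using that by (induction n) (auto simp: 1 m subring_set_power)
qed

lemma hom_on_sum:
  assumes "hom_on F \<phi>"
  shows "(\<And>i. i \<in> I \<Longrightarrow> f i \<in> F) \<Longrightarrow> \<phi> (sum f I) = (\<Sum>i\<in>I. \<phi> (f i))"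
  by (induction I rule: infinite_finite_induct)
     (auto simp: hom_on_simps[OF assms] subring_set_sum)

lemma hom_on_prod:
  assumes "hom_on F \<phi>"
  shows "(\<And>i. i \<in> I \<Longrightarrow> f i \<in> F) \<Longrightarrow> \<phi> (prod f I) = (\<Prod>i\<in>I. \<phi> (f i))"
  by (induction I rule: infinite_finite_induct)
     (auto simp: hom_on_simps[OF assms] subring_set_prod)

lemma coeff_map_poly_hom: "hom_on F \<phi> \<Longrightarrow> coeff (map_poly \<phi> p) i = \<phi> (coeff p i)"
  by (simp add: coeff_map_poly hom_on_zero)

lemma map_poly_hom_simps:
  assumes \<phi>: "hom_on F \<phi>"
  shows map_poly_hom_add:
      "poly_over F p \<Longrightarrow> poly_over F q \<Longrightarrow> map_poly \<phi> (p + q) = map_poly \<phi> p + map_poly \<phi> q"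
    and map_poly_hom_diff:
      "poly_over F p \<Longrightarrow> poly_over F q \<Longrightarrow> map_poly \<phi> (p - q) = map_poly \<phi> p - map_poly \<phi> q"
    and map_poly_hom_mult:
      "poly_over F p \<Longrightarrow> poly_over F q \<Longrightarrow> map_poly \<phi> (p * q) = map_poly \<phi> p * map_poly \<phi> q"
    and map_poly_hom_smult:
      "c \<in> F \<Longrightarrow> poly_over F p \<Longrightarrow> map_poly \<phi> (smult c p) = smult (\<phi> c) (map_poly \<phi> p)"
    and map_poly_hom_monom: "map_poly \<phi> (monom c n) = monom (\<phi> c) n"
    and map_poly_hom_pCons: "map_poly \<phi> (pCons c p) = pCons (\<phi> c) (map_poly \<phi> p)"
  by (auto simp: poly_eq_iff coeff_map_poly_hom[OF \<phi>] hom_on_simps[OF \<phi>] poly_over_def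
      coeff_mult hom_on_sum[OF \<phi>] subring_set_mult coeff_pCons split: nat.splits)

lemma map_poly_hom_prod:
  assumes \<phi>: "hom_on F \<phi>"
  shows "(\<And>i. i \<in> I \<Longrightarrow> poly_over F (f i)) \<Longrightarrow>
    map_poly \<phi> (prod f I) = (\<Prod>i\<in>I. map_poly \<phi> (f i))"
  by (induction I rule: infinite_finite_induct)
     (auto simp: map_poly_hom_simps[OF \<phi>] poly_over_prod map_poly_1' hom_on_one[OF \<phi>])

lemma map_poly_hom_sum:
  assumes \<phi>: "hom_on F \<phi>"
  shows "(\<And>i. i \<in> I \<Longrightarrow> poly_over F (f i)) \<Longrightarrow>
    map_poly \<phi> (sum f I) = (\<Sum>i\<in>I. map_poly \<phi> (f i))"
  by (induction I rule: infinite_finite_induct)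
     (auto simp: map_poly_hom_simps[OF \<phi>] poly_over_sum)

lemma hom_on_poly:
  assumes \<phi>: "hom_on F \<phi>" and "poly_over F p" "x \<in> F"
  shows "\<phi> (poly p x) = poly (map_poly \<phi> p) (\<phi> x)"
  using assms(2)
proof (induction p)
  case 0
  then show ?case by (simp add: hom_on_zero[OF \<phi>])
next
  case (pCons a p)
  have "poly_over F p" unfolding poly_over_def
  proof
    fix i show "coeff p i \<in> F" using pCons.prems[unfolded poly_over_def, rule_format, of "Suc i"] by simp
  qed
  moreover have "a \<in> F" using pCons.prems[unfolded poly_over_def, rule_format, of 0] by simp
  ultimately show ?case
    using pCons.IH \<open>x \<in> F\<close>
    by (simp add: map_poly_hom_pCons[OF \<phi>] hom_on_simps[OF \<phi>] subring_set_poly subring_set_mult)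
qed

end

lemmas hom_simps = hom_on_simps[OF subring_set_UNIV]
lemmas hom_zero = hom_on_zero[OF subring_set_UNIV]
lemmas hom_poly = hom_on_poly[OF subring_set_UNIV]
lemmas hom_prod = hom_on_prod[OF subring_set_UNIV]
lemmas coeff_map_hom = coeff_map_poly_hom[OF subring_set_UNIV]
lemmas map_hom_simps = map_poly_hom_simps[OF subring_set_UNIV]
lemmas map_hom_mult = map_poly_hom_mult[OF subring_set_UNIV]
lemmas map_hom_prod = map_poly_hom_prod[OF subring_set_UNIV]

lemma degree_map_poly_hom:
  fixes \<phi> :: "'a::field \<Rightarrow> 'b::comm_ring_1"
  assumes "hom_on UNIV \<phi>"
  shows "\<phi> x = 0 \<longleftrightarrow> x = 0" and "degree (map_poly \<phi> p) = degree p" and "inj \<phi>"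
    and "map_poly \<phi> p = 0 \<longleftrightarrow> p = 0"
proof -
  have z: "x = 0" if "\<phi> x = 0" for x
  proof (rule ccontr)
    assume "x \<noteq> 0"
    then have "\<phi> x * \<phi> (inverse x) = 1"
      using hom_simps[OF assms]
      by (metis UNIV_I right_inverse)
    with that show False by simp
  qed
  have z0: "\<phi> 0 = 0" using hom_zero[OF assms] .
  show 1: "\<phi> x = 0 \<longleftrightarrow> x = 0" for x using z z0 by auto
  show "degree (map_poly \<phi> p) = degree p"
    by (rule degree_map_poly) (use 1 in auto)
  show "inj \<phi>"
  proof (rule injI)
    fix x y assume "\<phi> x = \<phi> y"
    then have "\<phi> (x - y) = 0" using hom_on_diff[OF subring_set_UNIV assms] by simp
    then show "x = y" using 1 by simp
  qed
  show "map_poly \<phi> p = 0 \<longleftrightarrow> p = 0"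
    using 1 by (auto simp: poly_eq_iff coeff_map_poly z0)
qed

lemma hom_on_inverse:
  fixes \<phi> :: "'a::field \<Rightarrow> 'b::field"
  assumes "hom_on UNIV \<phi>"
  shows "\<phi> (inverse x) = inverse (\<phi> x)"
proof (cases "x = 0")
  case True then show ?thesis using hom_zero[OF assms] by simp
next
  case False
  then have "\<phi> x * \<phi> (inverse x) = 1"
    using hom_simps[OF assms] by (metis UNIV_I right_inverse)
  then show ?thesis by (metis inverse_unique)
qed

lemma hom_to_ac: "hom_on UNIV to_ac"
  by (simp add: hom_on_def)

section \<open>Subfields of the algebraic closure above the base field, and their generators\<close>

definition intermediate :: "'f::field alg_closure set \<Rightarrow> bool" where
  "intermediate F \<longleftrightarrow> subring_set F \<and> base_field \<subseteq> F"

lemma intermediate_subring: "intermediate F \<Longrightarrow> subring_set F"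
  and intermediate_base: "intermediate F \<Longrightarrow> to_ac x \<in> F"
  by (auto simp: intermediate_def)

lemma intermediate_base_field [simp]: "intermediate base_field"
  unfolding intermediate_def subring_set_def
  by (auto simp flip: to_ac_mult to_ac_diff to_ac_1)

lemma poly_over_base: "poly_over base_field p \<longleftrightarrow> (\<exists>q. p = map_poly to_ac q)"
proof
  assume p: "poly_over base_field p"
  have "p = map_poly to_ac (map_poly of_ac p)"
    using p by (intro poly_eqI) (simp add: coeff_map_poly poly_over_def to_ac_of_ac)
  then show "\<exists>q. p = map_poly to_ac q" by blast
qed (auto simp: poly_over_def coeff_map_poly)

lemma poly_over_mono: "poly_over F p \<Longrightarrow> F \<subseteq> F' \<Longrightarrow> poly_over F' p"
  by (auto simp: poly_over_def)

text \<open>All elements are algebraic over the base field, so a subring containing it is a field.\<close>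

lemma intermediate_inverse:
  assumes F: "intermediate F" and x: "x \<in> F"
  shows "inverse x \<in> F"
proof (cases "x = 0")
  case False
  have "inverse x \<in> F" if "p \<noteq> 0" "poly (map_poly to_ac p) x = 0" for p :: "'a poly"
    using that
  proof (induction p)
    case (pCons a p)
    have eq: "to_ac a + x * poly (map_poly to_ac p) x = 0"
      using pCons.prems by (simp add: map_poly_pCons)
    show ?case
    \<comment> \<open>If the constant term vanishes, \<open>x\<close> cancels and the shorter
      polynomial serves; otherwise \<open>a + x * p(x) = 0\<close> is solved for the inverse of
      \<open>x\<close>.\<close>
    proof (cases "a = 0")
      case True
      then show ?thesis using eq False pCons by auto
    next
      case a: False
      have "poly (map_poly to_ac p) x \<in> F"
        by (intro subring_set_poly intermediate_subring F x)
           (use F in \<open>auto simp: poly_over_def coeff_map_poly intermediate_base\<close>)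
      then have "to_ac (- inverse a) * poly (map_poly to_ac p) x \<in> F"
        by (intro subring_set_mult intermediate_subring F intermediate_base)
      moreover have "x * poly (map_poly to_ac p) x = - to_ac a"
        using eq by (simp add: eq_neg_iff_add_eq_0 add.commute)
      then have "to_ac (- inverse a) * poly (map_poly to_ac p) x = inverse x"
        using a False by (simp add: field_simps)
      ultimately show ?thesis by simp
    qed
  qed simp
  then show ?thesis using alg_closure_algebraic by blast
qed (use x in simp)

lemma intermediate_divide: "intermediate F \<Longrightarrow> x \<in> F \<Longrightarrow> y \<in> F \<Longrightarrow> x / y \<in> F"
  unfolding divide_inverse by (intro subring_set_mult intermediate_inverse intermediate_subring)

definition gen :: "'f::field alg_closure set \<Rightarrow> 'f alg_closure set" where
  "gen T = \<Inter> {F. intermediate F \<and> T \<subseteq> F}"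

lemma gen_least: "intermediate F \<Longrightarrow> T \<subseteq> F \<Longrightarrow> gen T \<subseteq> F"
  by (auto simp: gen_def)

lemma gen_incl: "T \<subseteq> gen T"
  by (auto simp: gen_def)

lemma intermediate_gen [simp]: "intermediate (gen T)"
  by (auto simp: gen_def intermediate_def subring_set_def)

lemma subring_set_gen [simp]: "subring_set (gen T)"
  by (rule intermediate_subring) simp

lemma gen_mono: "T \<subseteq> T' \<Longrightarrow> gen T \<subseteq> gen T'"
  by (meson gen_incl gen_least intermediate_gen subset_trans)

lemma gen_gen_Un: "gen (gen T \<union> S) = gen (T \<union> S)"
proof
  show "gen (gen T \<union> S) \<subseteq> gen (T \<union> S)"
    by (rule gen_least) (use gen_mono[of T "T \<union> S"] gen_incl[of "T \<union> S"] in auto)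
  show "gen (T \<union> S) \<subseteq> gen (gen T \<union> S)"
    by (rule gen_mono) (use gen_incl[of T] in auto)
qed

lemma gen_idem: "intermediate F \<Longrightarrow> gen F = F"
  by (meson gen_incl gen_least order_refl subset_antisym)

lemma intermediate_poly_image:
  assumes F: "intermediate F"
  shows "intermediate {poly g t |g. poly_over F g}"
proof -
  note sr = intermediate_subring[OF F]
  have "to_ac c \<in> {poly g t |g. poly_over F g}" for c
    by (rule CollectI, rule exI[of _ "[:to_ac c:]"])
       (auto intro!: poly_over_pCons poly_over_zero sr intermediate_base F)
  moreover have "1 \<in> {poly g t |g. poly_over F g}"
    by (rule CollectI, rule exI[of _ 1]) (auto intro!: poly_over_one sr)
  moreover have "poly g t - poly h t \<in> {poly g t |g. poly_over F g}"
    "poly g t * poly h t \<in> {poly g t |g. poly_over F g}" if "poly_over F g" "poly_over F h" for g h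
    using poly_over_diff[OF sr that] poly_over_mult[OF sr that]
    by (auto simp flip: poly_diff poly_mult)
  ultimately show ?thesis
    by (auto simp: intermediate_def subring_set_def)
qed

text \<open>Polynomial expressions in \<open>t\<close> suffice, without quotients: as everything is
  algebraic, the ring \<open>F[t]\<close> is already a field.\<close>

lemma gen_insert:
  assumes F: "intermediate F"
  shows "gen (insert t F) = {poly g t |g. poly_over F g}"
proof
  note sr = intermediate_subring[OF F]
  show "gen (insert t F) \<subseteq> {poly g t |g. poly_over F g}"
  proof (rule gen_least[OF intermediate_poly_image[OF F]])
    have "t \<in> {poly g t |g. poly_over F g}"
      by (rule CollectI, rule exI[of _ "[:0, 1:]"])
         (auto intro!: poly_over_pCons poly_over_zero sr subring_set_one subring_set_zero)
    moreover have "c \<in> {poly g t |g. poly_over F g}" if "c \<in> F" for c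
      by (rule CollectI, rule exI[of _ "[:c:]"])
         (auto intro!: poly_over_pCons poly_over_zero sr that)
    ultimately show "insert t F \<subseteq> {poly g t |g. poly_over F g}" by auto
  qed
next
  have "poly g t \<in> gen (insert t F)" if "poly_over F g" for g
    using that gen_incl[of "insert t F"]
    by (intro subring_set_poly intermediate_subring) (auto simp: poly_over_def)
  then show "{poly g t |g. poly_over F g} \<subseteq> gen (insert t F)" by auto
qed

text \<open>Long division by a monic polynomial only multiplies and subtracts coefficients, so
  quotient and remainder never leave \<open>F\<close>.\<close>

lemma poly_over_division:
  assumes F: "subring_set F" and m: "poly_over F m" "lead_coeff m = 1" and g: "poly_over F g"
  obtains h r where "poly_over F h" "poly_over F r" "g = m * h + r" "r = 0 \<or> degree r < degree m"
proof -
  have "\<exists>h r. poly_over F h \<and> poly_over F r \<and> g = m * h + r \<and> (r = 0 \<or> degree r < degree m)"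
    using g
  proof (induction "degree g" arbitrary: g rule: less_induct)
    case less
    show ?case
    proof (cases "g = 0 \<or> degree g < degree m")
      case True
      then show ?thesis using less.prems poly_over_zero[OF F]
        by (intro exI[of _ 0] exI[of _ g]) auto
    next
      case False
      define s where "s = monom (lead_coeff g) (degree g - degree m)"
      have s: "poly_over F s"
        using less.prems unfolding s_def by (intro poly_over_monom F) (auto simp: poly_over_def)
      define g' where "g' = g - m * s"
      have g': "poly_over F g'"
        unfolding g'_def by (intro poly_over_diff poly_over_mult F m s less.prems)
      have ds: "degree (m * s) \<le> degree g"
        using False degree_mult_le[of m s] degree_monom_le[of "lead_coeff g" "degree g - degree m"]
        by (auto simp: s_def)
      have "coeff (m * s) (degree g) = lead_coeff g"
      proof -
        have "coeff (m * s) (degree m + (degree g - degree m)) = lead_coeff m * lead_coeff g"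
          unfolding s_def by (simp add: mult.commute[of m] coeff_monom_mult)
        then show ?thesis using False m by simp
      qed
      then have "coeff g' (degree g) = 0" by (simp add: g'_def)
      moreover have "degree g' \<le> degree g" unfolding g'_def by (rule degree_diff_le) (use ds in auto)
      ultimately have dg: "g' = 0 \<or> degree g' < degree g"
        by (metis le_neq_implies_less leading_coeff_0_iff)
      have "\<exists>h r. poly_over F h \<and> poly_over F r \<and> g' = m * h + r \<and> (r = 0 \<or> degree r < degree m)"
      proof (cases "g' = 0")
        case True
        then show ?thesis using poly_over_zero[OF F] by (intro exI[of _ 0]) auto
      qed (use dg less.hyps g' in auto)
      then obtain h r where "poly_over F h" "poly_over F r" "g' = m * h + r" "r = 0 \<or> degree r < degree m"
        by blast
      then show ?thesis
        by (intro exI[of _ "h + s"] exI[of _ r])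
           (auto simp: g'_def algebra_simps intro!: poly_over_add F s)
    qed
  qed
  then show ?thesis using that by blast
qed

text \<open>Algebraicity over the base field supplies a candidate. One of least degree, made monic,
  divides all others, because the remainder of a division would vanish at \<open>x\<close>
  too.\<close>

lemma minimal_poly_over:
  assumes F: "intermediate F"
  obtains m where "poly_over F m" "lead_coeff m = 1" "poly m x = 0"
    "\<And>q. poly_over F q \<Longrightarrow> poly q x = 0 \<longleftrightarrow> m dvd q"
proof -
  note sr = intermediate_subring[OF F]
  let ?P = "\<lambda>p. p \<noteq> 0 \<and> poly_over F p \<and> poly p x = 0"
  obtain p0 :: "'a poly" where p0: "p0 \<noteq> 0" "poly (map_poly to_ac p0) x = 0"
    using alg_closure_algebraic .
  have P0: "?P (map_poly to_ac p0)"
    using p0 F by (auto simp: poly_over_def coeff_map_poly intermediate_base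
      degree_map_poly_hom(4)[OF hom_to_ac])
  define p where "p = arg_min degree ?P"
  have p: "?P p" using arg_min_natI[of ?P, OF P0] by (simp add: p_def)
  have least: "degree p \<le> degree q" if "?P q" for q
    using arg_min_nat_le[of ?P q, OF that] by (simp add: p_def)
  define m where "m = smult (inverse (lead_coeff p)) p"
  have lc: "lead_coeff p \<noteq> 0" "lead_coeff p \<in> F" using p by (auto simp: poly_over_def)
  have m: "poly_over F m" "lead_coeff m = 1" "poly m x = 0" "degree m = degree p"
    using lc p by (auto simp: m_def intro!: poly_over_smult sr intermediate_inverse F)
  have "m dvd q" if q: "poly_over F q" "poly q x = 0" for q
  proof -
    obtain h r where hr: "poly_over F h" "poly_over F r" "q = m * h + r" "r = 0 \<or> degree r < degree m"
      using poly_over_division[OF sr m(1,2) q(1)] .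
    moreover have "poly r x = 0" using hr(3) q(2) m(3) by simp
    ultimately have "r = 0" using least[of r] m(4) by fastforce
    then show ?thesis using hr by simp
  qed
  then show ?thesis using that m by fastforce
qed

section \<open>Squarefree polynomials: derivatives and numbers of roots\<close>

lemma squarefree_iff:
  fixes p :: "'a::field poly"
  shows "rsquarefree p \<longleftrightarrow> p \<noteq> 0 \<and> (\<forall>a. \<not> [:-a, 1:] ^ 2 dvd p)"
proof -
  have "(order a p = 0 \<or> order a p = 1) \<longleftrightarrow> \<not> [:-a, 1:] ^ 2 dvd p" if "p \<noteq> 0" for a
    using that unfolding order_divides by auto
  then show ?thesis by (auto simp: rsquarefree_def)
qed

lemma squarefree_dvd:
  fixes p :: "'a::field poly"
  shows "rsquarefree q \<Longrightarrow> p dvd q \<Longrightarrow> rsquarefree p"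
  unfolding squarefree_iff using dvd_trans by blast

lemma squarefree_iff_pderiv:
  fixes p :: "'a::field poly"
  assumes "p \<noteq> 0"
  shows "rsquarefree p \<longleftrightarrow> (\<forall>a. poly p a = 0 \<longrightarrow> poly (pderiv p) a \<noteq> 0)"
proof -
  have "poly (pderiv p) a = 0 \<longleftrightarrow> [:-a, 1:] ^ 2 dvd p" if pa: "poly p a = 0" for a
  proof -
    obtain q where q: "p = [:-a, 1:] * q" using pa unfolding poly_eq_0_iff_dvd dvd_def by blast
    have "poly (pderiv p) a = poly q a" unfolding q pderiv_mult by (simp add: pderiv_pCons)
    moreover have "[:-a, 1:] ^ 2 dvd p \<longleftrightarrow> [:-a, 1:] dvd q"
      unfolding q power2_eq_square by (subst dvd_mult_cancel_left) auto
    ultimately show ?thesis by (simp add: poly_eq_0_iff_dvd)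
  qed
  moreover have "poly p a = 0" if "[:-a, 1:] ^ 2 dvd p" for a
    using that unfolding poly_eq_0_iff_dvd power2_eq_square by (rule dvd_mult_left)
  ultimately show ?thesis using assms by (auto simp: squarefree_iff)
qed

text \<open>Turns squarefreeness into a count of roots, which any bijection between root sets
  transports. Both directions compare degrees after splitting off a root or a double root.\<close>

lemma squarefree_card_roots:
  fixes p :: "'a::alg_closed_field poly"
  assumes "p \<noteq> 0"
  shows "rsquarefree p \<longleftrightarrow> card {x. poly p x = 0} = degree p"
proof
  show "card {x. poly p x = 0} = degree p" if "rsquarefree p"
    using that
  proof (induction "degree p" arbitrary: p rule: less_induct)
    case less
    show ?case
    proof (cases "degree p = 0")
      case True
      then obtain c where "p = [:c:]" by (metis degree_eq_zeroE)
      then show ?thesis using less.prems by (auto simp: rsquarefree_def)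
    next
      case False
      then obtain a where "poly p a = 0" using alg_closed_imp_poly_has_root by blast
      then obtain q where q: "p = [:-a, 1:] * q" unfolding poly_eq_0_iff_dvd dvd_def by blast
      have q0: "q \<noteq> 0" using False q by auto
      have dq: "degree p = Suc (degree q)" unfolding q by (subst degree_mult_eq) (use q0 in auto)
      have "rsquarefree q" by (rule squarefree_dvd[OF less.prems]) (simp only: q dvd_triv_right)
      then have IH: "card {x. poly q x = 0} = degree q" using less.hyps dq by simp
      have "poly q a \<noteq> 0"
      proof
        assume "poly q a = 0"
        then have "[:-a, 1:] ^ 2 dvd p"
          unfolding q power2_eq_square by (intro mult_dvd_mono) (auto simp: poly_eq_0_iff_dvd)
        then show False using less.prems by (auto simp: squarefree_iff)
      qed
      moreover have "{x. poly p x = 0} = insert a {x. poly q x = 0}" by (auto simp: q)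
      moreover have "finite {x. poly q x = 0}" using q0 by (rule poly_roots_finite)
      ultimately show ?thesis using IH dq by simp
    qed
  qed
next
  assume c: "card {x. poly p x = 0} = degree p"
  show "rsquarefree p"
  proof (rule ccontr)
    assume "\<not> rsquarefree p"
    then obtain a r where r: "p = [:-a, 1:] ^ 2 * r" using assms by (auto simp: squarefree_iff dvd_def)
    have r0: "r \<noteq> 0" using assms r by auto
    have d: "degree p = 2 + degree r"
      unfolding r by (subst degree_mult_eq) (use r0 in \<open>auto simp: degree_power_eq\<close>)
    have "{x. poly p x = 0} \<subseteq> insert a {x. poly r x = 0}" by (auto simp: r)
    moreover have fin: "finite {x. poly r x = 0}" using r0 by (rule poly_roots_finite)
    ultimately have "card {x. poly p x = 0} \<le> card (insert a {x. poly r x = 0})"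
      by (intro card_mono) auto
    also have "\<dots> \<le> Suc (card {x. poly r x = 0})" by (rule card_insert_le_m1) auto
    also have "\<dots> \<le> Suc (degree r)" using card_poly_roots_bound[OF r0] by simp
    finally show False using c d by simp
  qed
qed

text \<open>The hypothesis on \<open>y\<close> says that it satisfies the \<phi>-image of every
  relation of \<open>x\<close> over \<open>F\<close>. Hence the value assigned to
  \<open>g(x)\<close> does not depend on the polynomial \<open>g\<close> that represents it.\<close>

lemma hom_extend_simple:
  fixes \<phi> :: "'f::field alg_closure \<Rightarrow> 'b::field"
  assumes F: "intermediate F" and \<phi>: "hom_on F \<phi>"
    and y: "\<And>q. poly_over F q \<Longrightarrow> poly q x = 0 \<Longrightarrow> poly (map_poly \<phi> q) y = 0"
  obtains \<psi> where "hom_on (gen (insert x F)) \<psi>" "\<And>a. a \<in> F \<Longrightarrow> \<psi> a = \<phi> a" "\<psi> x = y"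
proof -
  note sr = intermediate_subring[OF F]
  note gi = gen_insert[OF F, of x]
  define \<psi> where "\<psi> = (\<lambda>a. poly (map_poly \<phi> (SOME g. poly_over F g \<and> poly g x = a)) y)"
  have \<psi>: "\<psi> (poly g x) = poly (map_poly \<phi> g) y" if g: "poly_over F g" for g
  proof -
    define h where "h = (SOME h. poly_over F h \<and> poly h x = poly g x)"
    have h: "poly_over F h" "poly h x = poly g x"
      using someI[of "\<lambda>h. poly_over F h \<and> poly h x = poly g x" g] g by (auto simp: h_def)
    have "poly (map_poly \<phi> (h - g)) y = 0"
      using h g by (intro y poly_over_diff sr) auto
    then show ?thesis
      using h(1) g by (simp add: \<psi>_def map_poly_hom_diff[OF sr \<phi>] flip: h_def)
  qed
  show ?thesis
  proof (rule that)
    have \<psi>a: "\<psi> a = \<phi> a" if "a \<in> F" for a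
      using \<psi>[of "[:a:]"] that by (simp add: poly_over_pCons poly_over_zero sr map_poly_pCons hom_on_zero[OF sr \<phi>])
    show "\<psi> a = \<phi> a" if "a \<in> F" for a using \<psi>a that .
    show "\<psi> x = y"
      using \<psi>[of "[:0,1:]"] by (simp add: poly_over_pCons poly_over_zero sr map_poly_pCons
        hom_on_zero[OF sr \<phi>] hom_on_one[OF sr \<phi>] subring_set_zero subring_set_one)
    show "hom_on (gen (insert x F)) \<psi>"
      unfolding hom_on_def
    proof (intro conjI ballI)
      show "\<psi> 1 = 1" using \<psi>a[of 1] subring_set_one[OF sr] hom_on_one[OF sr \<phi>] by simp
    next
      fix a b assume "a \<in> gen (insert x F)" "b \<in> gen (insert x F)"
      then obtain g h where gh: "poly_over F g" "a = poly g x" "poly_over F h" "b = poly h x"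
        unfolding gi by blast
      show "\<psi> (a + b) = \<psi> a + \<psi> b"
        using \<psi>[OF poly_over_add[OF sr gh(1,3)]] \<psi>[OF gh(1)] \<psi>[OF gh(3)] gh
        by (simp add: map_poly_hom_add[OF sr \<phi>])
      show "\<psi> (a * b) = \<psi> a * \<psi> b"
        using \<psi>[OF poly_over_mult[OF sr gh(1,3)]] \<psi>[OF gh(1)] \<psi>[OF gh(3)] gh
        by (simp add: map_poly_hom_mult[OF sr \<phi>])
    qed
  qed
qed

text \<open>Zorn's lemma. A maximal extension is defined everywhere: the image of the minimal
  polynomial of any \<open>x\<close> keeps its positive degree, hence has a root in the
  algebraically closed target, and that root is a legitimate value at \<open>x\<close>.\<close>

theorem hom_extend:
  fixes \<phi> :: "'f::field alg_closure \<Rightarrow> 'b::alg_closed_field"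
  assumes F: "intermediate F" and \<phi>: "hom_on F \<phi>"
  obtains \<psi> where "hom_on UNIV \<psi>" "\<And>a. a \<in> F \<Longrightarrow> \<psi> a = \<phi> a"
proof -
  \<comment> \<open>Homomorphisms with varying domains are replaced by their graphs, so that
    extension is inclusion and the union of a chain is an upper bound.\<close>
  define graph where "graph = (\<lambda>E (\<psi>::'f alg_closure \<Rightarrow> 'b). (\<lambda>x. (x, \<psi> x)) ` E)"
  define S where "S = {graph E \<psi> |E \<psi>. intermediate E \<and> hom_on E \<psi> \<and> F \<subseteq> E \<and> (\<forall>a\<in>F. \<psi> a = \<phi> a)}"
  have gr: "(x, y) \<in> graph E \<psi> \<longleftrightarrow> x \<in> E \<and> y = \<psi> x" for x y E \<psi> by (auto simp: graph_def)
  have "graph F \<phi> \<in> S" using assms by (auto simp: S_def)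
  then have ne: "S \<noteq> {}" by blast
  have union: "\<Union> C \<in> S" if "C \<noteq> {}" and chain: "subset.chain S C" for C
  proof -
    have C: "g \<in> S" if "g \<in> C" for g using that chain by (auto simp: subset.chain_def)
    have lin: "g \<subseteq> h \<or> h \<subseteq> g" if "g \<in> C" "h \<in> C" for g h
      using that chain by (auto simp: subset.chain_def)
    define E where "E = fst ` \<Union> C"
    define \<psi> where "\<psi> = (\<lambda>x. SOME y. (x, y) \<in> \<Union> C)"
    have repr: "\<exists>E' \<psi>'. g = graph E' \<psi>' \<and> intermediate E' \<and> hom_on E' \<psi>' \<and> F \<subseteq> E' \<and> (\<forall>a\<in>F. \<psi>' a = \<phi> a)"
      if "g \<in> C" for g using C[OF that] by (auto simp: S_def)
    have uniq: "y = y'" if xy: "(x, y) \<in> \<Union> C" "(x, y') \<in> \<Union> C" for x y y'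
    proof -
      obtain g h where gh: "g \<in> C" "h \<in> C" "(x, y) \<in> g" "(x, y') \<in> h" using xy by blast
      obtain k where "k \<in> C" "(x, y) \<in> k" "(x, y') \<in> k" using lin[OF gh(1,2)] gh by blast
      then show ?thesis using repr[of k] by (auto simp: gr)
    qed
    have \<psi>: "\<psi> x = y" if "(x, y) \<in> \<Union> C" for x y
      unfolding \<psi>_def using that uniq by (metis (mono_tags, lifting) someI_ex)
    have two: "\<exists>E' \<psi>'. graph E' \<psi>' \<in> C \<and> intermediate E' \<and> hom_on E' \<psi>' \<and> F \<subseteq> E' \<and>
        (\<forall>a\<in>F. \<psi>' a = \<phi> a) \<and> x \<in> E' \<and> y \<in> E'" if xy: "x \<in> E" "y \<in> E" for x y
    proof -
      obtain g h a b where gh: "g \<in> C" "h \<in> C" "(x, a) \<in> g" "(y, b) \<in> h"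
        using xy by (auto simp: E_def)
      obtain k where k: "k \<in> C" "(x, a) \<in> k" "(y, b) \<in> k" using lin[OF gh(1,2)] gh by blast
      obtain E' \<psi>' where *: "k = graph E' \<psi>'" "intermediate E'" "hom_on E' \<psi>'" "F \<subseteq> E'" "\<forall>a\<in>F. \<psi>' a = \<phi> a"
        using repr[OF k(1)] by blast
      have "graph E' \<psi>' \<in> C" "x \<in> E'" "y \<in> E'" using k by (simp_all add: *(1) gr)
      then show ?thesis using * by blast
    qed
    have inE: "E' \<subseteq> E" "\<And>x. x \<in> E' \<Longrightarrow> \<psi> x = \<psi>' x" if "graph E' \<psi>' \<in> C" for E' \<psi>'
    proof -
      have *: "(x, \<psi>' x) \<in> \<Union> C" if "x \<in> E'" for x using that \<open>graph E' \<psi>' \<in> C\<close> gr by blast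
      then show "E' \<subseteq> E" by (force simp: E_def)
      show "\<psi> x = \<psi>' x" if "x \<in> E'" for x using \<psi> * that by blast
    qed
    obtain g where "g \<in> C" using \<open>C \<noteq> {}\<close> by blast
    then obtain E0 \<psi>0 where 0: "graph E0 \<psi>0 \<in> C" "intermediate E0" "hom_on E0 \<psi>0" "F \<subseteq> E0"
      "\<forall>a\<in>F. \<psi>0 a = \<phi> a" using repr[of g] by blast
    have "intermediate E"
      unfolding intermediate_def subring_set_def
    proof (intro conjI ballI)
      show "1 \<in> E" using 0(2) inE(1)[OF 0(1)] by (auto simp: intermediate_def subring_set_def)
      show "base_field \<subseteq> E" using 0(2) inE(1)[OF 0(1)] by (auto simp: intermediate_def)
    next
      fix x y assume "x \<in> E" "y \<in> E"
      from two[OF this] obtain E' \<psi>' where *: "graph E' \<psi>' \<in> C" "intermediate E'" "x \<in> E'" "y \<in> E'"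
        by blast
      then have "x - y \<in> E'" "x * y \<in> E'" by (auto simp: intermediate_def subring_set_def)
      then show "x - y \<in> E" "x * y \<in> E" using inE(1)[OF *(1)] by auto
    qed
    moreover have "hom_on E \<psi>"
      unfolding hom_on_def
    proof (intro conjI ballI)
      show "\<psi> 1 = 1" using 0(2,3) inE(2)[OF 0(1), of 1]
        by (auto simp: intermediate_def subring_set_def hom_on_def)
    next
      fix x y assume "x \<in> E" "y \<in> E"
      from two[OF this] obtain E' \<psi>' where *: "graph E' \<psi>' \<in> C" "intermediate E'" "hom_on E' \<psi>'" "x \<in> E'" "y \<in> E'"
        by blast
      have sr: "subring_set E'" using *(2) by (rule intermediate_subring)
      show "\<psi> (x + y) = \<psi> x + \<psi> y" "\<psi> (x * y) = \<psi> x * \<psi> y"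
        using * by (auto simp: inE(2)[OF *(1)] subring_set_add[OF sr] subring_set_mult[OF sr] hom_on_simps[OF sr *(3)])
    qed
    moreover have "F \<subseteq> E" using 0 inE(1) by blast
    moreover have "\<forall>a\<in>F. \<psi> a = \<phi> a" using 0 inE(2)[OF 0(1)] by (auto simp: subset_iff)
    moreover have "\<Union> C = graph E \<psi>"
      using \<psi> by (force simp: E_def graph_def image_iff)
    ultimately show ?thesis unfolding S_def by blast
  qed
  obtain M where M: "M \<in> S" "\<And>g. g \<in> S \<Longrightarrow> M \<subseteq> g \<Longrightarrow> g = M"
    using subset_Zorn_nonempty[OF ne union] by blast
  obtain E \<psi> where E: "M = graph E \<psi>" "intermediate E" "hom_on E \<psi>" "F \<subseteq> E" "\<forall>a\<in>F. \<psi> a = \<phi> a"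
    using M(1) by (auto simp: S_def)
  have "x \<in> E" for x
  proof -
    note sr = intermediate_subring[OF E(2)]
    obtain m where m: "poly_over E m" "lead_coeff m = 1" "poly m x = 0"
      "\<And>q. poly_over E q \<Longrightarrow> poly q x = 0 \<longleftrightarrow> m dvd q"
      using minimal_poly_over[OF E(2), of x] by metis
    have "degree m \<noteq> 0"
    proof
      assume "degree m = 0"
      then obtain c where "m = [:c:]" by (metis degree_eq_zeroE)
      then show False using m(2,3) by auto
    qed
    moreover have "degree (map_poly \<psi> m) = degree m"
    proof (rule antisym)
      show "degree (map_poly \<psi> m) \<le> degree m" by (rule degree_le) (simp add: coeff_map_poly_hom[OF sr E(3)] coeff_eq_0 hom_on_zero[OF sr E(3)])
      show "degree m \<le> degree (map_poly \<psi> m)"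
        by (rule le_degree) (use m(2) in \<open>simp add: coeff_map_poly_hom[OF sr E(3)] hom_on_one[OF sr E(3)]\<close>)
    qed
    ultimately obtain y where y: "poly (map_poly \<psi> m) y = 0"
      using alg_closed_imp_poly_has_root by (metis neq0_conv)
    have "poly (map_poly \<psi> q) y = 0" if q: "poly_over E q" "poly q x = 0" for q
    proof -
      obtain h r where hr: "poly_over E h" "poly_over E r" "q = m * h + r" "r = 0 \<or> degree r < degree m"
        using poly_over_division[OF sr m(1,2) q(1)] .
      have "r = 0"
      proof (rule ccontr)
        assume "r \<noteq> 0"
        moreover have "poly r x = 0" using q(2) m(3) by (simp add: hr(3))
        then have "m dvd r" using m(4)[OF hr(2)] by simp
        ultimately show False using hr(4) dvd_imp_degree_le[of m r] by simp
      qed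
      then show ?thesis using hr y by (simp add: map_poly_hom_mult[OF sr E(3) m(1) hr(1)])
    qed
    from hom_extend_simple[OF E(2,3) this]
    obtain \<psi>' where \<psi>': "hom_on (gen (insert x E)) \<psi>'" "\<And>a. a \<in> E \<Longrightarrow> \<psi>' a = \<psi> a" by blast
    let ?E = "gen (insert x E)"
    have sub: "insert x E \<subseteq> ?E" by (rule gen_incl)
    have "graph ?E \<psi>' \<in> S"
      unfolding S_def using \<psi>' E sub by (intro CollectI exI[of _ ?E] exI[of _ \<psi>']) auto
    moreover have "M \<subseteq> graph ?E \<psi>'" using \<psi>'(2) sub by (auto simp: E(1) graph_def)
    ultimately have "graph ?E \<psi>' = graph E \<psi>" using M(2) E(1) by blast
    moreover have "(x, \<psi>' x) \<in> graph ?E \<psi>'" using sub by (auto simp: graph_def)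
    ultimately show "x \<in> E" by (simp add: gr)
  qed
  then have "E = UNIV" by blast
  then show ?thesis using that[of \<psi>] E by auto
qed


section \<open>The automorphism group of the algebraic closure\<close>

text \<open>These are a priori endomorphisms; \<open>Gal_bij\<close> shows that they are bijective.
  Adding \<open>base_field\<close> allows \<open>F\<close> to be any set of generators, even the
  empty one.\<close>

definition Gal :: "'f::field alg_closure set \<Rightarrow> ('f alg_closure \<Rightarrow> 'f alg_closure) set" where
  "Gal F = {\<sigma>. hom_on UNIV \<sigma> \<and> (\<forall>x\<in>base_field \<union> F. \<sigma> x = x)}"

lemma GalD:
  assumes "\<sigma> \<in> Gal F"
  shows Gal_hom: "hom_on UNIV \<sigma>" and Gal_fixes: "x \<in> F \<Longrightarrow> \<sigma> x = x" and Gal_base: "\<sigma> (to_ac c) = to_ac c"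
  using assms by (auto simp: Gal_def)

lemma Gal_mono: "F \<subseteq> F' \<Longrightarrow> Gal F' \<subseteq> Gal F"
  by (auto simp: Gal_def)

lemma Gal_empty: "\<sigma> \<in> Gal F \<Longrightarrow> \<sigma> \<in> Gal {}"
  using Gal_mono[of "{}" F] by auto

lemma Gal_simps:
  assumes "\<sigma> \<in> Gal F"
  shows "\<sigma> 0 = 0" "\<sigma> 1 = 1" "\<sigma> (x + y) = \<sigma> x + \<sigma> y" "\<sigma> (x * y) = \<sigma> x * \<sigma> y" "\<sigma> (- x) = - \<sigma> x"
    "\<sigma> (x - y) = \<sigma> x - \<sigma> y" "\<sigma> (x ^ n) = \<sigma> x ^ n" "\<sigma> (inverse x) = inverse (\<sigma> x)"
    "\<sigma> (x / y) = \<sigma> x / \<sigma> y" "\<sigma> x = 0 \<longleftrightarrow> x = 0" "\<sigma> x = \<sigma> y \<longleftrightarrow> x = y"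
proof -
  note h = Gal_hom[OF assms]
  show "\<sigma> 0 = 0" "\<sigma> 1 = 1" "\<sigma> (x + y) = \<sigma> x + \<sigma> y" and m: "\<sigma> (x * y) = \<sigma> x * \<sigma> y" for x y
    by (simp_all add: hom_simps[OF h])
  show "\<sigma> (- x) = - \<sigma> x" "\<sigma> (x - y) = \<sigma> x - \<sigma> y" "\<sigma> (x ^ n) = \<sigma> x ^ n"
    by (simp_all add: hom_simps[OF h])
  show "\<sigma> (inverse x) = inverse (\<sigma> x)" "\<sigma> (x / y) = \<sigma> x / \<sigma> y"
    by (simp_all add: divide_inverse m hom_on_inverse[OF h])
  show "\<sigma> x = 0 \<longleftrightarrow> x = 0" "\<sigma> x = \<sigma> y \<longleftrightarrow> x = y"
    using degree_map_poly_hom(1)[OF h] degree_map_poly_hom(3)[OF h] by (auto simp: inj_on_def)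
qed

lemma Gal_poly:
  assumes "\<sigma> \<in> Gal F"
  shows "\<sigma> (poly p x) = poly (map_poly \<sigma> p) (\<sigma> x)"
  by (rule hom_poly[OF Gal_hom[OF assms]]) auto

lemma Gal_map_poly: "\<sigma> \<in> Gal F \<Longrightarrow> poly_over (base_field \<union> F) p \<Longrightarrow> map_poly \<sigma> p = p"
  by (rule poly_eqI) (auto simp: coeff_map_poly Gal_simps poly_over_def Gal_def)

lemma Gal_root_iff:
  assumes "\<sigma> \<in> Gal F" "poly_over (base_field \<union> F) p"
  shows "poly p (\<sigma> x) = 0 \<longleftrightarrow> poly p x = 0"
  using Gal_poly[OF assms(1), of p x] Gal_map_poly[OF assms] Gal_simps(10)[OF assms(1), of "poly p x"]
  by simp

lemma finite_orbit: "finite {\<sigma> x |\<sigma>. \<sigma> \<in> Gal {}}"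
proof -
  obtain p :: "'a poly" where p: "p \<noteq> 0" "poly (map_poly to_ac p) x = 0"
    using alg_closure_algebraic .
  have "finite {y. poly (map_poly to_ac p) y = 0}"
    using p(1) by (intro poly_roots_finite) (simp add: degree_map_poly_hom(4)[OF hom_to_ac])
  moreover have "{\<sigma> x |\<sigma>. \<sigma> \<in> Gal {}} \<subseteq> {y. poly (map_poly to_ac p) y = 0}"
  proof -
    have "poly_over (base_field \<union> {}) (map_poly to_ac p)" by (auto simp: poly_over_base)
    from Gal_root_iff[OF _ this] p(2) show ?thesis by auto
  qed
  ultimately show ?thesis by (rule finite_subset[rotated])
qed

text \<open>An injective map of the finite orbit of \<open>x\<close> into itself is onto, and
  \<open>x\<close> belongs to its own orbit.\<close>

lemma Gal_bij:
  assumes \<sigma>: "\<sigma> \<in> Gal F"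
  shows "bij \<sigma>"
proof (rule bijI)
  show inj: "inj \<sigma>" using Gal_simps(11)[OF \<sigma>] by (auto simp: inj_on_def)
  show "surj \<sigma>"
  proof -
    have "x \<in> range \<sigma>" for x
    proof -
      let ?O = "{\<tau> x |\<tau>. \<tau> \<in> Gal {}}"
      have "\<sigma> ` ?O \<subseteq> ?O"
      proof
        fix y assume "y \<in> \<sigma> ` ?O"
        then obtain \<tau> where \<tau>: "\<tau> \<in> Gal {}" "y = (\<sigma> \<circ> \<tau>) x" by auto
        have "\<sigma> \<circ> \<tau> \<in> Gal {}"
          using \<tau>(1) \<sigma> by (auto simp: Gal_def hom_on_def)
        then show "y \<in> ?O" using \<tau>(2) by blast
      qed
      then have "\<sigma> ` ?O = ?O"
        using finite_orbit[of x] inj by (meson endo_inj_surj inj_on_subset subset_UNIV)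
      moreover have "x \<in> ?O" by (rule CollectI, rule exI[of _ id]) (auto simp: Gal_def hom_on_def)
      ultimately show ?thesis by blast
    qed
    then show ?thesis by blast
  qed
qed

lemma Gal_comp: "\<sigma> \<in> Gal F \<Longrightarrow> \<tau> \<in> Gal F \<Longrightarrow> \<sigma> \<circ> \<tau> \<in> Gal F"
  by (auto simp: Gal_def hom_on_def)

lemma Gal_id: "id \<in> Gal F"
  by (auto simp: Gal_def hom_on_def)

lemma Gal_inv:
  assumes \<sigma>: "\<sigma> \<in> Gal F"
  shows "inv_into UNIV \<sigma> \<in> Gal F" "inv_into UNIV \<sigma> (\<sigma> x) = x" "\<sigma> (inv_into UNIV \<sigma> x) = x"
proof -
  have b: "bij \<sigma>" by (rule Gal_bij[OF \<sigma>])
  show 1: "inv_into UNIV \<sigma> (\<sigma> x) = x" "\<sigma> (inv_into UNIV \<sigma> x) = x" for x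
    using b by (auto simp: bij_is_inj inv_f_f bij_is_surj surj_f_inv_f)
  have eq: "inv_into UNIV \<sigma> a = b" if "\<sigma> b = a" for a b using that 1 by auto
  show "inv_into UNIV \<sigma> \<in> Gal F"
    unfolding Gal_def hom_on_def
    using 1 \<sigma> by (auto intro!: eq simp: Gal_simps[OF \<sigma>] GalD[OF \<sigma>])
qed

lemma intermediate_equalizer:
  assumes "\<sigma> \<in> Gal F" "\<tau> \<in> Gal F'"
  shows "intermediate {x. \<sigma> x = \<tau> x}"
  by (auto simp: intermediate_def subring_set_def Gal_simps[OF assms(1)] Gal_simps[OF assms(2)]
     GalD[OF assms(1)] GalD[OF assms(2)])

text \<open>The elements on which two automorphisms agree form an intermediate field, so agreement
  spreads from generators.\<close>

lemma Gal_agree_gen: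
  assumes "\<sigma> \<in> Gal F" "\<tau> \<in> Gal F'" "\<And>t. t \<in> T \<Longrightarrow> \<sigma> t = \<tau> t" "x \<in> gen T"
  shows "\<sigma> x = \<tau> x"
  using gen_least[OF intermediate_equalizer[OF assms(1,2)], of T] assms(3,4) by auto

lemma Gal_gen: "Gal (gen T) = Gal T"
proof
  show "Gal T \<subseteq> Gal (gen T)"
  proof
    fix \<sigma> assume s: "\<sigma> \<in> Gal T"
    have "\<sigma> x = x" if "x \<in> gen T" for x
      using Gal_agree_gen[OF s Gal_id[of T], of T x] Gal_fixes[OF s] that by auto
    then show "\<sigma> \<in> Gal (gen T)" using s by (auto simp: Gal_def)
  qed
qed (rule Gal_mono[OF gen_incl])

lemma intermediate_preimage:
  assumes "\<sigma> \<in> Gal F" "intermediate E"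
  shows "intermediate {x. \<sigma> x \<in> E}"
  using intermediate_subring[OF assms(2)] assms(2)
  by (auto simp: intermediate_def subring_set_def Gal_simps[OF assms(1)] GalD[OF assms(1)])

text \<open>The identity of \<open>F\<close> is extended to \<open>F[x]\<close> with value
  \<open>y\<close> at \<open>x\<close>, and from there to the whole closure.\<close>

lemma Gal_conj:
  assumes F: "intermediate F" and "\<And>q. poly_over F q \<Longrightarrow> poly q x = 0 \<Longrightarrow> poly q y = 0"
  obtains \<sigma> where "\<sigma> \<in> Gal F" "\<sigma> x = y"
proof -
  note sr = intermediate_subring[OF F]
  have h: "hom_on F (\<lambda>x. x)" by (auto simp: hom_on_def)
  have mp: "map_poly (\<lambda>x. x) q = q" for q :: "'a alg_closure poly" by (simp add: map_poly_idI)
  obtain \<psi> where \<psi>: "hom_on (gen (insert x F)) \<psi>" "\<And>a. a \<in> F \<Longrightarrow> \<psi> a = a" "\<psi> x = y"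
    using hom_extend_simple[OF F h, of x y] assms(2) by (auto simp: mp)
  obtain \<sigma> where \<sigma>: "hom_on UNIV \<sigma>" "\<And>a. a \<in> gen (insert x F) \<Longrightarrow> \<sigma> a = \<psi> a"
    using hom_extend[OF intermediate_gen \<psi>(1)] by blast
  have sub: "insert x F \<subseteq> gen (insert x F)" by (rule gen_incl)
  show ?thesis
  proof (rule that)
    show "\<sigma> x = y" using \<sigma>(2)[of x] sub \<psi>(3) by auto
    have "\<sigma> a = a" if "a \<in> F" for a using \<sigma>(2)[of a] sub \<psi>(2)[of a] that by auto
    moreover have "base_field \<subseteq> F" using F by (simp add: intermediate_def)
    ultimately show "\<sigma> \<in> Gal F" using \<sigma>(1) by (auto simp: Gal_def)
  qed
qed

section \<open>Fixed elements of separable extensions\<close>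

definition separable_over :: "'f::field alg_closure set \<Rightarrow> 'f alg_closure \<Rightarrow> bool" where
  "separable_over F t \<longleftrightarrow> (\<exists>q. poly_over F q \<and> rsquarefree q \<and> poly q t = 0)"

text \<open>Write \<open>x = r(t)\<close> with \<open>r\<close> of smaller degree than the minimal
  polynomial \<open>m\<close> of \<open>t\<close>. Every root of \<open>m\<close> is a conjugate of
  \<open>t\<close>, so \<open>r - x\<close> vanishes at all of them; separability makes these too
  many unless \<open>r\<close> is the constant \<open>x\<close>.\<close>

lemma fixed_simple:
  assumes F: "intermediate F" and t: "separable_over F t" and x: "x \<in> gen (insert t F)"
    and fix_x: "\<And>\<sigma>. \<sigma> \<in> Gal F \<Longrightarrow> \<sigma> x = x"
  shows "x \<in> F"
proof -
  note sr = intermediate_subring[OF F]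
  obtain m where m: "poly_over F m" "lead_coeff m = 1" "poly m t = 0"
    "\<And>q. poly_over F q \<Longrightarrow> poly q t = 0 \<longleftrightarrow> m dvd q"
    using minimal_poly_over[OF F, of t] by metis
  obtain g where g: "poly_over F g" "x = poly g t" using x by (auto simp: gen_insert[OF F])
  obtain h r where hr: "poly_over F h" "poly_over F r" "g = m * h + r" "r = 0 \<or> degree r < degree m"
    using poly_over_division[OF sr m(1,2) g(1)] .
  have xr: "x = poly r t" using g(2) hr(3) m(3) by simp
  have "m \<noteq> 0" using m(2) by auto
  obtain q where q: "poly_over F q" "rsquarefree q" "poly q t = 0" using t by (auto simp: separable_over_def)
  have "rsquarefree m" using squarefree_dvd[OF q(2)] m(4) q by blast
  then have card: "card {y. poly m y = 0} = degree m" using squarefree_card_roots \<open>m \<noteq> 0\<close> by blast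
  have roots: "poly (r - [:x:]) y = 0" if y: "poly m y = 0" for y
  proof -
    have "poly q y = 0" if "poly_over F q" "poly q t = 0" for q
      using m(4)[OF that(1)] that(2) y by auto
    then obtain \<sigma> where \<sigma>: "\<sigma> \<in> Gal F" "\<sigma> t = y" using Gal_conj[OF F] by blast
    have "map_poly \<sigma> r = r" by (rule Gal_map_poly[OF \<sigma>(1)]) (rule poly_over_mono[OF hr(2)], auto)
    then have "\<sigma> x = poly r y" using Gal_poly[OF \<sigma>(1), of r t] \<sigma>(2) xr by simp
    then show ?thesis using fix_x[OF \<sigma>(1)] by simp
  qed
  have dm: "degree m > 0"
  proof (rule ccontr)
    assume "\<not> degree m > 0"
    then obtain c where "m = [:c:]" by (metis degree_eq_zeroE neq0_conv)
    then show False using m(2,3) by auto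
  qed
  have "r - [:x:] = 0"
  proof (rule ccontr)
    assume nz: "r - [:x:] \<noteq> 0"
    have "card {y. poly m y = 0} \<le> card {y. poly (r - [:x:]) y = 0}"
      using roots poly_roots_finite[OF nz] by (intro card_mono) auto
    also have "\<dots> \<le> degree (r - [:x:])" by (rule card_poly_roots_bound[OF nz])
    also have "\<dots> < degree m"
      using hr(4) dm by (intro degree_diff_less) auto
    finally show False using card by simp
  qed
  then have "x = coeff r 0" by simp
  then show ?thesis using hr(2) by (simp add: poly_over_def)
qed

lemma separable_over_mono: "separable_over F t \<Longrightarrow> F \<subseteq> F' \<Longrightarrow> separable_over F' t"
  unfolding separable_over_def using poly_over_mono by blast

text \<open>One generator at a time: an element fixed over \<open>F\<close> is also fixed by the
  smaller group over \<open>F\<close> and the remaining generators.\<close>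

lemma fixed_separable:
  assumes "finite T" and F: "intermediate F" and "\<And>t. t \<in> T \<Longrightarrow> separable_over F t"
    and "x \<in> gen (F \<union> T)" and "\<And>\<sigma>. \<sigma> \<in> Gal F \<Longrightarrow> \<sigma> x = x"
  shows "x \<in> F"
  using assms
proof (induction T)
  case empty
  then show ?case using gen_idem[OF F] by simp
next
  case (insert t T)
  let ?F = "gen (F \<union> T)"
  have sub: "F \<subseteq> ?F" using gen_incl[of "F \<union> T"] by auto
  have "gen (insert t ?F) = gen (F \<union> insert t T)"
    using gen_gen_Un[of "F \<union> T" "{t}"] by simp
  then have "x \<in> ?F"
    using insert.prems separable_over_mono[OF _ sub] Gal_mono[OF sub]
    by (intro fixed_simple[of ?F t x]) auto
  then show ?case using insert.IH insert.prems by auto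
qed

lemma squarefree_map_poly:
  assumes \<sigma>: "\<sigma> \<in> Gal F" and q: "rsquarefree q"
  shows "rsquarefree (map_poly \<sigma> q)"
proof -
  have q0: "q \<noteq> 0" using q by (auto simp: rsquarefree_def)
  note deg = degree_map_poly_hom[OF Gal_hom[OF \<sigma>]]
  have "{y. poly (map_poly \<sigma> q) y = 0} = \<sigma> ` {y. poly q y = 0}"
  proof safe
    fix y assume "poly (map_poly \<sigma> q) y = 0"
    then have "\<sigma> (poly q (inv_into UNIV \<sigma> y)) = 0" using Gal_poly[OF \<sigma>] Gal_inv[OF \<sigma>] by simp
    then have "poly q (inv_into UNIV \<sigma> y) = 0" using Gal_simps[OF \<sigma>] by simp
    then show "y \<in> \<sigma> ` {y. poly q y = 0}" using Gal_inv(3)[OF \<sigma>, of y] by force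
  next
    fix y assume "poly q y = 0"
    then show "poly (map_poly \<sigma> q) (\<sigma> y) = 0" using Gal_poly[OF \<sigma>, of q y] Gal_simps[OF \<sigma>] by simp
  qed
  moreover have "card (\<sigma> ` {y. poly q y = 0}) = card {y. poly q y = 0}"
    by (intro card_image inj_on_subset[OF deg(3)]) auto
  ultimately show ?thesis
    using q q0 squarefree_card_roots[of q] squarefree_card_roots[of "map_poly \<sigma> q"] deg by auto
qed

text \<open>The last clause is descent to the base field. It makes the orbit polynomial of any
  element of \<open>N\<close> a polynomial over the base field; this is how separability of all
  elements of a generated field is obtained.\<close>

definition galois :: "'f::field alg_closure set \<Rightarrow> bool" where
  "galois N \<longleftrightarrow> intermediate N \<and> (\<forall>\<sigma>\<in>Gal {}. \<sigma> ` N \<subseteq> N) \<and>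
     (\<forall>x\<in>N. (\<forall>\<sigma>\<in>Gal {}. \<sigma> x = x) \<longrightarrow> x \<in> base_field)"

lemma galois_base_field: "galois base_field"
  by (auto simp: galois_def GalD)

text \<open>Automorphisms may move \<open>q\<close>, since its coefficients lie only in
  \<open>N\<close>. Therefore all conjugates of its roots are adjoined; each is a root of some
  squarefree \<sigma>-image of \<open>q\<close> over \<open>N\<close>, and
  \<open>fixed_separable\<close> leads back from the new field to \<open>N\<close>.\<close>

lemma galois_adjoin:
  assumes N: "galois N" and q: "poly_over N q" "rsquarefree q"
  obtains N' where "galois N'" "N \<subseteq> N'" "{x. poly q x = 0} \<subseteq> N'"
proof -
  have iN: "intermediate N" using N by (simp add: galois_def)
  define T where "T = (\<Union>x\<in>{x. poly q x = 0}. {\<sigma> x |\<sigma>. \<sigma> \<in> Gal {}})"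
  have q0: "q \<noteq> 0" using q by (auto simp: rsquarefree_def)
  have fin: "finite T" unfolding T_def
    by (intro finite_UN_I poly_roots_finite q0 finite_orbit)
  have sep: "separable_over N t" if t: "t \<in> T" for t
  proof -
    obtain x \<sigma> where x: "poly q x = 0" "\<sigma> \<in> Gal {}" "t = \<sigma> x" using t by (auto simp: T_def)
    have "poly_over N (map_poly \<sigma> q)"
      using q(1) N x(2) by (auto simp: poly_over_def coeff_map_poly Gal_simps[OF x(2)] galois_def)
    moreover have "poly (map_poly \<sigma> q) t = 0" using Gal_poly[OF x(2), of q x] x Gal_simps[OF x(2)] by simp
    ultimately show ?thesis using squarefree_map_poly[OF x(2) q(2)] by (auto simp: separable_over_def)
  qed
  define N' where "N' = gen (N \<union> T)"
  have sub: "N \<union> T \<subseteq> N'" unfolding N'_def by (rule gen_incl)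
  have "\<sigma> ` N' \<subseteq> N'" if \<sigma>: "\<sigma> \<in> Gal {}" for \<sigma>
  proof -
    have "\<sigma> t \<in> T" if "t \<in> T" for t
    proof -
      obtain x \<tau> where "poly q x = 0" "\<tau> \<in> Gal {}" "t = \<tau> x" using \<open>t \<in> T\<close> by (auto simp: T_def)
      moreover then have "\<sigma> t = (\<sigma> \<circ> \<tau>) x" "\<sigma> \<circ> \<tau> \<in> Gal {}" using Gal_comp[OF \<sigma>] by auto
      ultimately show ?thesis unfolding T_def by blast
    qed
    then have "N \<union> T \<subseteq> {x. \<sigma> x \<in> N'}"
      using N \<sigma> sub by (auto simp: galois_def image_subset_iff subset_iff)
    then have "gen (N \<union> T) \<subseteq> {x. \<sigma> x \<in> N'}"
      by (rule gen_least[OF intermediate_preimage[OF \<sigma>], rotated]) (simp add: N'_def)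
    then have "N' \<subseteq> {x. \<sigma> x \<in> N'}" by (simp add: N'_def)
    then show ?thesis by auto
  qed
  moreover have "x \<in> base_field" if x: "x \<in> N'" "\<forall>\<sigma>\<in>Gal {}. \<sigma> x = x" for x
  proof -
    have "x \<in> N" using fixed_separable[OF fin iN sep, of x] x Gal_empty unfolding N'_def by blast
    then show ?thesis using N x(2) by (auto simp: galois_def)
  qed
  ultimately have "galois N'" by (auto simp: galois_def N'_def)
  moreover have "{x. poly q x = 0} \<subseteq> T"
    unfolding T_def by (force intro: exI[of _ id] Gal_id)
  ultimately show ?thesis using that sub by blast
qed

lemma minimal_poly_base:
  fixes x :: "'f::field alg_closure"
  obtains p :: "'f poly" where "irred p"
    "\<And>q. poly (map_poly to_ac q) x = 0 \<longleftrightarrow> map_poly to_ac p dvd map_poly to_ac q"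
proof -
  obtain m where m: "poly_over base_field m" "lead_coeff m = 1" "poly m x = 0"
    "\<And>q. poly_over base_field q \<Longrightarrow> poly q x = 0 \<longleftrightarrow> m dvd q"
    using minimal_poly_over[OF intermediate_base_field] by metis
  obtain p where p: "m = map_poly to_ac p" using m(1) by (auto simp: poly_over_base)
  note deg = degree_map_poly_hom[OF hom_to_ac]
  have *: "poly (map_poly to_ac q) x = 0 \<longleftrightarrow> map_poly to_ac p dvd map_poly to_ac q" for q
    using m(4)[of "map_poly to_ac q"] unfolding poly_over_base p by blast
  have p0: "p \<noteq> 0" using m(2) p by auto
  have dp: "degree p > 0"
  proof (rule ccontr)
    assume "\<not> degree p > 0"
    then obtain c where "p = [:c:]" by (metis degree_eq_zeroE neq0_conv)
    then show False using m(3) p0 by (simp add: p map_poly_pCons)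
  qed
  have "irred p"
  proof (rule Factorial_Ring.irreducibleI)
    show "p \<noteq> 0" by (rule p0)
    show "\<not> p dvd 1" using dp by (auto simp: is_unit_iff_degree p0)
    fix a b assume ab: "p = a * b"
    then have nz: "a \<noteq> 0" "b \<noteq> 0" using p0 by auto
    have dab: "degree p = degree a + degree b" unfolding ab by (rule degree_mult_eq) (use nz in auto)
    have "map_poly to_ac p = map_poly to_ac a * map_poly to_ac b"
      unfolding ab by (rule map_hom_mult[OF hom_to_ac]) auto
    then have "poly (map_poly to_ac a) x = 0 \<or> poly (map_poly to_ac b) x = 0"
      using m(3) p by simp
    moreover have "degree p \<le> degree c"
      if "poly (map_poly to_ac c) x = 0" "c \<noteq> 0" for c
      using dvd_imp_degree_le[of "map_poly to_ac p" "map_poly to_ac c"] that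
      by (simp add: deg flip: *)
    ultimately have "degree p \<le> degree a \<or> degree p \<le> degree b" using nz by blast
    then show "a dvd 1 \<or> b dvd 1" using dab nz by (auto simp: is_unit_iff_degree)
  qed
  then show ?thesis using that * by blast
qed

text \<open>The minimal polynomial divides every squarefree polynomial over the base field that
  vanishes at \<open>x\<close>, and inherits squarefreeness.\<close>

lemma separable_element_iff: "separable_element x \<longleftrightarrow> separable_over base_field x"
proof
  assume "separable_over base_field x"
  then obtain q where q: "rsquarefree (map_poly to_ac q)" "poly (map_poly to_ac q) x = 0"
    by (auto simp: separable_over_def poly_over_base)
  obtain p :: "'a poly" where p: "irred p"
    "\<And>q. poly (map_poly to_ac q) x = 0 \<longleftrightarrow> map_poly to_ac p dvd map_poly to_ac q"
    using minimal_poly_base[of x] by blast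
  have "map_poly to_ac p dvd map_poly to_ac q" using p(2)[of q] q(2) by simp
  then have "rsquarefree (map_poly to_ac p)" by (rule squarefree_dvd[OF q(1)])
  then show "separable_element x"
    unfolding separable_element_def using p(1) p(2)[of p] by auto
qed (auto simp: separable_element_def separable_over_def poly_over_base)

text \<open>The product of all \<open>X - a\<close> over the orbit of \<open>x\<close> has distinct
  roots and is invariant, because every automorphism permutes the finite orbit; by descent its
  coefficients lie in the base field.\<close>

lemma galois_separable:
  assumes N: "galois N" and x: "x \<in> N"
  shows "separable_element x"
proof -
  define O' where "O' = {\<sigma> x |\<sigma>. \<sigma> \<in> Gal {}}"
  have fin: "finite O'" unfolding O'_def by (rule finite_orbit)
  have ON: "O' \<subseteq> N" using N x by (auto simp: O'_def galois_def)
  define P where "P = (\<Prod>a\<in>O'. [:-a, 1:])"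
  have sr: "subring_set N" using N by (simp add: galois_def intermediate_def)
  have PN: "poly_over N P" unfolding P_def using ON
    by (intro poly_over_prod sr poly_over_pCons poly_over_zero subring_set_one subring_set_uminus) auto
  have deg: "degree P = card O'" unfolding P_def by (subst degree_prod_eq_sum_degree) auto
  have P0: "P \<noteq> 0" using fin by (auto simp: P_def)
  have roots: "{y. poly P y = 0} = O'" using fin by (auto simp: P_def poly_prod)
  have sq: "rsquarefree P" using squarefree_card_roots[OF P0] roots deg by simp
  have mP': "map_poly \<sigma> P = P" if \<sigma>: "\<sigma> \<in> Gal {}" for \<sigma>
  proof -
    have "\<sigma> ` O' \<subseteq> O'"
    proof
      fix y assume "y \<in> \<sigma> ` O'"
      then obtain \<tau> where \<tau>: "\<tau> \<in> Gal {}" "y = (\<sigma> \<circ> \<tau>) x" by (auto simp: O'_def)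
      then show "y \<in> O'" unfolding O'_def using Gal_comp[OF \<sigma> \<tau>(1)] by blast
    qed
    moreover have inj: "inj_on \<sigma> O'" using Gal_bij[OF \<sigma>] by (meson bij_is_inj inj_on_subset subset_UNIV)
    ultimately have eq: "\<sigma> ` O' = O'" by (rule endo_inj_surj[OF fin])
    have "map_poly \<sigma> P = (\<Prod>a\<in>O'. map_poly \<sigma> [:-a, 1:])"
      unfolding P_def by (rule map_hom_prod[OF Gal_hom[OF \<sigma>]]) auto
    also have "\<dots> = (\<Prod>a\<in>O'. [:- \<sigma> a, 1:])"
      by (simp add: map_poly_pCons Gal_simps[OF \<sigma>])
    also have "\<dots> = (\<Prod>a\<in>\<sigma> ` O'. [:- a, 1:])" by (simp add: prod.reindex[OF inj])
    finally show ?thesis by (simp add: eq P_def)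
  qed
  then have mP: "\<sigma> (coeff P i) = coeff P i" if "\<sigma> \<in> Gal {}" for \<sigma> i
  proof -
    have "coeff (map_poly \<sigma> P) i = \<sigma> (coeff P i)"
      by (rule coeff_map_poly) (rule Gal_simps(1)[OF that])
    then show ?thesis using mP'[OF that] by simp
  qed
  have "poly_over base_field P"
    using N PN mP by (auto simp: poly_over_def galois_def)
  moreover have "poly P x = 0"
  proof -
    have "x \<in> O'" unfolding O'_def by (force intro: exI[of _ id] Gal_id)
    then show ?thesis using roots by auto
  qed
  ultimately show ?thesis unfolding separable_element_iff separable_over_def using sq by blast
qed

section \<open>Polynomials over power series\<close>

instance fps :: (field) semiring_gcd_mult_normalize ..

abbreviation res :: "'a::zero fps \<Rightarrow> 'a" where "res f \<equiv> fps_nth f 0"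

lemma hom_res: "hom_on UNIV (res :: 'a::comm_ring_1 fps \<Rightarrow> 'a)"
  by (simp add: hom_on_def)

lemma res_poly: "res (poly q x) = poly (map_poly res q) (res x)" for q :: "'a::comm_ring_1 fps poly"
  by (rule hom_poly[OF hom_res]) auto

lemma map_poly_pderiv:
  fixes \<phi> :: "'a::idom \<Rightarrow> 'b::idom"
  assumes "hom_on UNIV \<phi>"
  shows "map_poly \<phi> (pderiv p) = pderiv (map_poly \<phi> p)"
proof -
  have "\<phi> (of_nat n) = of_nat n" for n
    by (induction n) (auto simp: hom_simps[OF assms])
  then show ?thesis
    by (simp add: poly_eq_iff coeff_pderiv coeff_map_hom[OF assms]
      hom_simps[OF assms])
qed

section \<open>Hensel's lemma for power series over a field\<close>

lemma taylor2:
  fixes q :: "'a::idom poly"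
  shows "\<exists>s. poly q (x + h) = poly q x + h * poly (pderiv q) x + h\<^sup>2 * s"
proof (induction q)
  case (pCons a q)
  then obtain s where s: "poly q (x + h) = poly q x + h * poly (pderiv q) x + h\<^sup>2 * s" by blast
  show ?case
    unfolding poly_pCons s pderiv_pCons
    by (rule exI[of _ "x * s + poly (pderiv q) x + h * s"])
       (simp add: algebra_simps power2_eq_square)
qed auto

lemma X_power_dvd_iff: "fps_X ^ n dvd f \<longleftrightarrow> (\<forall>k<n. fps_nth f k = 0)" for f :: "'a::comm_ring_1 fps"
proof
  assume "fps_X ^ n dvd f"
  then show "\<forall>k<n. fps_nth f k = 0" by (auto simp: fps_X_power_mult_nth elim!: dvdE)
next
  assume "\<forall>k<n. fps_nth f k = 0"
  then have "f = fps_X ^ n * fps_shift n f"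
    by (intro fps_ext) (simp add: fps_X_power_mult_nth)
  then show "fps_X ^ n dvd f" by (metis dvd_triv_left)
qed

lemma diff_dvd_poly_diff: "x - y dvd poly q x - poly q y" for q :: "'a::comm_ring_1 poly"
proof (induction q)
  case (pCons a q)
  then obtain k where k: "poly q x - poly q y = (x - y) * k" by (elim dvdE)
  have "poly (pCons a q) x - poly (pCons a q) y = (x - y) * poly q x + y * (poly q x - poly q y)"
    by (simp add: algebra_simps)
  also have "\<dots> = (x - y) * (poly q x + y * k)" by (simp add: k algebra_simps)
  finally show ?case by simp
qed simp

lemma hensel:
  fixes q :: "'a::field fps poly"
  assumes root: "poly (map_poly res q) c = 0" and simple: "poly (pderiv (map_poly res q)) c \<noteq> 0"
  obtains r where "poly q r = 0" "res r = c"
proof -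
  define P where "P = (\<lambda>n x. res x = c \<and> fps_X ^ Suc n dvd poly q x)"
  have "\<exists>x. \<forall>n. P n (x n) \<and> fps_X ^ Suc n dvd x (Suc n) - x n"
  proof (rule dependent_nat_choice)
    show "\<exists>x. P 0 x"
      by (rule exI[of _ "fps_const c"]) (use root in \<open>simp add: P_def X_power_dvd_iff res_poly del: power_Suc\<close>)
  next
    fix x n assume x: "P n x"
    then obtain f where f: "poly q x = fps_X ^ Suc n * f" unfolding P_def by (elim conjE dvdE)
    let ?d = "poly (pderiv q) x"
    have d: "res ?d \<noteq> 0"
      using simple x by (simp add: P_def res_poly map_poly_pderiv[OF hom_res])
    \<comment> \<open>The correction of order \<open>n + 1\<close> cancels the lowest coefficient
      \<open>res f\<close> of \<open>q(x)\<close>; the quadratic Taylor term has order at least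
      \<open>2n + 2\<close> and does not interfere.\<close>
    define h where "h = fps_X ^ Suc n * fps_const (- res f / res ?d)"
    obtain s where s: "poly q (x + h) = poly q x + h * ?d + h\<^sup>2 * s" using taylor2 by blast
    have h2: "h\<^sup>2 = fps_X ^ Suc n * (fps_X * (fps_X ^ n * (fps_const (- res f / res ?d))\<^sup>2))"
      unfolding h_def power_mult_distrib power2_eq_square by (simp add: algebra_simps)
    have "poly q (x + h) = fps_X ^ Suc n *
        (f + fps_const (- res f / res ?d) * ?d + fps_X * (fps_X ^ n * (fps_const (- res f / res ?d))\<^sup>2 * s))"
      unfolding s f h2 by (simp only: h_def algebra_simps)
    moreover have "fps_X ^ 1 dvd f + fps_const (- res f / res ?d) * ?d
        + fps_X * (fps_X ^ n * (fps_const (- res f / res ?d))\<^sup>2 * s)"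
      unfolding X_power_dvd_iff using d by simp
    ultimately have "fps_X ^ Suc n * fps_X ^ 1 dvd poly q (x + h)"
      by (metis mult_dvd_mono dvd_refl)
    then have "fps_X ^ Suc (Suc n) dvd poly q (x + h)" by (simp add: mult.commute)
    moreover have "res (x + h) = c" using x by (simp add: P_def h_def)
    ultimately show "\<exists>y. P (Suc n) y \<and> fps_X ^ Suc n dvd y - x"
      by (intro exI[of _ "x + h"]) (simp add: P_def h_def)
  qed
  then obtain x where x: "\<And>n. P n (x n)" "\<And>n. fps_X ^ Suc n dvd x (Suc n) - x n" by blast
  \<comment> \<open>Diagonal limit: the coefficient of index \<open>n\<close> no longer changes from
    \<open>x n\<close> on.\<close>
  define r where "r = Abs_fps (\<lambda>n. fps_nth (x n) n)"
  have stab: "fps_nth (x (n + k)) n = fps_nth (x n) n" for n k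
  proof (induction k)
    case (Suc k)
    have "fps_nth (x (Suc (n + k)) - x (n + k)) n = 0"
      using x(2)[of "n + k"] unfolding X_power_dvd_iff by simp
    then show ?case using Suc by simp
  qed simp
  have rx: "fps_X ^ Suc n dvd r - x n" for n
    unfolding X_power_dvd_iff
  proof (intro allI impI)
    fix k assume "k < Suc n"
    then have "fps_nth (x n) k = fps_nth (x k) k" using stab[of k "n - k"] by simp
    then show "fps_nth (r - x n) k = 0" by (simp add: r_def)
  qed
  have "fps_X ^ Suc n dvd poly q r" for n
  proof -
    have "fps_X ^ Suc n dvd poly q r - poly q (x n)"
      using rx[of n] diff_dvd_poly_diff dvd_trans by blast
    then have "fps_X ^ Suc n dvd (poly q r - poly q (x n)) + poly q (x n)"
      using x(1)[of n] unfolding P_def by (intro dvd_add) auto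
    then show ?thesis by simp
  qed
  then have "fps_nth (poly q r) n = 0" for n
    unfolding X_power_dvd_iff by blast
  then have "poly q r = 0" by (simp add: fps_eq_iff)
  moreover have "res r = c" using x(1)[of 0] by (simp add: r_def P_def)
  ultimately show ?thesis using that by blast
qed

text \<open>In the Taylor expansion of \<open>q\<close> at \<open>r\<close> the factor
  \<open>r' - r\<close> cancels, leaving \<open>q'(r)\<close> plus a term of zero residue.\<close>

lemma hensel_unique:
  fixes q :: "'a::field fps poly"
  assumes "poly q r = 0" "poly q r' = 0" "res r = res r'"
    and "poly (pderiv (map_poly res q)) (res r) \<noteq> 0"
  shows "r = r'"
proof (rule ccontr)
  assume ne: "r \<noteq> r'"
  obtain s where "poly q (r + (r' - r)) = poly q r + (r' - r) * poly (pderiv q) r + (r' - r)\<^sup>2 * s"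
    using taylor2 by blast
  then have "(r' - r) * (poly (pderiv q) r + (r' - r) * s) = 0"
    using assms by (simp add: power2_eq_square algebra_simps)
  then have "poly (pderiv q) r + (r' - r) * s = 0" using ne by simp
  then have "res (poly (pderiv q) r + (r' - r) * s) = 0" by simp
  then have "res (poly (pderiv q) r) = 0" using assms by simp
  then show False using assms by (simp add: res_poly map_poly_pderiv[OF hom_res])
qed

section \<open>Power series inside the algebraic closure of the Laurent series field, and roots
  there\<close>

definition ser :: "'a::field fps \<Rightarrow> 'a fps fract alg_closure" where
  "ser f = to_ac (to_fract f)"

lemma hom_ser: "hom_on UNIV ser"
  by (simp add: hom_on_def ser_def)

lemma ser_simps [simp]: "ser 0 = 0" "ser 1 = 1" "ser f = ser g \<longleftrightarrow> f = g" "ser f = 0 \<longleftrightarrow> f = 0"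
  "ser (f + g) = ser f + ser g" "ser (f * g) = ser f * ser g" "ser (f - g) = ser f - ser g"
  "ser (- f) = - ser f" "ser (f ^ n) = ser f ^ n"
  using hom_on_power[OF subring_set_UNIV hom_ser] by (simp_all add: ser_def)

lemma inj_ser: "inj ser"
  by (rule injI) simp

lemma ser_poly: "poly (map_poly ser q) (ser x) = ser (poly q x)"
  using hom_poly[OF hom_ser, of q x] by simp

lemma degree_map_ser [simp]: "degree (map_poly ser q) = degree q"
  by (rule degree_map_poly) auto

lemma map_poly_ser: "map_poly ser q = map_poly to_ac (fract_poly q)"
  by (simp add: poly_eq_iff coeff_map_poly ser_def)

text \<open>The unramified case: each simple root of the reduction lifts uniquely, and this already
  gives as many power series roots as the degree allows in the algebraic closure.\<close>

lemma roots_split: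
  fixes q :: "'a::alg_closed_field fps poly"
  assumes deg: "degree (map_poly res q) = degree q" and sq: "rsquarefree (map_poly res q)"
  shows "{b. poly (map_poly ser q) b = 0} = ser ` {r. poly q r = 0}"
    and "bij_betw res {r. poly q r = 0} {c. poly (map_poly res q) c = 0}"
proof -
  have nz: "map_poly res q \<noteq> 0" using sq by (auto simp: rsquarefree_def)
  then have q0: "q \<noteq> 0" "map_poly ser q \<noteq> 0" by (auto simp: map_poly_eq_0_iff)
  let ?R = "{r. poly q r = 0}" and ?S = "{c. poly (map_poly res q) c = 0}"
  have simple: "poly (pderiv (map_poly res q)) c \<noteq> 0" if "c \<in> ?S" for c
    using squarefree_iff_pderiv[OF nz] sq that by blast
  have RS: "res ` ?R \<subseteq> ?S" by (auto simp flip: res_poly)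
  have SR: "?S \<subseteq> res ` ?R"
  proof
    fix c assume "c \<in> ?S"
    then obtain r where "poly q r = 0" "res r = c" using hensel[of q c] simple by blast
    then show "c \<in> res ` ?R" by auto
  qed
  have inj: "inj_on res ?R"
  proof (rule inj_onI)
    fix r r' assume r: "r \<in> ?R" "r' \<in> ?R" "res r = res r'"
    then have "res r \<in> ?S" using RS by blast
    from hensel_unique[of q r r', OF _ _ r(3) simple[OF this]] r(1,2) show "r = r'" by simp
  qed
  show b: "bij_betw res ?R ?S" unfolding bij_betw_def using RS SR inj by blast
  have card: "card (ser ` ?R) = degree (map_poly ser q)"
    using bij_betw_same_card[OF b] squarefree_card_roots[OF nz] sq deg
    by (simp add: card_image[OF inj_on_subset[OF inj_ser]])
  have sub: "ser ` ?R \<subseteq> {b. poly (map_poly ser q) b = 0}"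
    by (auto simp: ser_poly)
  show "{b. poly (map_poly ser q) b = 0} = ser ` ?R"
    by (rule card_seteq[OF poly_roots_finite[OF q0(2)] sub, symmetric])
       (simp only: card card_poly_roots_bound[OF q0(2)])
qed

text \<open>Power series form a valuation ring. If \<open>b\<close> were not a power series, its
  inverse \<open>h\<close> would be one of zero residue and a root of the reversed polynomial, whose
  constant term is 1 because \<open>q\<close> is monic.\<close>

lemma integral_root:
  fixes q :: "'a::field fps poly"
  assumes q: "lead_coeff q = 1" and b: "poly (map_poly ser q) b = 0" "b \<in> range to_ac"
  obtains r where "b = ser r" "poly q r = 0"
proof -
  obtain x where x: "b = to_ac x" using b(2) by auto
  obtain f g where fg: "x = to_fract f / to_fract g" "g \<noteq> 0"
    by (cases x) (auto simp: Fract_conv_to_fract)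
  have "\<exists>r. b = ser r"
  proof (cases "f = 0 \<or> g dvd f")
    case True
    then obtain h where "f = g * h" by (metis dvdE mult_zero_right)
    then have "b = ser h" using fg x by (simp add: ser_def)
    then show ?thesis by blast
  next
    case False
    then have "f dvd g" and s: "subdegree f < subdegree g" using fg(2) by (auto simp: fps_dvd_iff)
    then obtain h where h: "g = f * h" by (elim dvdE)
    have h0: "h \<noteq> 0" "res h = 0" using s fg(2) h by auto
    have bh: "b = inverse (ser h)" using fg x False h h0 by (simp add: ser_def field_simps)
    have "poly (map_poly ser (reflect_poly q)) (ser h) = 0"
    proof -
      have "map_poly ser (reflect_poly q) = reflect_poly (map_poly ser q)"
        by (simp add: poly_eq_iff coeff_map_poly coeff_reflect_poly)
      then show ?thesis using poly_reflect_poly_nz[of "ser h" "map_poly ser q"] h0 b(1) bh by simp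
    qed
    then have "poly (reflect_poly q) h = 0" by (simp add: ser_poly)
    moreover have "res (poly (reflect_poly q) h) = 1"
      using h0 q by (simp add: res_poly poly_0_coeff_0 coeff_map_poly)
    ultimately show ?thesis by simp
  qed
  then obtain r where "b = ser r" by blast
  then show ?thesis using that[of r] b(1) by (simp add: ser_poly)
qed

text \<open>In a factorisation \<open>g = a * b\<close> the leading coefficients are units, so
  degrees survive reduction. The reductions multiply to a power of \<open>X\<close>; hence both
  constant terms have zero residue if both degrees are positive, and the constant term of
  \<open>g\<close> would have order at least two. Gauss's lemma passes to the fraction
  field.\<close>

lemma eisenstein:
  fixes g :: "'a::field fps poly"
  assumes lc: "lead_coeff g = 1" and deg: "degree g > 0"
    and red: "map_poly res g = monom 1 (degree g)" and g0: "fps_nth (coeff g 0) 1 \<noteq> 0"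
  shows "irred (fract_poly g)"
proof -
  have "irred g"
  proof (rule Factorial_Ring.irreducibleI)
    show "g \<noteq> 0" using deg by auto
    show "\<not> g dvd 1" using deg by (auto simp: is_unit_poly_iff)
    fix a b assume ab: "g = a * b"
    have lab: "lead_coeff a * lead_coeff b = 1" using lc ab by (simp add: lead_coeff_mult)
    then have ua: "lead_coeff a dvd 1" and ub: "lead_coeff b dvd 1"
      by (metis dvd_triv_left, metis dvd_triv_right)
    have nz: "a \<noteq> 0" "b \<noteq> 0" using ab \<open>g \<noteq> 0\<close> by auto
    show "a dvd 1 \<or> b dvd 1"
    proof (cases "degree a = 0 \<or> degree b = 0")
      case True
      then show ?thesis using ua ub by (auto simp: is_unit_poly_iff elim!: degree_eq_zeroE)
    next
      case False
      have da: "degree (map_poly res a) = degree a" "degree (map_poly res b) = degree b"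
        using ua ub by (auto intro!: map_poly_degree_eq)
      then have nz': "map_poly res a \<noteq> 0" "map_poly res b \<noteq> 0" using False by auto
      have dab: "degree g = degree a + degree b" unfolding ab by (rule degree_mult_eq) (use nz in auto)
      have "monom 1 (degree g) = map_poly res a * map_poly res b"
        using red unfolding ab by (simp add: map_hom_mult[OF hom_res])
      moreover have "order 0 (monom (1::'a) (degree g)) = degree g"
      proof -
        have "monom (1::'a) (degree g) = [:- 0, 1:] ^ degree g" by (simp add: monom_altdef)
        then show ?thesis by (simp only: order_power_n_n)
      qed
      ultimately have "degree g = order 0 (map_poly res a) + order 0 (map_poly res b)"
        using nz' by (metis order_mult mult_eq_0_iff)
      moreover have "order 0 (map_poly res a) \<le> degree a" "order 0 (map_poly res b) \<le> degree b"
        using order_degree[OF nz'(1), of 0] order_degree[OF nz'(2), of 0] da by auto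
      ultimately have "order 0 (map_poly res a) > 0" "order 0 (map_poly res b) > 0"
        using False dab by auto
      then have "poly (map_poly res a) 0 = 0" "poly (map_poly res b) 0 = 0"
        using order_root nz' by (metis gr0_conv_Suc order_root less_numeral_extra(3))+
      then have "res (coeff a 0) = 0" "res (coeff b 0) = 0"
        by (auto simp: poly_0_coeff_0 coeff_map_poly)
      moreover have "coeff g 0 = coeff a 0 * coeff b 0" by (simp add: ab coeff_mult)
      ultimately have "fps_nth (coeff g 0) 1 = 0" by (simp add: fps_mult_nth)
      then show ?thesis using g0 by simp
    qed
  qed
  then show ?thesis using nonconst_poly_irreducible_iff[of g] deg by simp
qed

lemma prod_linear_dvd:
  fixes q :: "'a::idom poly"
  assumes "finite S" "\<And>r. r \<in> S \<Longrightarrow> poly q r = 0"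
  shows "(\<Prod>r\<in>S. [:-r, 1:]) dvd q"
  using assms
proof (induction S)
  case (insert s S)
  then obtain g where g: "q = (\<Prod>r\<in>S. [:-r, 1:]) * g" by (auto elim: dvdE)
  have "poly (\<Prod>r\<in>S. [:-r, 1:]) s \<noteq> 0" using insert.hyps by (auto simp: poly_prod)
  then have "poly g s = 0" using insert.prems[of s] by (simp add: g)
  then have "[:-s, 1:] dvd g" by (simp add: poly_eq_0_iff_dvd)
  then have "(\<Prod>r\<in>S. [:-r, 1:]) * [:-s, 1:] dvd q" unfolding g by (rule mult_dvd_mono[OF dvd_refl])
  then show ?case unfolding prod.insert[OF insert.hyps(1,2)] by (subst mult.commute)
qed simp

lemma prod_linear_props:
  fixes S :: "'a::idom set"
  shows "degree (\<Prod>r\<in>S. [:-r, 1:]) = card S" "lead_coeff (\<Prod>r\<in>S. [:-r, 1:]) = 1"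
  by (subst degree_prod_eq_sum_degree) (auto simp: lead_coeff_prod)

lemma squarefree_eq_prod:
  fixes h :: "'a::alg_closed_field poly"
  assumes "rsquarefree h" "lead_coeff h = 1"
  shows "h = (\<Prod>c\<in>{c. poly h c = 0}. [:-c, 1:])"
proof -
  have h0: "h \<noteq> 0" using assms by (auto simp: rsquarefree_def)
  let ?S = "{c. poly h c = 0}"
  have "(\<Prod>c\<in>?S. [:-c, 1:]) dvd h" by (rule prod_linear_dvd) (auto simp: poly_roots_finite[OF h0])
  then obtain g where g: "h = (\<Prod>c\<in>?S. [:-c, 1:]) * g" by (elim dvdE)
  have g0: "g \<noteq> 0" "(\<Prod>c\<in>?S. [:-c, 1:]) \<noteq> 0" using g h0 by auto
  have "degree h = card ?S + degree g"
    by (subst (1) g) (simp add: degree_mult_eq[OF g0(2,1)] prod_linear_props del: prod_zero_iff)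
  then have "degree g = 0" using squarefree_card_roots[OF h0] assms by simp
  then obtain c where c: "g = [:c:]" by (metis degree_eq_zeroE)
  have "lead_coeff ((\<Prod>c\<in>?S. [:-c, 1:]) * g) = c"
    unfolding lead_coeff_mult prod_linear_props(2) c by simp
  then have "lead_coeff h = c" using g by simp
  then show ?thesis using g c assms by simp
qed

text \<open>The roots of \<open>h\<close> are simple and nonzero, hence simple roots of the whole
  reduction, and Hensel's lemma splits off one linear factor for each. The cofactor \<open>g\<close>
  reduces to \<open>X^k\<close>. Its constant term has residue zero, and a vanishing coefficient of
  index 1 would force the same for \<open>q\<close>.\<close>

lemma eisenstein_cofactor:
  fixes q :: "'a::alg_closed_field fps poly"
  assumes lc: "lead_coeff q = 1" and red: "map_poly res q = monom 1 k * h"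
    and h: "rsquarefree h" "poly h 0 \<noteq> 0" and k: "k > 0" and q0: "fps_nth (coeff q 0) 1 \<noteq> 0"
  obtains S g where "finite S" "card S = degree h" "q = (\<Prod>r\<in>S. [:-r, 1:]) * g"
    "irred (fract_poly g)" "degree q = k + degree h"
proof -
  have h0: "h \<noteq> 0" using h by (auto simp: rsquarefree_def)
  let ?H = "{c. poly h c = 0}"
  have "lead_coeff (map_poly res q) = 1"
    using lc by (subst lead_coeff_map_poly_nz) auto
  then have lh: "lead_coeff h = 1" by (simp add: red lead_coeff_mult degree_monom_eq)
  have dq: "degree q = k + degree h"
  proof -
    have "degree q = degree (map_poly res q)" using lc by (intro map_poly_degree_eq[symmetric]) auto
    also have "\<dots> = k + degree h" unfolding red by (subst degree_mult_eq) (auto simp: h0 degree_monom_eq)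
    finally show ?thesis .
  qed
  have "\<exists>r. poly q r = 0 \<and> res r = c" if c: "c \<in> ?H" for c
  proof -
    have "c \<noteq> 0" using c h(2) by auto
    moreover have "poly (pderiv h) c \<noteq> 0" using squarefree_iff_pderiv[OF h0] h(1) c by blast
    ultimately have "poly (pderiv (map_poly res q)) c \<noteq> 0"
      using c by (simp add: red pderiv_mult poly_monom)
    then show ?thesis using hensel[of q c] c by (auto simp: red)
  qed
  then obtain f where f: "\<And>c. c \<in> ?H \<Longrightarrow> poly q (f c) = 0 \<and> res (f c) = c" by metis
  have inj: "inj_on f ?H" by (rule inj_onI) (metis f)
  define S where "S = f ` ?H"
  have fin: "finite S" unfolding S_def by (intro finite_imageI poly_roots_finite h0)
  have card: "card S = degree h"
    using squarefree_card_roots[OF h0] h(1) by (simp add: S_def card_image[OF inj])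
  have "(\<Prod>r\<in>S. [:-r, 1:]) dvd q" by (rule prod_linear_dvd[OF fin]) (use f in \<open>auto simp: S_def\<close>)
  then obtain g where g: "q = (\<Prod>r\<in>S. [:-r, 1:]) * g" by (elim dvdE)
  have "map_poly res (\<Prod>r\<in>S. [:-r, 1:]) = (\<Prod>r\<in>S. map_poly res [:-r, 1:])"
    by (rule map_hom_prod[OF hom_res]) auto
  also have "\<dots> = (\<Prod>c\<in>?H. [:-c, 1:])"
    unfolding S_def using f by (subst prod.reindex[OF inj]) (auto simp: map_poly_pCons intro!: prod.cong)
  also have "\<dots> = h" using squarefree_eq_prod[OF h(1) lh] by simp
  finally have rS: "map_poly res (\<Prod>r\<in>S. [:-r, 1:]) = h" .
  have "h * map_poly res g = h * monom 1 k"
    using red by (subst (asm) g) (simp add: map_hom_mult[OF hom_res] rS mult.commute)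
  then have rg: "map_poly res g = monom 1 k" using h0 by simp
  have nz: "(\<Prod>r\<in>S. [:-r, 1:]) \<noteq> 0" "g \<noteq> 0" using g lc by auto
  have "lead_coeff ((\<Prod>r\<in>S. [:-r, 1:]) * g) = 1" using lc g by simp
  then have lg: "lead_coeff g = 1" unfolding lead_coeff_mult prod_linear_props(2) by simp
  have dg: "degree g = k"
  proof -
    have "degree q = card S + degree g"
      by (subst g) (simp add: degree_mult_eq[OF nz] prod_linear_props)
    then show ?thesis using dq card by simp
  qed
  have "coeff q 0 = coeff (\<Prod>r\<in>S. [:-r, 1:]) 0 * coeff g 0" by (subst g) (simp add: coeff_mult)
  moreover have "res (coeff g 0) = 0"
    using arg_cong[OF rg, of "\<lambda>p. coeff p 0"] k by (simp add: coeff_map_poly)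
  ultimately have "fps_nth (coeff g 0) 1 \<noteq> 0" using q0 by (auto simp: fps_mult_nth)
  then have "irred (fract_poly g)"
    using eisenstein[of g] lg dg rg k by simp
  then show ?thesis using that fin card g dq by blast
qed

section \<open>Decomposition fields\<close>

text \<open>The minimal polynomial of \<open>x\<close> divides both, and the irreducible
  \<open>g\<close> is associated to it.\<close>

lemma irreducible_common_root:
  fixes g q :: "'f::field poly"
  assumes g: "irred g" and r: "poly (map_poly to_ac g) x = 0" "poly (map_poly to_ac q) x = 0"
  shows "g dvd q"
proof -
  obtain p where p: "irred p"
    "\<And>q. poly (map_poly to_ac q) x = 0 \<longleftrightarrow> map_poly to_ac p dvd map_poly to_ac q"
    using minimal_poly_base[of x] by blast
  note deg = degree_map_poly_hom[OF hom_to_ac]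
  have *: "p dvd q" if "poly (map_poly to_ac q) x = 0" for q
  proof -
    have eq: "q = p * (q div p) + q mod p" by simp
    have "map_poly to_ac q = map_poly to_ac p * map_poly to_ac (q div p) + map_poly to_ac (q mod p)"
      by (subst eq) (simp only: map_poly_hom_add[OF subring_set_UNIV hom_to_ac]
        map_hom_mult[OF hom_to_ac] poly_over_UNIV)
    then have d: "map_poly to_ac p dvd map_poly to_ac (q mod p)"
      using that p(2) by (metis dvd_add_right_iff dvd_triv_left)
    have "q mod p = 0"
    proof (rule ccontr)
      assume nz: "q mod p \<noteq> 0"
      then have "degree p \<le> degree (q mod p)" using dvd_imp_degree_le[OF d] by (simp add: deg)
      moreover have "p \<noteq> 0" using p(1) by auto
      ultimately show False using degree_mod_less[of p q] nz by simp
    qed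
    then show ?thesis by (simp add: mod_eq_0_iff_dvd)
  qed
  obtain c where c: "g = p * c" using *[OF r(1)] by (elim dvdE)
  have "\<not> p dvd 1" using p(1) by (simp add: irreducible_def)
  then have "c dvd 1" using irreducibleD[OF g c] by blast
  then have "g dvd p" unfolding c by (simp add: mult_unit_dvd_iff)
  then show ?thesis using *[OF r(2)] dvd_trans by blast
qed

text \<open>Applied to places, \<open>range to_ac\<close> is the Laurent series field inside its
  algebraic closure, and \<open>dec\<close> is the decomposition field of the place.\<close>

definition dec :: "('f::field alg_closure \<Rightarrow> 'g::field alg_closure) \<Rightarrow> 'f alg_closure set" where
  "dec \<iota> = {x. \<iota> x \<in> range to_ac}"

lemma intermediate_dec:
  assumes \<iota>: "hom_on UNIV \<iota>" and "\<iota> ` base_field \<subseteq> base_field"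
  shows "intermediate (dec \<iota>)"
  unfolding intermediate_def subring_set_def dec_def
  using assms(2) intermediate_subring[OF intermediate_base_field]
  by (auto simp: hom_simps[OF \<iota>] subring_set_def)
     (auto simp flip: to_ac_diff to_ac_mult)

text \<open>Local irreducibility gives global conjugacy: a polynomial over
  \<open>dec \<iota>\<close> with root \<open>x\<close> is mapped to one over the local field that
  shares a root with \<open>g\<close>, so it is divisible by \<open>g\<close> and vanishes at
  \<open>y\<close> as well.\<close>

lemma dec_transitive:
  assumes \<iota>: "hom_on UNIV \<iota>" "\<iota> ` base_field \<subseteq> base_field"
    and g: "irred g"
    and xy: "poly (map_poly to_ac g) (\<iota> x) = 0" "poly (map_poly to_ac g) (\<iota> y) = 0"
  obtains \<sigma> where "\<sigma> \<in> Gal (dec \<iota>)" "\<sigma> x = y"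
proof (rule Gal_conj[OF intermediate_dec[OF \<iota>], of x y])
  fix q assume q: "poly_over (dec \<iota>) q" "poly q x = 0"
  have "poly_over base_field (map_poly \<iota> q)"
    using q(1) by (auto simp: poly_over_def dec_def coeff_map_hom[OF \<iota>(1)])
  then obtain q' where q': "map_poly \<iota> q = map_poly to_ac q'" by (auto simp: poly_over_base)
  have ev: "\<iota> (poly q z) = poly (map_poly to_ac q') (\<iota> z)" for z
    using hom_poly[OF \<iota>(1), of q z] by (simp add: q')
  have "g dvd q'"
    using irreducible_common_root[OF g xy(1), of q'] ev[of x] q(2) hom_zero[OF \<iota>(1)] by simp
  then obtain k where "q' = g * k" by (elim dvdE)
  then have "poly (map_poly to_ac q') (\<iota> y) = 0"
    using xy(2) by (simp add: map_hom_mult[OF hom_to_ac])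
  then show "poly q y = 0" using ev[of y] degree_map_poly_hom(1)[OF \<iota>(1)] by simp
qed (use that in blast)

section \<open>Places of the rational function field\<close>

lemma hom_on_comp: "hom_on UNIV f \<Longrightarrow> hom_on UNIV g \<Longrightarrow> hom_on UNIV (\<lambda>x. f (g x))"
  by (simp add: hom_on_def)

lemma map_poly_comp:
  assumes "hom_on UNIV f" "hom_on UNIV g"
  shows "map_poly f (map_poly g p) = map_poly (\<lambda>x. f (g x)) p"
  using hom_zero[OF assms(1)] hom_zero[OF assms(2)]
  by (simp add: poly_eq_iff coeff_map_poly)

lemma hom_map_poly:
  assumes "hom_on UNIV f"
  shows "hom_on UNIV (map_poly f)"
  using hom_on_one[OF subring_set_UNIV assms]
  by (simp add: hom_on_def map_hom_simps[OF assms])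

lemma hom_poly_eval: "hom_on UNIV (\<lambda>p. poly p x)"
  by (simp add: hom_on_def)

lemma hom_const: "hom_on UNIV (const_to_ac :: 'k::field \<Rightarrow> _)"
  by (simp add: hom_on_def const_to_ac_def flip: to_ac_add to_ac_mult to_fract_add to_fract_mult one_pCons)

type_synonym 'k acl = "'k poly fract alg_closure"

section \<open>Evaluation and Taylor expansion of polynomials at a point\<close>

definition emb :: "'k::field poly \<Rightarrow> 'k acl" where
  "emb P = to_ac (to_fract P)"

definition ev :: "'k acl \<Rightarrow> 'k::field poly \<Rightarrow> 'k acl" where
  "ev c P = poly (map_poly const_to_ac P) c"

text \<open>Taylor expansion with local parameter \<open>X = T - c\<close>. The point
  \<open>c\<close> ranges over \<open>A\<close>, so every nonconstant polynomial over
  \<open>k\<close> has a zero among the points.\<close>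

definition expand :: "'k acl \<Rightarrow> 'k::field poly \<Rightarrow> 'k acl fps" where
  "expand c P = fps_of_poly (pcompose (map_poly const_to_ac P) [:c, 1:])"

lemma hom_emb: "hom_on UNIV emb"
  by (simp add: hom_on_def emb_def)

lemma emb_eq_iff [simp]: "emb P = emb Q \<longleftrightarrow> P = Q"
  by (simp add: emb_def)

lemma hom_ev: "hom_on UNIV (ev c)"
  unfolding ev_def by (intro hom_on_comp[OF hom_poly_eval hom_map_poly] hom_const)

lemma hom_expand: "hom_on UNIV (expand c)"
  unfolding hom_on_def expand_def
  by (simp add: map_hom_simps[OF hom_const] hom_on_one[OF subring_set_UNIV hom_const]
    pcompose_1 pcompose_add pcompose_mult fps_of_poly_add fps_of_poly_mult)

lemmas emb_simps = hom_simps[OF hom_emb, simplified]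
lemmas ev_simps = hom_simps[OF hom_ev, simplified]
lemmas expand_simps = hom_simps[OF hom_expand, simplified]

lemma emb_eq_0_iff [simp]: "emb P = 0 \<longleftrightarrow> P = 0"
  by (simp add: emb_def)

lemma ev_const: "ev c [:a:] = const_to_ac a"
  by (simp add: ev_def map_poly_pCons hom_zero[OF hom_const])

lemma expand_const: "expand c [:a:] = fps_const (const_to_ac a)"
  by (simp add: expand_def map_poly_pCons hom_zero[OF hom_const] fps_of_poly_const)

lemma res_expand: "res (expand c P) = ev c P"
  by (simp add: expand_def ev_def flip: poly_0_coeff_0) (simp add: poly_pcompose)

lemma expand_eq_0_iff [simp]: "expand c P = 0 \<longleftrightarrow> P = 0"
proof
  assume "expand c P = 0"
  then have "pcompose (map_poly const_to_ac P) [:c, 1:] = 0"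
    by (metis expand_def fps_of_poly_0 fps_of_poly_eq_iff)
  then have "map_poly const_to_ac P = 0" by (simp add: pcompose_eq_0_iff)
  then show "P = 0" using degree_map_poly_hom(4)[OF hom_const] by blast
qed (simp add: expand_simps)

text \<open>A zero of \<open>P\<close> at \<open>c\<close> with nonzero derivative thus has order
  exactly one; this supplies the constant terms for Eisenstein's criterion.\<close>

lemma expand_nth_1: "fps_nth (expand c P) 1 = ev c (pderiv P)"
proof -
  let ?p = "map_poly const_to_ac P"
  have "coeff (pcompose ?p [:c, 1:]) 1 = coeff (pderiv (pcompose ?p [:c, 1:])) 0"
    by (simp add: coeff_pderiv)
  also have "\<dots> = poly (pcompose (pderiv ?p) [:c, 1:]) 0"
    by (simp add: pderiv_pcompose pderiv_pCons flip: poly_0_coeff_0)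
  also have "\<dots> = ev c (pderiv P)"
    by (simp add: poly_pcompose ev_def map_poly_pderiv[OF hom_const])
  finally show ?thesis by (simp add: expand_def)
qed

definition place :: "'k acl \<Rightarrow>
    ('k::field acl \<Rightarrow> 'k acl fps fract alg_closure) \<Rightarrow> bool" where
  "place c \<iota> \<longleftrightarrow> hom_on UNIV \<iota> \<and> (\<forall>P. \<iota> (emb P) = ser (expand c P))"

lemma base_field_emb:
  assumes "x \<in> base_field"
  obtains P Q where "x = emb P / emb Q" "Q \<noteq> 0"
proof -
  obtain y where y: "x = to_ac y" using assms by auto
  obtain P Q where "y = to_fract P / to_fract Q" "Q \<noteq> 0"
    by (cases y) (auto simp: Fract_conv_to_fract)
  then show ?thesis using that[of P Q] y by (simp add: emb_def)
qed

text \<open>Taylor expansion is injective on \<open>k[T]\<close> and therefore passes to fractions;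
  \<open>hom_extend\<close> does the rest.\<close>

lemma place_exists: "\<exists>\<iota>. place (c :: 'a::field acl) \<iota>"
proof -
  have ex: "\<exists>y P Q. Q \<noteq> 0 \<and> x = emb P / emb Q \<and> y = ser (expand c P) / ser (expand c Q)"
    if x: "x \<in> base_field" for x
    using base_field_emb[OF x] by metis
  define \<phi> where "\<phi> = (\<lambda>x. SOME y. \<exists>P Q. Q \<noteq> 0 \<and> x = emb P / emb Q \<and>
    y = ser (expand c P) / ser (expand c Q))"
  have \<phi>: "\<phi> (emb P / emb Q) = ser (expand c P) / ser (expand c Q)" if Q: "Q \<noteq> 0" for P Q
  proof -
    have "emb P / emb Q \<in> base_field" by (auto simp: emb_def simp flip: to_ac_divide)
    then obtain P' Q' where *: "Q' \<noteq> 0" "emb P / emb Q = emb P' / emb Q'"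
      "\<phi> (emb P / emb Q) = ser (expand c P') / ser (expand c Q')"
      using someI_ex[OF ex[of "emb P / emb Q"]] unfolding \<phi>_def by blast
    then have "emb (P * Q') = emb (P' * Q)" using Q by (simp add: emb_simps field_simps)
    then have "P * Q' = P' * Q" by simp
    then have "ser (expand c (P * Q')) = ser (expand c (P' * Q))" by simp
    then have "ser (expand c P) / ser (expand c Q) = ser (expand c P') / ser (expand c Q')"
      using *(1) Q by (simp add: expand_simps frac_eq_eq)
    then show ?thesis using *(3) by simp
  qed
  have \<phi>': "\<phi> (emb P) = ser (expand c P)" for P :: "'a poly"
    using \<phi>[of 1 P] by (simp add: emb_simps expand_simps)
  have hom: "hom_on base_field \<phi>"
    unfolding hom_on_def
  proof (intro conjI ballI)
    show "\<phi> 1 = 1" using \<phi>'[of 1] by (simp add: emb_simps expand_simps)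
  next
    fix x y :: "'a acl" assume "x \<in> base_field" "y \<in> base_field"
    then obtain P Q P' Q' :: "'a poly" where *: "x = emb P / emb Q" "Q \<noteq> 0" "y = emb P' / emb Q'" "Q' \<noteq> 0"
      by (metis base_field_emb)
    have "x + y = emb (P * Q' + P' * Q) / emb (Q * Q')" "x * y = emb (P * P') / emb (Q * Q')"
      using * by (simp_all add: emb_simps add_frac_eq times_divide_times_eq)
    moreover have "Q * Q' \<noteq> 0" using * by simp
    ultimately have "\<phi> (x + y) = ser (expand c (P * Q' + P' * Q)) / ser (expand c (Q * Q'))"
      "\<phi> (x * y) = ser (expand c (P * P')) / ser (expand c (Q * Q'))" using \<phi> by simp_all
    then show "\<phi> (x + y) = \<phi> x + \<phi> y" "\<phi> (x * y) = \<phi> x * \<phi> y"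
      using * by (simp_all add: \<phi> expand_simps add_frac_eq times_divide_times_eq)
  qed
  obtain \<iota> where "hom_on UNIV \<iota>" "\<And>a. a \<in> base_field \<Longrightarrow> \<iota> a = \<phi> a"
    using hom_extend[OF intermediate_base_field hom] by blast
  moreover have "emb P \<in> base_field" for P :: "'a poly" by (auto simp: emb_def)
  ultimately show ?thesis using \<phi>' by (auto simp: place_def)
qed

lemma placeD:
  assumes "place c \<iota>"
  shows place_hom: "hom_on UNIV \<iota>" and place_emb: "\<iota> (emb P) = ser (expand c P)"
    and place_base: "\<iota> ` base_field \<subseteq> base_field"
proof -
  show h: "hom_on UNIV \<iota>" and e: "\<iota> (emb P) = ser (expand c P)" for P
    using assms by (auto simp: place_def)
  show "\<iota> ` base_field \<subseteq> base_field"
  proof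
    fix y assume "y \<in> \<iota> ` base_field"
    then obtain P Q where "y = \<iota> (emb P / emb Q)" by (metis base_field_emb imageE)
    then have "y = ser (expand c P) / ser (expand c Q)"
      by (simp add: divide_inverse hom_simps[OF h] hom_on_inverse[OF h] e)
    then show "y \<in> base_field" by (auto simp: ser_def simp flip: to_ac_divide)
  qed
qed

text \<open>Composition with an automorphism gives another place above the same point; this permits
  choosing which conjugate takes a prescribed local value.\<close>

lemma place_Gal: "place c \<iota> \<Longrightarrow> \<sigma> \<in> Gal F \<Longrightarrow> place c (\<lambda>x. \<iota> (\<sigma> x))"
  by (auto simp: place_def emb_def GalD intro: hom_on_comp)

lemma place_poly:
  assumes "place c \<iota>"
  shows "\<iota> (poly (map_poly emb p) x) = poly (map_poly ser (map_poly (expand c) p)) (\<iota> x)"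
proof -
  note h = place_hom[OF assms]
  have "map_poly \<iota> (map_poly emb p) = map_poly ser (map_poly (expand c) p)"
    by (simp add: map_poly_comp[OF h hom_emb] map_poly_comp[OF hom_ser hom_expand] place_emb[OF assms])
  then show ?thesis using hom_poly[OF h, of "map_poly emb p" x] by simp
qed

lemma place_eq_iff:
  assumes "place c \<iota>"
  shows "\<iota> x = \<iota> y \<longleftrightarrow> x = y" "\<iota> x = 0 \<longleftrightarrow> x = 0"
  using degree_map_poly_hom[OF place_hom[OF assms]] by (auto simp: inj_on_def)

lemma intermediate_place: "place c \<iota> \<Longrightarrow> intermediate (dec \<iota>)"
  by (rule intermediate_dec[OF place_hom place_base])

lemma place_transitive:
  assumes "place c \<iota>" "irred (fract_poly g)"
    and "poly (map_poly ser g) (\<iota> x) = 0" "poly (map_poly ser g) (\<iota> y) = 0"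
  obtains \<sigma> where "\<sigma> \<in> Gal (dec \<iota>)" "\<sigma> x = y"
  using dec_transitive[OF place_hom[OF assms(1)] place_base[OF assms(1)] assms(2), of x y] assms(3,4)
  unfolding map_poly_ser by blast

text \<open>Over the algebraically closed source the polynomial splits into linear factors, so its
  image has no roots besides the images of roots.\<close>

lemma hom_root_lift:
  fixes \<phi> :: "'a::alg_closed_field \<Rightarrow> 'b::field"
  assumes \<phi>: "hom_on UNIV \<phi>" and "q \<noteq> 0" "poly (map_poly \<phi> q) y = 0"
  shows "\<exists>a. y = \<phi> a \<and> poly q a = 0"
  using assms(2,3)
proof (induction "degree q" arbitrary: q rule: less_induct)
  case (less q)
  show ?case
  proof (cases "degree q = 0")
    case True
    then obtain a where "q = [:a:]" by (metis degree_eq_zeroE)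
    then show ?thesis using less.prems
      by (simp add: map_poly_pCons hom_zero[OF \<phi>] degree_map_poly_hom(1)[OF \<phi>])
  next
    case False
    then obtain a where a: "poly q a = 0" using alg_closed_imp_poly_has_root by blast
    then have "[:-a, 1:] dvd q" by (simp add: poly_eq_0_iff_dvd)
    then obtain r where r: "q = [:-a, 1:] * r" by (elim dvdE)
    have r0: "r \<noteq> 0" using less.prems r by auto
    have dq: "degree q = Suc (degree r)" unfolding r by (subst degree_mult_eq) (use r0 in auto)
    have "map_poly \<phi> q = map_poly \<phi> [:-a, 1:] * map_poly \<phi> r"
      unfolding r by (rule map_hom_mult[OF \<phi>]) auto
    also have "map_poly \<phi> [:-a, 1:] = [:- \<phi> a, 1:]"
      by (simp add: map_poly_pCons hom_simps[OF \<phi>])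
    finally have "poly ([:- \<phi> a, 1:] * map_poly \<phi> r) y = 0" using less.prems(2) by simp
    then have "y = \<phi> a \<or> poly (map_poly \<phi> r) y = 0" by auto
    moreover have "\<exists>b. y = \<phi> b \<and> poly q b = 0" if "poly (map_poly \<phi> r) y = 0"
      using less.hyps[of r] r0 dq that by (auto simp: r)
    ultimately show ?thesis using a by blast
  qed
qed

text \<open>On \<open>k\<close> the place agrees with the embedding \<open>cs\<close> of
  \<open>A\<close> as constant series. A constant is mapped to a root of a polynomial with
  coefficients in the image of \<open>cs\<close>, and since \<open>A\<close> is algebraically
  closed, that root is again a constant series.\<close>

lemma constants_dec:
  assumes \<iota>: "place c \<iota>"
  shows "constant_closure \<subseteq> dec \<iota>"
proof
  fix x :: "'a acl" assume "x \<in> constant_closure"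
  then obtain p :: "'a poly" where p: "p \<noteq> 0" "poly (map_poly const_to_ac p) x = 0"
    by (auto simp: constant_closure_def)
  note h = place_hom[OF \<iota>]
  define cs where "cs = (\<lambda>a. ser (fps_const a) :: 'a acl fps fract alg_closure)"
  have hcs: "hom_on UNIV cs"
    by (simp add: hom_on_def cs_def flip: fps_const_add fps_const_mult)
  have "\<iota> (const_to_ac a) = cs (const_to_ac a)" for a
    using place_emb[OF \<iota>, of "[:a:]"] by (simp add: emb_def expand_const const_to_ac_def cs_def)
  then have "map_poly \<iota> (map_poly const_to_ac p) = map_poly cs (map_poly const_to_ac p)"
    by (simp add: map_poly_comp[OF h hom_const] map_poly_comp[OF hcs hom_const])
  then have 0: "poly (map_poly cs (map_poly const_to_ac p)) (\<iota> x) = 0"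
    using hom_poly[OF h, of "map_poly const_to_ac p" x] p(2)
      hom_zero[OF h] by simp
  have "map_poly const_to_ac p \<noteq> 0" using p(1) degree_map_poly_hom(4)[OF hom_const] by blast
  then have "\<iota> x \<in> range cs" using hom_root_lift[OF hcs _ 0] by blast
  then show "x \<in> dec \<iota>" by (auto simp: dec_def cs_def ser_def)
qed

section \<open>Good reduction of separable polynomials at almost all points\<close>

lemma clear_denominators:
  fixes p :: "'a::idom fract poly"
  obtains d P where "d \<noteq> 0" "fract_poly P = smult (to_fract d) p"
proof -
  have "\<exists>d P. d \<noteq> 0 \<and> fract_poly P = smult (to_fract d) p"
  proof (induction p)
    case 0
    then show ?case by (intro exI[of _ 1] exI[of _ 0]) simp
  next
    case (pCons a p)
    then obtain d P where d: "d \<noteq> 0" "fract_poly P = smult (to_fract d) p" by blast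
    obtain x y where xy: "a = to_fract x / to_fract y" "y \<noteq> 0"
      by (cases a) (auto simp: Fract_conv_to_fract)
    show ?case
      by (rule exI[of _ "d * y"], rule exI[of _ "pCons (d * x) (smult y P)"])
         (use d xy in \<open>simp add: map_poly_pCons mult.commute\<close>)
  qed
  then show ?thesis using that by blast
qed

text \<open>A combination of \<open>p\<close> and its derivative of least degree divides both; a
  root of it would be a multiple root of \<open>p\<close>.\<close>

lemma bezout_squarefree:
  fixes p :: "'f::field poly"
  assumes "rsquarefree (map_poly to_ac p)"
  obtains u v where "u * p + v * pderiv p = 1"
proof -
  let ?P = "\<lambda>h. h \<noteq> 0 \<and> (\<exists>u v. h = u * p + v * pderiv p)"
  have p0: "p \<noteq> 0" using assms by (auto simp: rsquarefree_def)
  have "?P p" using p0 by (auto intro: exI[of _ 1] exI[of _ 0])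
  define h where "h = arg_min degree ?P"
  have h: "?P h" using arg_min_natI[of ?P, OF \<open>?P p\<close>] by (simp add: h_def)
  then obtain u v where uv: "h = u * p + v * pderiv p" by blast
  have least: "degree h \<le> degree q" if "?P q" for q
    using arg_min_nat_le[of ?P q, OF that] by (simp add: h_def)
  have "h dvd a * p + b * pderiv p" for a b
  proof -
    let ?q = "a * p + b * pderiv p"
    have "?q mod h = ?q - h * (?q div h)" by (simp add: minus_mult_div_eq_mod)
    also have "h * (?q div h) = u * (?q div h) * p + v * (?q div h) * pderiv p"
    proof -
      have "h * d = u * d * p + v * d * pderiv p" for d by (simp add: uv algebra_simps)
      then show ?thesis .
    qed
    also have "?q - \<dots> = (a - u * (?q div h)) * p + (b - v * (?q div h)) * pderiv p"
      by (simp only: left_diff_distrib) (simp only: algebra_simps)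
    finally have "?q mod h = (a - u * (?q div h)) * p + (b - v * (?q div h)) * pderiv p" .
    then have "?q mod h = 0"
      using least[of "?q mod h"] degree_mod_less[of h ?q] h by fastforce
    then show ?thesis by (simp add: mod_eq_0_iff_dvd)
  qed
  from this[of 1 0] this[of 0 1] have dvd: "h dvd p" "h dvd pderiv p" by simp_all
  have ac_dvd: "map_poly to_ac a dvd map_poly to_ac b" if "a dvd b" for a b :: "'f poly"
    using that by (auto elim!: dvdE simp: map_hom_mult[OF hom_to_ac])
  have "degree h = 0"
  proof (rule ccontr)
    assume "degree h \<noteq> 0"
    then have "degree (map_poly to_ac h) > 0" by (simp add: degree_map_poly_hom(2)[OF hom_to_ac])
    then obtain x where x: "poly (map_poly to_ac h) x = 0" using alg_closed_imp_poly_has_root by blast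
    have "poly (map_poly to_ac p) x = 0" "poly (pderiv (map_poly to_ac p)) x = 0"
      using ac_dvd[OF dvd(1)] ac_dvd[OF dvd(2)] x
      by (auto elim!: dvdE simp: map_poly_pderiv[OF hom_to_ac])
    then show False using assms squarefree_iff_pderiv[of "map_poly to_ac p"] by (auto simp: rsquarefree_def)
  qed
  then obtain c where c: "h = [:c:]" by (metis degree_eq_zeroE)
  then have "c \<noteq> 0" using h by auto
  have "smult (inverse c) u * p + smult (inverse c) v * pderiv p = smult (inverse c) h"
    by (simp add: uv smult_add_right)
  also have "\<dots> = 1" using c \<open>c \<noteq> 0\<close> by (simp add: one_pCons)
  finally show ?thesis by (rule that)
qed

lemma map_poly_emb: "map_poly emb p = map_poly to_ac (fract_poly p)"
  by (simp add: poly_eq_iff coeff_map_poly emb_def)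

lemma pderiv_fract_poly: "fract_poly (pderiv p) = pderiv (fract_poly p)"
  by (rule map_poly_pderiv) (simp add: hom_on_def)

text \<open>After clearing denominators, the Bezout identity for \<open>p\<close> and its derivative
  survives reduction at every \<open>c\<close> where its right side \<open>d * e\<close> does not
  vanish. Multiplied by the leading coefficient, this right side does the work of a
  discriminant.\<close>

lemma squarefree_reduction:
  fixes p :: "'k::field poly poly"
  assumes sq: "rsquarefree (map_poly emb p)"
  obtains D where "D \<noteq> 0"
    "\<And>c. ev c D \<noteq> 0 \<Longrightarrow> degree (map_poly (ev c) p) = degree p \<and> rsquarefree (map_poly (ev c) p)"
proof -
  obtain u v where uv: "u * fract_poly p + v * pderiv (fract_poly p) = 1"
    using bezout_squarefree[of "fract_poly p"] sq unfolding map_poly_emb by blast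
  obtain d U where U: "d \<noteq> 0" "fract_poly U = smult (to_fract d) u" using clear_denominators .
  obtain e V where V: "e \<noteq> 0" "fract_poly V = smult (to_fract e) v" using clear_denominators .
  have "fract_poly (smult e U * p + smult d V * pderiv p) =
      smult (to_fract (d * e)) (u * fract_poly p + v * pderiv (fract_poly p))"
    by (simp add: U V pderiv_fract_poly smult_add_right mult.commute)
  also have "\<dots> = fract_poly [:d * e:]" by (simp add: uv map_poly_pCons)
  finally have eq: "smult e U * p + smult d V * pderiv p = [:d * e:]" by (simp only: fract_poly_eq_iff)
  have p0: "p \<noteq> 0" using sq by (auto simp: rsquarefree_def)
  show ?thesis
  proof (rule that[of "d * e * lead_coeff p"])
    show "d * e * lead_coeff p \<noteq> 0" using U V p0 by simp
    fix c assume c: "ev c (d * e * lead_coeff p) \<noteq> 0"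
    then have deg: "degree (map_poly (ev c) p) = degree p"
      by (intro map_poly_degree_eq) (simp add: ev_simps)
    have nz: "map_poly (ev c) p \<noteq> 0"
    proof
      assume "map_poly (ev c) p = 0"
      then have "coeff (map_poly (ev c) p) (degree p) = 0" by simp
      then show False using c by (simp add: coeff_map_hom[OF hom_ev] ev_simps)
    qed
    have "poly (pderiv (map_poly (ev c) p)) x \<noteq> 0" if "poly (map_poly (ev c) p) x = 0" for x
    proof
      assume "poly (pderiv (map_poly (ev c) p)) x = 0"
      then have "poly (map_poly (ev c) (smult e U * p + smult d V * pderiv p)) x = 0"
        using that by (simp add: map_hom_simps[OF hom_ev] map_poly_pderiv[OF hom_ev])
      then show False unfolding eq using c
        by (simp add: map_poly_pCons ev_simps)
    qed
    then show "degree (map_poly (ev c) p) = degree p \<and> rsquarefree (map_poly (ev c) p)"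
      using deg squarefree_iff_pderiv[OF nz] by blast
  qed
qed

lemma unramified_roots:
  fixes p :: "'k::field poly poly"
  assumes \<iota>: "place c \<iota>" and deg: "degree (map_poly (ev c) p) = degree p"
    and sq: "rsquarefree (map_poly (ev c) p)" and x: "poly (map_poly emb p) x = 0"
  obtains r where "\<iota> x = ser r" "poly (map_poly (expand c) p) r = 0"
proof -
  let ?q = "map_poly (expand c) p"
  have "map_poly res ?q = map_poly (ev c) p"
    by (simp add: map_poly_comp[OF hom_res hom_expand] res_expand)
  moreover have "degree ?q = degree p" by (rule degree_map_poly) simp
  ultimately have "{b. poly (map_poly ser ?q) b = 0} = ser ` {r. poly ?q r = 0}"
    using roots_split(1)[of ?q] deg sq by simp
  moreover have "poly (map_poly ser ?q) (\<iota> x) = 0"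
    using place_poly[OF \<iota>, of p x] x place_eq_iff(2)[OF \<iota>, of 0] by simp
  ultimately show ?thesis using that by blast
qed

lemma unramified_residues:
  fixes p :: "'k::field poly poly"
  assumes deg: "degree (map_poly (ev c) p) = degree p" and sq: "rsquarefree (map_poly (ev c) p)"
  shows "bij_betw res {r. poly (map_poly (expand c) p) r = 0} {a. poly (map_poly (ev c) p) a = 0}"
proof -
  let ?q = "map_poly (expand c) p"
  have "map_poly res ?q = map_poly (ev c) p"
    by (simp add: map_poly_comp[OF hom_res hom_expand] res_expand)
  moreover have "degree ?q = degree p" by (rule degree_map_poly) simp
  ultimately show ?thesis using roots_split(2)[of ?q] deg sq by simp
qed

lemma Gal_root_emb:
  assumes "\<sigma> \<in> Gal {}"
  shows "poly (map_poly emb p) (\<sigma> x) = 0 \<longleftrightarrow> poly (map_poly emb p) x = 0"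
  by (rule Gal_root_iff[OF assms]) (auto simp: poly_over_def coeff_map_poly emb_def)

text \<open>The minimal polynomial scaled into \<open>k[T]\<close>; by irreducibility its roots are
  precisely the conjugates of \<open>x\<close>.\<close>

lemma separable_integral_poly:
  fixes x :: "'k::field acl"
  assumes "separable_element x"
  obtains p :: "'k poly poly" where "rsquarefree (map_poly emb p)" "poly (map_poly emb p) x = 0"
    "\<And>y. poly (map_poly emb p) y = 0 \<Longrightarrow> \<exists>\<sigma>\<in>Gal {}. \<sigma> x = y"
proof -
  obtain q :: "'k poly fract poly" where q: "irred q" "poly (map_poly to_ac q) x = 0"
    "rsquarefree (map_poly to_ac q)" using assms by (auto simp: separable_element_def)
  obtain d p where d: "d \<noteq> 0" "fract_poly p = smult (to_fract d) q" using clear_denominators .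
  have eq: "map_poly emb p = smult (emb d) (map_poly to_ac q)"
    unfolding map_poly_emb d(2) by (simp add: map_poly_hom_smult[OF subring_set_UNIV hom_to_ac] emb_def)
  have "rsquarefree (map_poly emb p)"
    by (rule squarefree_dvd[OF q(3)]) (use d in \<open>simp add: eq smult_dvd_iff\<close>)
  moreover have "poly (map_poly emb p) x = 0" using q by (simp add: eq)
  moreover have "\<exists>\<sigma>\<in>Gal {}. \<sigma> x = y" if y: "poly (map_poly emb p) y = 0" for y
  proof -
    have y': "poly (map_poly to_ac q) y = 0" using y d by (simp add: eq)
    have "poly r y = 0" if r: "poly_over base_field r" "poly r x = 0" for r
    proof -
      obtain r' where r': "r = map_poly to_ac r'" using r(1) by (auto simp: poly_over_base)
      have "q dvd r'" using irreducible_common_root[OF q(1,2)] r r' by simp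
      then show ?thesis using y' by (auto elim!: dvdE simp: r' map_hom_mult[OF hom_to_ac])
    qed
    then obtain \<sigma> where "\<sigma> \<in> Gal base_field" "\<sigma> x = y" using Gal_conj[OF intermediate_base_field] by blast
    then show ?thesis using Gal_empty by blast
  qed
  ultimately show ?thesis using that by blast
qed

text \<open>Exceptional points are recorded as the zeros of one polynomial, so that several
  conditions are combined by multiplication.\<close>

abbreviation unramified :: "'k::field poly \<Rightarrow> 'k acl set \<Rightarrow> bool" where
  "unramified D T \<equiv> (\<forall>c \<iota>. ev c D \<noteq> 0 \<longrightarrow> place c \<iota> \<longrightarrow> T \<subseteq> dec \<iota>)"

lemma separable_unramified:
  assumes "separable_element x"
  shows "\<exists>D. D \<noteq> 0 \<and> (\<forall>c \<iota>. ev c D \<noteq> 0 \<longrightarrow> place c \<iota> \<longrightarrow> x \<in> dec \<iota>)"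
proof -
  obtain p :: "'a poly poly" where p: "rsquarefree (map_poly emb p)" "poly (map_poly emb p) x = 0"
    using separable_integral_poly[OF assms] by metis
  obtain D where D: "D \<noteq> 0"
    "\<And>c. ev c D \<noteq> 0 \<Longrightarrow> degree (map_poly (ev c) p) = degree p \<and> rsquarefree (map_poly (ev c) p)"
    using squarefree_reduction[OF p(1)] by blast
  have "x \<in> dec \<iota>" if c: "ev c D \<noteq> 0" and \<iota>: "place c \<iota>" for c \<iota>
  proof -
    obtain r where "\<iota> x = ser r" using unramified_roots[OF \<iota>, of p x] D(2)[OF c] p(2) by blast
    then show ?thesis by (simp add: dec_def ser_def)
  qed
  then show ?thesis using D(1) by blast
qed

lemma finite_unramified:
  assumes "finite T" "\<And>x. x \<in> T \<Longrightarrow> separable_element x"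
  shows "\<exists>D. D \<noteq> 0 \<and> unramified D T"
  using assms
proof (induction T)
  case empty
  then show ?case by (intro exI[of _ 1]) simp
next
  case (insert x T)
  then obtain D where D: "D \<noteq> 0" "unramified D T" by auto
  obtain D' where D': "D' \<noteq> 0" "\<forall>c \<iota>. ev c D' \<noteq> 0 \<longrightarrow> place c \<iota> \<longrightarrow> x \<in> dec \<iota>"
    using separable_unramified[of x] insert.prems by blast
  show ?case
    by (rule exI[of _ "D * D'"]) (use D D' in \<open>auto simp: ev_simps\<close>)
qed

text \<open>Provides points away from the zeros of \<open>D\<close> together with a local parameter
  \<open>P\<close>. In characteristic 0 the field is infinite and some \<open>T - a\<close> does; a
  finite field may have no such \<open>a\<close>.\<close>

lemma separable_poly_avoiding:
  fixes D :: "'k::field poly"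
  assumes "D \<noteq> 0"
  obtains P :: "'k poly" where "degree P > 0"
    "\<And>c. ev c P = 0 \<Longrightarrow> ev c (pderiv P) \<noteq> 0 \<and> ev c D \<noteq> 0"
proof (cases "CHAR('k) = 0")
  case True
  have inj: "inj (of_nat :: nat \<Rightarrow> 'k)"
  proof (rule injI)
    fix m n :: nat assume eq: "(of_nat m :: 'k) = of_nat n"
    have "m = n" if "m \<le> n" "(of_nat m :: 'k) = of_nat n" for m n
    proof -
      have "of_nat (n - m) = (0 :: 'k)" using that by (simp add: of_nat_diff)
      then have "CHAR('k) dvd n - m" by (simp only: of_nat_eq_0_iff_char_dvd)
      then show ?thesis using True that(1) by simp
    qed
    then show "m = n" using eq by (metis nle_le)
  qed
  then have "infinite (range (of_nat :: nat \<Rightarrow> 'k))" using finite_imageD infinite_UNIV_nat by blast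
  then obtain a :: 'k where a: "poly D a \<noteq> 0"
    using poly_roots_finite[OF assms] by (metis (mono_tags, lifting) mem_Collect_eq rev_finite_subset subsetI)
  show ?thesis
  proof (rule that[of "[:-a, 1:]"])
    show "degree [:-a, 1:] > 0" by simp
    fix c assume "ev c [:-a, 1:] = 0"
    then have c: "c = const_to_ac a"
      by (simp add: ev_def map_poly_pCons hom_simps[OF hom_const])
    have "ev c D = const_to_ac (poly D a)"
      unfolding c ev_def by (simp add: hom_poly[OF hom_const])
    then show "ev c (pderiv [:-a, 1:]) \<noteq> 0 \<and> ev c D \<noteq> 0"
      using a by (simp add: pderiv_pCons ev_const hom_on_one[OF subring_set_UNIV hom_const]
        degree_map_poly_hom(1)[OF hom_const])
  qed
next
  case False
  let ?p = "CHAR('k)"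
  let ?X = "[:0, 1:] :: 'k poly"
  show ?thesis
  \<comment> \<open>In characteristic \<open>p\<close> the derivative of \<open>T * D^p + 1\<close>
    is \<open>D^p\<close>, because \<open>p\<close>-th powers have derivative zero, and no zero of
    \<open>D\<close> can be a root.\<close>
  proof (rule that[of "?X * D ^ ?p + 1"])
    have "degree (?X * D ^ ?p) > 0" using assms by (subst degree_mult_eq) auto
    then show "degree (?X * D ^ ?p + 1) > 0" by (subst degree_add_eq_left) auto
    fix c assume "ev c (?X * D ^ ?p + 1) = 0"
    then have "ev c ?X * ev c D ^ ?p + 1 = 0" by (simp add: ev_simps del: mult_pCons_left)
    then have nz: "ev c D \<noteq> 0" using False by (auto simp: power_0_left)
    have "pderiv (D ^ ?p) = 0" by (simp add: pderiv_power)
    then have "pderiv (?X * D ^ ?p + 1) = D ^ ?p"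
      by (simp add: pderiv_add pderiv_mult pderiv_pCons del: mult_pCons_left)
    then show "ev c (pderiv (?X * D ^ ?p + 1)) \<noteq> 0 \<and> ev c D \<noteq> 0" using nz by (simp add: ev_simps)
  qed
qed

lemma ev_root_exists:
  assumes "degree P > 0"
  shows "\<exists>c. ev c P = 0"
  unfolding ev_def using assms
  by (intro alg_closed_imp_poly_has_root) (simp add: degree_map_poly_hom(2)[OF hom_const])

section \<open>Polynomials with symmetric Galois group\<close>

text \<open>Induction on the size of \<open>W\<close>. All but one point of \<open>W\<close>, and
  their \<phi>-images, are moved onto the set \<open>Y\<close> of that size, by \<sigma> and \<tau>
  compatibly with \<phi>. Some \<rho> fixing \<open>Y\<close> then matches the remaining point, and
  \<rho> after \<sigma>, followed by the inverse of \<tau>, realises \<phi>.\<close>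

lemma symmetric_action:
  fixes F :: "'f::field alg_closure set"
  assumes fin: "finite Z" and stable: "\<And>\<sigma>. \<sigma> \<in> Gal F \<Longrightarrow> \<sigma> ` Z \<subseteq> Z"
    and step: "\<And>i. i < card Z \<Longrightarrow> \<exists>Y\<subseteq>Z. card Y = i \<and>
      (\<forall>y\<in>Z - Y. \<forall>y'\<in>Z - Y. \<exists>\<sigma>\<in>Gal (F \<union> Y). \<sigma> y = y')"
    and "W \<subseteq> Z" "inj_on \<phi> W" "\<phi> ` W \<subseteq> Z"
  shows "\<exists>\<sigma>\<in>Gal F. \<forall>x\<in>W. \<sigma> x = \<phi> x"
  using assms(4-6)
proof (induction "card W" arbitrary: W \<phi>)
  case 0
  then have "W = {}" using finite_subset[OF _ fin] by auto
  then show ?case using Gal_id by blast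
next
  case (Suc n)
  then have "W \<noteq> {}" by auto
  then obtain x W' where W: "W = insert x W'" "x \<notin> W'" by (meson mk_disjoint_insert ex_in_conv)
  have finX: "finite W" using Suc.prems(1) fin finite_subset by blast
  then have n: "card W' = n" using Suc.hyps(2) W by simp
  have "n < card Z" using Suc.hyps(2) card_mono[OF fin Suc.prems(1)] by simp
  then obtain Y where Y: "Y \<subseteq> Z" "card Y = n"
    "\<And>y y'. y \<in> Z - Y \<Longrightarrow> y' \<in> Z - Y \<Longrightarrow> \<exists>\<sigma>\<in>Gal (F \<union> Y). \<sigma> y = y'" using step by blast
  have finY: "finite Y" using Y(1) fin finite_subset by blast
  obtain \<eta> where \<eta>: "bij_betw \<eta> W' Y"
    using finite_same_card_bij[of W' Y] finX W finY Y(2) n by auto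
  then have \<eta>': "inj_on \<eta> W'" "\<eta> ` W' = Y" by (auto simp: bij_betw_def)
  have inj_phi: "inj_on \<phi> W'" using Suc.prems(2) W by (auto intro: inj_on_subset)
  obtain \<sigma> where \<sigma>: "\<sigma> \<in> Gal F" "\<forall>a\<in>W'. \<sigma> a = \<eta> a"
    using Suc.hyps(1)[of W' \<eta>] n Suc.prems(1) W \<eta>' Y(1) by auto
  have "\<exists>\<tau>\<in>Gal F. \<forall>a\<in>\<phi> ` W'. \<tau> a = (\<eta> \<circ> inv_into W' \<phi>) a"
  proof (rule Suc.hyps(1))
    show "n = card (\<phi> ` W')" using n by (simp add: card_image[OF inj_phi])
    show "\<phi> ` W' \<subseteq> Z" using Suc.prems(3) W by auto
    show "inj_on (\<eta> \<circ> inv_into W' \<phi>) (\<phi> ` W')"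
      by (rule comp_inj_on) (auto intro: inj_on_inv_into inj_on_subset[OF \<eta>'(1)] inv_into_into)
    show "(\<eta> \<circ> inv_into W' \<phi>) ` \<phi> ` W' \<subseteq> Z"
      using \<eta>'(2) Y(1) by (auto simp: inv_into_f_f[OF inj_phi])
  qed
  then obtain \<tau> where \<tau>: "\<tau> \<in> Gal F" "\<forall>a\<in>W'. \<tau> (\<phi> a) = \<eta> a"
    by (auto simp: inv_into_f_f[OF inj_phi])
  have "\<sigma> x \<in> Z - Y"
  proof
    show "\<sigma> x \<in> Z" using stable[OF \<sigma>(1)] Suc.prems(1) W by auto
    show "\<sigma> x \<notin> Y"
    proof
      assume "\<sigma> x \<in> Y"
      then obtain a where "a \<in> W'" "\<sigma> x = \<sigma> a" using \<eta>'(2) \<sigma>(2) by auto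
      then show False using W(2) Gal_simps(11)[OF \<sigma>(1)] by auto
    qed
  qed
  moreover have "\<tau> (\<phi> x) \<in> Z - Y"
  proof
    show "\<tau> (\<phi> x) \<in> Z" using stable[OF \<tau>(1)] Suc.prems(3) W by auto
    show "\<tau> (\<phi> x) \<notin> Y"
    proof
      assume "\<tau> (\<phi> x) \<in> Y"
      then obtain a where "a \<in> W'" "\<tau> (\<phi> x) = \<tau> (\<phi> a)" using \<eta>'(2) \<tau>(2) by force
      then show False using W Suc.prems(2) Gal_simps(11)[OF \<tau>(1)] by (auto simp: inj_on_def)
    qed
  qed
  ultimately obtain \<rho> where \<rho>: "\<rho> \<in> Gal (F \<union> Y)" "\<rho> (\<sigma> x) = \<tau> (\<phi> x)" using Y(3) by blast
  define \<omega> where "\<omega> = inv_into UNIV \<tau> \<circ> (\<rho> \<circ> \<sigma>)"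
  have "\<rho> \<in> Gal F" using \<rho>(1) Gal_mono[of F "F \<union> Y"] by auto
  then have "\<omega> \<in> Gal F" unfolding \<omega>_def by (intro Gal_comp Gal_inv \<tau> \<sigma>)
  moreover have "\<omega> a = \<phi> a" if "a \<in> W" for a
  proof (cases "a = x")
    case True
    then show ?thesis by (simp add: \<omega>_def \<rho>(2) Gal_inv(2)[OF \<tau>(1)])
  next
    case False
    then have a: "a \<in> W'" using that W by auto
    then have "\<rho> (\<sigma> a) = \<tau> (\<phi> a)" using Gal_fixes[OF \<rho>(1)] \<eta>'(2) \<sigma>(2) \<tau>(2) by force
    then show ?thesis by (simp add: \<omega>_def Gal_inv(2)[OF \<tau>(1)])
  qed
  ultimately show ?case by blast
qed

text \<open>At a place above \<open>c\<close> a multiple root would become a power series whose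
  residue is a multiple root of the reduction.\<close>

lemma squarefree_lift:
  fixes p :: "'k::field poly poly"
  assumes deg: "degree (map_poly (ev c) p) = degree p" and sq: "rsquarefree (map_poly (ev c) p)"
  shows "rsquarefree (map_poly emb p)"
proof -
  obtain \<iota> where \<iota>: "place c \<iota>" using place_exists by blast
  let ?q = "map_poly (expand c) p"
  have mr: "map_poly res ?q = map_poly (ev c) p"
    by (simp add: map_poly_comp[OF hom_res hom_expand] res_expand)
  have nz: "map_poly (ev c) p \<noteq> 0" using sq by (auto simp: rsquarefree_def)
  then have "p \<noteq> 0" by auto
  then have nz': "map_poly emb p \<noteq> 0" by (simp add: map_poly_eq_0_iff)
  have "poly (pderiv (map_poly emb p)) x \<noteq> 0" if x: "poly (map_poly emb p) x = 0" for x
  proof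
    assume x': "poly (pderiv (map_poly emb p)) x = 0"
    obtain r where r: "\<iota> x = ser r" "poly ?q r = 0" using unramified_roots[OF \<iota> deg sq x] .
    have "\<iota> (poly (map_poly emb (pderiv p)) x) = ser (poly (map_poly (expand c) (pderiv p)) r)"
      using place_poly[OF \<iota>, of "pderiv p" x] r by (simp add: ser_poly)
    then have "poly (map_poly (expand c) (pderiv p)) r = 0"
      using x' hom_zero[OF place_hom[OF \<iota>]] by (simp add: map_poly_pderiv[OF hom_emb])
    then have "res (poly (pderiv ?q) r) = 0" by (simp add: map_poly_pderiv[OF hom_expand])
    then have "poly (pderiv (map_poly (ev c) p)) (res r) = 0"
      by (simp add: res_poly map_poly_pderiv[OF hom_res] mr)
    moreover have "poly (map_poly (ev c) p) (res r) = 0"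
      using arg_cong[OF r(2), of res] by (simp add: res_poly mr)
    ultimately show False using squarefree_iff_pderiv[OF nz] sq by blast
  qed
  then show ?thesis using squarefree_iff_pderiv[OF nz'] by blast
qed

lemma separable_root:
  assumes "rsquarefree (map_poly emb p)" "poly (map_poly emb p) x = 0"
  shows "separable_element x"
  unfolding separable_element_iff separable_over_def
  using assms by (intro exI[of _ "map_poly emb p"]) (auto simp: poly_over_def coeff_map_poly emb_def)

lemma place_roots_lift:
  assumes \<iota>: "place c \<iota>" and p: "p \<noteq> 0"
  shows "{b. poly (map_poly ser (map_poly (expand c) p)) b = 0} = \<iota> ` {x. poly (map_poly emb p) x = 0}"
proof -
  note h = place_hom[OF \<iota>]
  have eq: "map_poly \<iota> (map_poly emb p) = map_poly ser (map_poly (expand c) p)"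
    by (simp add: map_poly_comp[OF h hom_emb] map_poly_comp[OF hom_ser hom_expand] place_emb[OF \<iota>])
  have nz: "map_poly emb p \<noteq> 0" using p by (simp add: map_poly_eq_0_iff)
  have "\<exists>x. b = \<iota> x \<and> poly (map_poly emb p) x = 0"
    if "poly (map_poly ser (map_poly (expand c) p)) b = 0" for b
    using hom_root_lift[OF h nz, of b] that unfolding eq .
  moreover have "poly (map_poly ser (map_poly (expand c) p)) (\<iota> x) = 0" if "poly (map_poly emb p) x = 0" for x
    using place_poly[OF \<iota>, of p x] that place_eq_iff(2)[OF \<iota>, of 0] by simp
  ultimately show ?thesis by blast
qed

text \<open>The conditions at the different points are imposed independently by interpolation:
  \<open>R i\<close> vanishes at every chosen point \<open>a j\<close> with \<open>j < n\<close>
  other than \<open>a i\<close>. Transitivity outside \<open>i\<close> roots is read off at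
  \<open>a i\<close>, and \<open>symmetric_action\<close> assembles the symmetric group.\<close>

theorem symmetric_splitting:
  fixes D :: "'k::field poly" and F :: "'k acl set"
  assumes D: "D \<noteq> 0" "unramified D F" and n: "n > 0"
  obtains Z where "finite Z" "card Z = n" "\<forall>z\<in>Z. separable_element z"
    "\<forall>\<sigma>\<in>Gal {}. \<sigma> ` Z \<subseteq> Z"
    "\<forall>\<phi>. inj_on \<phi> Z \<longrightarrow> \<phi> ` Z \<subseteq> Z \<longrightarrow> (\<exists>\<sigma>\<in>Gal (F \<union> constant_closure). \<forall>z\<in>Z. \<sigma> z = \<phi> z)"
proof -
  \<comment> \<open>Each new polynomial has no root in common with an earlier one; this later
    separates the points \<open>a i\<close>.\<close>
  define Q where "Q = (\<lambda>(f :: nat \<Rightarrow> 'k poly) (j :: nat) (r :: 'k poly). degree r > 0 \<and> (\<forall>c. ev c r = 0 \<longrightarrow>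
    ev c (pderiv r) \<noteq> 0 \<and> ev c D \<noteq> 0 \<and> (\<forall>i<j. ev c (f i) \<noteq> 0)))"
  have "\<exists>P. \<forall>j::nat. Q P j (P j)"
  proof (rule dependent_wellorder_choice)
    show "Q f x r = Q g x r" if "\<And>y. y < x \<Longrightarrow> f y = g y" for r f g and x :: nat
      using that by (auto simp: Q_def)
    show "\<exists>r. Q f x r" if "\<And>y. y < x \<Longrightarrow> Q f y (f y)" for x f
    proof -
      have "f y \<noteq> 0" if "y < x" for y using \<open>\<And>y. y < x \<Longrightarrow> Q f y (f y)\<close>[OF that] by (auto simp: Q_def)
      then have "D * prod f {..<x} \<noteq> 0" using D(1) by simp
      then obtain r where r: "degree r > 0"
        "\<And>c. ev c r = 0 \<Longrightarrow> ev c (pderiv r) \<noteq> 0 \<and> ev c (D * prod f {..<x}) \<noteq> 0"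
        using separable_poly_avoiding by blast
      have "ev c (prod f {..<x}) = (\<Prod>i<x. ev c (f i))" for c
        by (rule hom_prod[OF hom_ev]) auto
      then have "Q f x r" using r by (auto simp: Q_def ev_simps)
      then show ?thesis by blast
    qed
  qed
  then obtain P where Q: "\<And>j. Q P j (P j)" by blast
  have P: "degree (P j) > 0"
    "ev c (P j) = 0 \<Longrightarrow> ev c (pderiv (P j)) \<noteq> 0 \<and> ev c D \<noteq> 0 \<and> (\<forall>i<j. ev c (P i) \<noteq> 0)" for j c
    using Q[of j] by (simp_all add: Q_def)
  obtain a where a: "\<And>j. ev (a j) (P j) = 0" using ev_root_exists[OF P(1)] by metis
  have a': "ev (a i) (P j) \<noteq> 0" if "j \<noteq> i" for i j
    using P(2)[OF a, of i] P(2)[of "a i" j] a[of i] that by (meson linorder_neqE_nat)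
  define R where "R = (\<lambda>i. prod P ({..<n} - {i}))"
  \<comment> \<open>The linear term is switched on exactly when the characteristic divides
    \<open>i\<close>, where \<open>X^i + r\<close> alone would be inseparable.\<close>
  define \<delta> where "\<delta> = (\<lambda>i. if of_nat i = (0::'k) then 1 else 0 :: 'k poly)"
  \<comment> \<open>At \<open>a i\<close> all \<open>R j\<close> with \<open>j \<noteq> i\<close>
    and the constant term vanish, leaving \<open>X^(n - i)\<close> times
    \<open>X^i + r (\<delta> X + 1)\<close> for \<open>i > 0\<close>, and \<open>X^n\<close> for
    \<open>i = 0\<close>. The constant term has a simple zero there.\<close>
  define p where "p = monom 1 n + (\<Sum>i=1..<n. smult (R i) (monom (\<delta> i) (n - i + 1) + monom 1 (n - i)))
    + [:prod P {..<n}:]"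
  \<comment> \<open>For \<open>i = 1\<close> the extra monomial would have degree \<open>n\<close>;
    its vanishing keeps \<open>p\<close> monic.\<close>
  have \<delta>1: "\<delta> 1 = 0" by (simp add: \<delta>_def)
  have cf: "coeff p j = (if j = n then 1 else 0) +
    (\<Sum>i=1..<n. R i * ((if n - i + 1 = j then \<delta> i else 0) + (if n - i = j then 1 else 0))) +
    (if j = 0 then prod P {..<n} else 0)" for j
    unfolding p_def by (simp add: coeff_sum coeff_pCons split: nat.split)
  have cfn: "coeff p j = (if j = n then 1 else 0)" if "j \<ge> n" for j
  proof -
    have "R i * ((if n - i + 1 = j then \<delta> i else 0) + (if n - i = j then 1 else 0)) = 0"
      if i: "i \<in> {1..<n}" for i
    proof (cases "i = 1")
      case True
      then show ?thesis using \<delta>1 \<open>j \<ge> n\<close> i by auto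
    next
      case False
      then show ?thesis using \<open>j \<ge> n\<close> i by auto
    qed
    then have "(\<Sum>i=1..<n. R i * ((if n - i + 1 = j then \<delta> i else 0) + (if n - i = j then 1 else 0))) = 0"
      by (intro sum.neutral) blast
    then show ?thesis using that n unfolding cf by simp
  qed
  have degp: "degree p = n"
  proof (rule antisym)
    show "degree p \<le> n" by (rule degree_le) (simp add: cfn)
    show "n \<le> degree p" by (rule le_degree) (simp add: cfn)
  qed
  have lcp: "lead_coeff p = 1" by (simp add: degp cfn)
  have cf0: "coeff p 0 = prod P {..<n}"
    unfolding cf using n by (auto intro!: sum.neutral)
  define h where "h = (\<lambda>i. monom 1 i + (if i = 0 then 0 else smult (ev (a i) (R i)) [:1, ev (a i) (\<delta> i):]))"
  have evR: "ev (a i) (R j) = (\<Prod>l\<in>{..<n} - {j}. ev (a i) (P l))" for i j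
    unfolding R_def by (rule hom_prod[OF hom_ev]) auto
  have R0: "ev (a i) (R i) \<noteq> 0" for i unfolding evR using a' by auto
  have Rj: "ev (a i) (R j) = 0" if "i < n" "j \<noteq> i" for i j unfolding evR using a that by auto
  have red: "map_poly (ev (a i)) p = monom 1 (n - i) * h i" if i: "i < n" for i
  proof -
    have "map_poly (ev (a i)) p = monom 1 n +
      (\<Sum>j=1..<n. smult (ev (a i) (R j)) (monom (ev (a i) (\<delta> j)) (n - j + 1) + monom 1 (n - j)))
      + [:ev (a i) (prod P {..<n}):]"
      unfolding p_def
      by (simp add: map_hom_simps[OF hom_ev] map_poly_hom_sum[OF subring_set_UNIV hom_ev] ev_simps
        del: One_nat_def)
    also have "(\<Sum>j=1..<n. smult (ev (a i) (R j)) (monom (ev (a i) (\<delta> j)) (n - j + 1) + monom 1 (n - j)))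
      = (\<Sum>j=1..<n. if j = i then smult (ev (a i) (R i)) (monom (ev (a i) (\<delta> i)) (n - i + 1) + monom 1 (n - i)) else 0)"
      using Rj[OF i] by (intro sum.cong) auto
    also have "\<dots> = (if i = 0 then 0 else smult (ev (a i) (R i)) (monom (ev (a i) (\<delta> i)) (n - i + 1) + monom 1 (n - i)))"
      using i by (simp add: sum.delta')
    also have "ev (a i) (prod P {..<n}) = 0"
    proof -
      have "ev (a i) (prod P {..<n}) = (\<Prod>l<n. ev (a i) (P l))"
        by (rule hom_prod[OF hom_ev]) auto
      then show ?thesis using a i by auto
    qed
    also have "monom 1 n + (if i = 0 then 0 else smult (ev (a i) (R i))
        (monom (ev (a i) (\<delta> i)) (n - i + 1) + monom 1 (n - i))) + [:0:] = monom 1 (n - i) * h i"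
    proof -
      have l: "[:1, ev (a i) (\<delta> i):] = monom (ev (a i) (\<delta> i)) 1 + monom 1 0"
        by (simp add: monom_altdef)
      have "n - i + i = n" using i by simp
      then show ?thesis
        unfolding h_def l by (simp add: distrib_left mult_monom smult_add_right smult_monom)
    qed
    finally show ?thesis .
  qed
  have h0: "poly (h i) 0 \<noteq> 0" for i using R0[of i] by (auto simp: h_def poly_monom power_0_left)
  then have hnz: "h i \<noteq> 0" for i by (metis poly_0)
  have hsq: "rsquarefree (h i)" for i
    unfolding squarefree_iff_pderiv[OF hnz]
  proof (intro allI impI)
    fix x assume x: "poly (h i) x = 0"
    show "poly (pderiv (h i)) x \<noteq> 0"
    proof (cases "i = 0")
      case True
      then show ?thesis using x by (simp add: h_def)
    next
      case False
      have x0: "x \<noteq> 0" using x h0 by auto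
      have "(of_nat i :: 'k acl) = const_to_ac (of_nat i)"
        by (induction i) (simp_all add: hom_simps[OF hom_const])
      then have ofn: "of_nat i = (0 :: 'k acl) \<longleftrightarrow> of_nat i = (0::'k)"
        by (simp only: degree_map_poly_hom(1)[OF hom_const])
      have "pderiv (h i) = monom (of_nat i) (i - 1) + [:ev (a i) (R i) * ev (a i) (\<delta> i):]"
        using False by (simp add: h_def pderiv_add pderiv_monom pderiv_smult pderiv_pCons)
      then show ?thesis
        using x0 R0[of i] ofn by (auto simp: \<delta>_def poly_monom ev_simps)
    qed
  qed
  \<comment> \<open>At \<open>a (n - 1)\<close> the power of \<open>X\<close> split off is just
    \<open>X\<close>, so this one reduction is squarefree, and that suffices.\<close>
  have sqp: "rsquarefree (map_poly emb p)"
  proof (rule squarefree_lift[of "a (n - 1)"])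
    have m: "map_poly (ev (a (n - 1))) p = monom 1 1 * h (n - 1)" using red[of "n - 1"] n by simp
    show "degree (map_poly (ev (a (n - 1))) p) = degree p"
      by (rule map_poly_degree_eq) (use lcp in \<open>simp add: ev_simps\<close>)
    have W: "monom 1 1 * h (n - 1) \<noteq> 0" using hnz by (simp add: monom_eq_0_iff)
    show "rsquarefree (map_poly (ev (a (n - 1))) p)"
      unfolding m squarefree_iff_pderiv[OF W]
    proof (intro allI impI)
      fix x assume "poly (monom 1 1 * h (n - 1)) x = 0"
      then have "x = 0 \<or> poly (h (n - 1)) x = 0" by (simp add: poly_monom)
      then show "poly (pderiv (monom 1 1 * h (n - 1))) x \<noteq> 0"
        using h0[of "n - 1"] hsq[of "n - 1"] squarefree_iff_pderiv[OF hnz, of "n - 1"]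
        by (auto simp: pderiv_mult poly_monom pderiv_monom)
    qed
  qed
  define Z where "Z = {x. poly (map_poly emb p) x = 0}"
  have nzp: "map_poly emb p \<noteq> 0" using sqp by (auto simp: rsquarefree_def)
  have finZ: "finite Z" unfolding Z_def by (rule poly_roots_finite[OF nzp])
  have degp': "degree (map_poly emb p) = n" using degp by (subst degree_map_poly) auto
  have cardZ: "card Z = n" using squarefree_card_roots[OF nzp] sqp degp' by (simp add: Z_def)
  have stable: "\<sigma> ` Z \<subseteq> Z" if "\<sigma> \<in> Gal {}" for \<sigma>
    using Gal_root_emb[OF that] by (auto simp: Z_def)
  let ?F = "F \<union> constant_closure"
  have step: "\<exists>Y\<subseteq>Z. card Y = i \<and> (\<forall>y\<in>Z - Y. \<forall>y'\<in>Z - Y. \<exists>\<sigma>\<in>Gal (?F \<union> Y). \<sigma> y = y')"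
    if i: "i < card Z" for i
  proof -
    have i: "i < n" using i cardZ by simp
    obtain \<iota> where \<iota>: "place (a i) \<iota>" using place_exists by blast
    let ?q = "map_poly (expand (a i)) p"
    have lq: "degree ?q = n" "lead_coeff ?q = 1"
    proof -
      show dq: "degree ?q = n" using degp by (subst degree_map_poly) auto
      show "lead_coeff ?q = 1" using lcp degp unfolding dq
        by (simp add: coeff_map_hom[OF hom_expand] expand_simps)
    qed
    have rq: "map_poly res ?q = monom 1 (n - i) * h i"
      using red[OF i] by (simp add: map_poly_comp[OF hom_res hom_expand] res_expand)
    have q1: "fps_nth (coeff ?q 0) 1 \<noteq> 0"
    proof -
      have "prod P {..<n} = P i * R i" unfolding R_def using i by (subst prod.remove[of _ i]) auto
      then have "ev (a i) (pderiv (prod P {..<n})) = ev (a i) (P i) * ev (a i) (pderiv (R i)) + ev (a i) (R i) * ev (a i) (pderiv (P i))"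
        by (simp add: pderiv_mult ev_simps)
      then show ?thesis
        using a[of i] R0[of i] P(2)[OF a, of i]
        by (simp add: coeff_map_hom[OF hom_expand] cf0 expand_nth_1 del: One_nat_def)
    qed
    obtain S g where S: "finite S" "card S = degree (h i)" "?q = (\<Prod>r\<in>S. [:-r, 1:]) * g"
      "irred (fract_poly g)" "degree ?q = (n - i) + degree (h i)"
      using eisenstein_cofactor[OF lq(2) rq hsq h0 _ q1] i by auto
    have cardS: "card S = i" using S(2,5) lq(1) i by simp
    have roots: "{b. poly (map_poly ser ?q) b = 0} = \<iota> ` Z"
      unfolding Z_def by (rule place_roots_lift[OF \<iota>]) (use lcp in auto)
    have fact: "map_poly ser ?q = (\<Prod>r\<in>S. [:- ser r, 1:]) * map_poly ser g"
      unfolding S(3) by (simp add: map_hom_mult[OF hom_ser]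
        map_hom_prod[OF hom_ser] map_poly_pCons)
    \<comment> \<open>The roots that become the power series in \<open>S\<close>; all others are
      roots of the irreducible cofactor \<open>g\<close>, hence conjugate over the decomposition
      field, which contains \<open>F\<close>, \<open>Y\<close> and the constants.\<close>
    define Y where "Y = {y \<in> Z. \<iota> y \<in> ser ` S}"
    have sub: "ser ` S \<subseteq> \<iota> ` Z"
      unfolding roots[symmetric] fact using S(1) by (auto simp: poly_prod)
    have "\<iota> ` Y = ser ` S"
    proof
      show "ser ` S \<subseteq> \<iota> ` Y"
      proof
        fix b assume b: "b \<in> ser ` S"
        then obtain z where "z \<in> Z" "b = \<iota> z" using sub by blast
        then show "b \<in> \<iota> ` Y" using b by (simp add: Y_def)
      qed
    qed (auto simp: Y_def)
    then have "card Y = card S"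
      using place_eq_iff(1)[OF \<iota>] by (metis card_image inj_on_def inj_ser inj_on_subset subset_UNIV)
    then have "card Y = i" using cardS by simp
    moreover have "Y \<subseteq> Z" by (auto simp: Y_def)
    moreover have "\<exists>\<sigma>\<in>Gal (?F \<union> Y). \<sigma> y = y'" if yy: "y \<in> Z - Y" "y' \<in> Z - Y" for y y'
    proof -
      have r: "poly (map_poly ser g) (\<iota> x) = 0" if "x \<in> Z - Y" for x
      proof -
        have "poly (map_poly ser ?q) (\<iota> x) = 0" using roots that by blast
        then show ?thesis unfolding fact using that S(1) by (auto simp: poly_prod Y_def)
      qed
      obtain \<sigma> where \<sigma>: "\<sigma> \<in> Gal (dec \<iota>)" "\<sigma> y = y'"
        using place_transitive[OF \<iota> S(4) r[OF yy(1)] r[OF yy(2)]] .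
      have "Y \<subseteq> dec \<iota>" by (auto simp: Y_def dec_def ser_def)
      moreover have "F \<subseteq> dec \<iota>" using D(2) \<iota> P(2)[OF a, of i] by blast
      ultimately have "?F \<union> Y \<subseteq> dec \<iota>" using constants_dec[OF \<iota>] by blast
      then show ?thesis using \<sigma> Gal_mono by blast
    qed
    ultimately show ?thesis by blast
  qed
  show ?thesis
  proof (rule that[OF finZ cardZ]; intro ballI allI impI)
    show "separable_element z" if "z \<in> Z" for z
      using separable_root[OF sqp, of z] that by (simp add: Z_def)
    show "\<sigma> ` Z \<subseteq> Z" if "\<sigma> \<in> Gal {}" for \<sigma> by (rule stable[OF that])
    fix \<phi> assume \<phi>: "inj_on \<phi> Z" "\<phi> ` Z \<subseteq> Z"
    show "\<exists>\<sigma>\<in>Gal ?F. \<forall>z\<in>Z. \<sigma> z = \<phi> z"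
    proof (rule symmetric_action[OF finZ _ _ subset_refl \<phi>])
      show "\<sigma> ` Z \<subseteq> Z" if "\<sigma> \<in> Gal ?F" for \<sigma> using stable Gal_empty[OF that] .
    qed (rule step)
  qed
qed

section \<open>Rigid generators\<close>

lemma infinite_base: "infinite (base_field :: 'k::field acl set)"
proof
  assume fin: "finite (base_field :: 'k acl set)"
  have "range (\<lambda>n. emb (monom (1::'k) n)) \<subseteq> base_field" by (auto simp: emb_def)
  then have "finite (range (\<lambda>n. emb (monom (1::'k) n)))" using fin finite_subset by blast
  moreover have "inj (\<lambda>n. emb (monom (1::'k) n))"
    by (rule injI) (metis degree_monom_eq emb_eq_iff one_neq_zero)
  ultimately show False using finite_imageD infinite_UNIV_nat by blast
qed

lemma infinite_minus_finite: "infinite A \<Longrightarrow> finite B \<Longrightarrow> \<exists>x\<in>A. x \<notin> B"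
  by (meson rev_finite_subset subsetI)

text \<open>The primitive element argument, expressed through automorphisms: a combination
  \<open>\<theta> + c * t\<close> separates all images of both parts once \<open>c\<close> avoids
  finitely many values.\<close>

lemma separating_element:
  fixes T :: "'k::field acl set"
  assumes "finite T"
  shows "\<exists>\<theta>\<in>gen T. \<forall>\<sigma>\<in>Gal {}. \<forall>\<tau>\<in>Gal {}. \<sigma> \<theta> = \<tau> \<theta> \<longrightarrow> (\<forall>t\<in>T. \<sigma> t = \<tau> t)"
  using assms
proof (induction T)
  case empty
  then show ?case using subring_set_zero[OF subring_set_gen] by blast
next
  case (insert t T)
  then obtain \<theta> where \<theta>: "\<theta> \<in> gen T"
    "\<And>\<sigma> \<tau>. \<sigma> \<in> Gal {} \<Longrightarrow> \<tau> \<in> Gal {} \<Longrightarrow> \<sigma> \<theta> = \<tau> \<theta> \<Longrightarrow> \<forall>t\<in>T. \<sigma> t = \<tau> t" by blast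
  define U where "U = {\<sigma> \<theta> |\<sigma>. \<sigma> \<in> Gal {}}"
  define V where "V = {\<sigma> t |\<sigma>. \<sigma> \<in> Gal {}}"
  \<comment> \<open>If two automorphisms agree on the combination but not on \<open>t\<close>, then
    \<open>c\<close> is one of these quotients of differences of conjugates.\<close>
  define bad where "bad = (\<lambda>(a, a', b, b'). (a - a') / (b' - b)) ` (U \<times> U \<times> V \<times> V)"
  have "finite bad" unfolding bad_def U_def V_def by (intro finite_imageI finite_cartesian_product finite_orbit)
  then obtain c where c: "c \<in> base_field" "c \<notin> bad" using infinite_minus_finite[OF infinite_base] by blast
  note sr = subring_set_gen
  have sub: "insert t T \<subseteq> gen (insert t T)" by (rule gen_incl)
  have "c \<in> gen (insert t T)" using c(1) intermediate_base[OF intermediate_gen] by auto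
  moreover have "\<theta> \<in> gen (insert t T)" using \<theta>(1) gen_mono[of T "insert t T"] by auto
  ultimately have "\<theta> + c * t \<in> gen (insert t T)"
    using sub by (intro subring_set_add subring_set_mult sr) auto
  moreover have "\<forall>x\<in>insert t T. \<sigma> x = \<tau> x"
    if \<sigma>: "\<sigma> \<in> Gal {}" and \<tau>: "\<tau> \<in> Gal {}" and eq: "\<sigma> (\<theta> + c * t) = \<tau> (\<theta> + c * t)" for \<sigma> \<tau>
  proof -
    have fc: "\<sigma> c = c" "\<tau> c = c" using c(1) Gal_base[OF \<sigma>] Gal_base[OF \<tau>] by auto
    have eq': "\<sigma> \<theta> + c * \<sigma> t = \<tau> \<theta> + c * \<tau> t"
      using eq by (simp add: Gal_simps[OF \<sigma>] Gal_simps[OF \<tau>] fc)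
    have "\<sigma> t = \<tau> t"
    proof (rule ccontr)
      assume ne: "\<sigma> t \<noteq> \<tau> t"
      have "c = (\<sigma> \<theta> - \<tau> \<theta>) / (\<tau> t - \<sigma> t)" using eq' ne by (simp add: field_simps)
      moreover have "(\<sigma> \<theta>, \<tau> \<theta>, \<sigma> t, \<tau> t) \<in> U \<times> U \<times> V \<times> V" using \<sigma> \<tau> by (auto simp: U_def V_def)
      ultimately have "c \<in> bad" unfolding bad_def by (metis (mono_tags, lifting) case_prod_conv image_eqI)
      then show False using c(2) by blast
    qed
    then show ?thesis using \<theta>(2)[OF \<sigma> \<tau>] eq' by simp
  qed
  ultimately show ?case by blast
qed

text \<open>The polynomial with roots \<open>s h \<theta>\<close> is invariant under the action, and
  its coefficients together determine the set of these roots. To have a single element, it is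
  evaluated at a \<open>c\<close> at which none of the finitely many relevant polynomials
  coincide.\<close>

lemma invariant_element:
  fixes T :: "'k::field acl set"
  assumes T: "finite T" and I: "finite I" "e \<in> I"
    and s: "\<And>h. h \<in> I \<Longrightarrow> s h \<in> Gal {}" "\<And>h t. h \<in> I \<Longrightarrow> t \<in> T \<Longrightarrow> s h t \<in> gen T"
      "\<And>t. t \<in> T \<Longrightarrow> s e t = t"
    and mult: "\<And>h. h \<in> I \<Longrightarrow> \<exists>b. bij_betw b I I \<and> (\<forall>g\<in>I. \<forall>t\<in>T. s h (s g t) = s (b g) t)"
  obtains w where "w \<in> gen T" "w \<noteq> 0" "\<forall>h\<in>I. s h w = w"
    "\<forall>\<sigma>\<in>Gal {}. \<sigma> w = w \<longrightarrow> (\<exists>h\<in>I. \<forall>t\<in>T. \<sigma> t = s h t)"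
proof -
  obtain \<theta> where \<theta>: "\<theta> \<in> gen T"
    "\<And>\<sigma> \<tau>. \<sigma> \<in> Gal {} \<Longrightarrow> \<tau> \<in> Gal {} \<Longrightarrow> \<sigma> \<theta> = \<tau> \<theta> \<Longrightarrow> \<forall>t\<in>T. \<sigma> t = \<tau> t"
    using separating_element[OF T] by blast
  define U where "U = {\<sigma> \<theta> |\<sigma>. \<sigma> \<in> Gal {}}"
  have finU: "finite U" unfolding U_def by (rule finite_orbit)
  define P where "P = (\<lambda>a. \<Prod>h\<in>I. [:- a h, 1:] :: 'k acl poly)"
  \<comment> \<open>Excluding \<open>U\<close> makes \<open>w\<close> nonzero; excluding the zeros
    of the differences makes evaluation at \<open>c\<close> injective on products of
    \<open>X - a h\<close> with all \<open>a h\<close> in \<open>U\<close>. Extensional functions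
    keep the index set finite.\<close>
  define bad where "bad = U \<union> (\<Union>a\<in>I \<rightarrow>\<^sub>E U. \<Union>b\<in>I \<rightarrow>\<^sub>E U. if P a = P b then {} else {x. poly (P a - P b) x = 0})"
  have "finite (if P a = P b then {} else {x. poly (P a - P b) x = 0})" for a b
    using poly_roots_finite[of "P a - P b"] by (auto simp del: poly_diff)
  then have "finite bad"
    unfolding bad_def by (intro finite_UnI finite_UN_I finite_PiE finU I)
  then obtain c where c: "c \<in> base_field" "c \<notin> bad" using infinite_minus_finite[OF infinite_base] by blast
  have Pc: "poly (P a) c = (\<Prod>h\<in>I. c - a h)" for a by (simp add: P_def poly_prod)
  have P_restrict: "P (restrict a I) = P a" for a by (simp add: P_def)
  have key: "P a = P b" if "\<And>h. h \<in> I \<Longrightarrow> a h \<in> U" "\<And>h. h \<in> I \<Longrightarrow> b h \<in> U" "poly (P a) c = poly (P b) c" for a b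
  proof (rule ccontr)
    assume "P a \<noteq> P b"
    then have "c \<in> (if P (restrict a I) = P (restrict b I) then {} else {x. poly (P (restrict a I) - P (restrict b I)) x = 0})"
      using that(3) by (simp add: P_restrict)
    moreover have "restrict a I \<in> I \<rightarrow>\<^sub>E U" "restrict b I \<in> I \<rightarrow>\<^sub>E U" using that(1,2) by auto
    ultimately show False using c(2) unfolding bad_def by blast
  qed
  define w where "w = (\<Prod>h\<in>I. c - s h \<theta>)"
  have wP: "w = poly (P (\<lambda>h. s h \<theta>)) c" by (simp add: w_def Pc)
  have fc: "\<sigma> c = c" if "\<sigma> \<in> Gal {}" for \<sigma> using c(1) Gal_base[OF that] by auto
  have sU: "s h \<theta> \<in> U" if "h \<in> I" for h using s(1)[OF that] by (auto simp: U_def)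
  have \<sigma>w: "\<sigma> w = (\<Prod>h\<in>I. c - \<sigma> (s h \<theta>))" if \<sigma>: "\<sigma> \<in> Gal {}" for \<sigma>
    unfolding w_def by (subst hom_prod[OF Gal_hom[OF \<sigma>]]) (auto simp: Gal_simps[OF \<sigma>] fc[OF \<sigma>])
  have sgen: "s h x \<in> gen T" if h: "h \<in> I" and x: "x \<in> gen T" for h x
  proof -
    have "T \<subseteq> {x. s h x \<in> gen T}" using s(2)[OF h] by auto
    then have "gen T \<subseteq> {x. s h x \<in> gen T}"
      by (rule gen_least[OF intermediate_preimage[OF s(1)[OF h] intermediate_gen]])
    then show ?thesis using x by auto
  qed
  show ?thesis
  proof (rule that; (intro ballI impI)?)
    have "c \<in> gen T" using c(1) intermediate_base[OF intermediate_gen] by auto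
    then show "w \<in> gen T" unfolding w_def
      using \<theta>(1) sgen by (intro subring_set_prod subring_set_diff subring_set_gen) auto
    show "w \<noteq> 0" unfolding w_def using c(2) sU I(1) by (auto simp: bad_def)
    show "s h w = w" if h: "h \<in> I" for h
    proof -
      obtain b where b: "bij_betw b I I" "\<forall>g\<in>I. \<forall>t\<in>T. s h (s g t) = s (b g) t" using mult[OF h] by blast
      have "s h (s g \<theta>) = s (b g) \<theta>" if g: "g \<in> I" for g
      proof -
        have bg: "b g \<in> I" using b(1) g by (auto simp: bij_betw_def)
        have "(s h \<circ> s g) \<theta> = s (b g) \<theta>"
          by (rule Gal_agree_gen[OF Gal_comp[OF s(1)[OF h] s(1)[OF g]] s(1)[OF bg] _ \<theta>(1)]) (use b(2) g in auto)
        then show ?thesis by simp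
      qed
      then have "s h w = (\<Prod>g\<in>I. c - s (b g) \<theta>)" unfolding \<sigma>w[OF s(1)[OF h]] by (intro prod.cong) auto
      also have "\<dots> = w" unfolding w_def by (rule prod.reindex_bij_betw[OF b(1)])
      finally show ?thesis .
    qed
    fix \<sigma> assume \<sigma>: "\<sigma> \<in> Gal {}" "\<sigma> w = w"
    have "P (\<lambda>h. \<sigma> (s h \<theta>)) = P (\<lambda>h. s h \<theta>)"
    proof (rule key)
      show "\<sigma> (s h \<theta>) \<in> U" if "h \<in> I" for h
        using Gal_comp[OF \<sigma>(1) s(1)[OF that]] unfolding U_def
        by (intro CollectI exI[of _ "\<sigma> \<circ> s h"]) simp
      show "poly (P (\<lambda>h. \<sigma> (s h \<theta>))) c = poly (P (\<lambda>h. s h \<theta>)) c"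
        using \<sigma>w[OF \<sigma>(1)] \<sigma>(2) wP by (simp add: Pc)
    qed (use sU in auto)
    \<comment> \<open>As \<open>s e\<close> is the identity on \<open>T\<close>, locating the image
      of \<open>s e \<theta>\<close> among the \<open>s h \<theta>\<close> identifies \<sigma> on
      \<open>T\<close>, because \<theta> separates automorphisms.\<close>
    moreover have "poly (P (\<lambda>h. \<sigma> (s h \<theta>))) (\<sigma> (s e \<theta>)) = 0" using I by (auto simp: P_def poly_prod)
    ultimately have "poly (P (\<lambda>h. s h \<theta>)) (\<sigma> (s e \<theta>)) = 0" by simp
    then obtain h where h: "h \<in> I" "\<sigma> (s e \<theta>) = s h \<theta>" using I(1) by (auto simp: P_def poly_prod)
    have "\<forall>t\<in>T. (\<sigma> \<circ> s e) t = s h t"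
      by (rule \<theta>(2)[OF Gal_comp[OF \<sigma>(1) s(1)[OF I(2)]] s(1)[OF h(1)]]) (simp add: h(2))
    then show "\<exists>h\<in>I. \<forall>t\<in>T. \<sigma> t = s h t" using h(1) s(3) by auto
  qed
qed

section \<open>Trinomials over fields and over power series\<close>

definition trinomial :: "nat \<Rightarrow> 'a::comm_ring_1 \<Rightarrow> 'a \<Rightarrow> 'a poly" where
  "trinomial m b a = monom 1 m + monom b (m - 1) + [:a:]"

lemma map_trinomial:
  assumes "hom_on UNIV \<phi>"
  shows "map_poly \<phi> (trinomial m b a) = trinomial m (\<phi> b) (\<phi> a)"
  by (simp add: trinomial_def map_hom_simps[OF assms] hom_simps[OF assms])

lemma poly_trinomial: "poly (trinomial m b a) x = x ^ m + b * x ^ (m - 1) + a"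
  by (simp add: trinomial_def poly_monom)

lemma trinomial_monic:
  assumes "m \<ge> 2"
  shows "degree (trinomial m b a) = m" "lead_coeff (trinomial m b a) = 1" "coeff (trinomial m b a) 0 = a"
proof -
  have c: "coeff (trinomial m b a) j = (if j = m then 1 else if j = m - 1 then b else if j = 0 then a else 0)" for j
    using assms by (auto simp: trinomial_def coeff_pCons split: nat.split)
  show d: "degree (trinomial m b a) = m"
    by (rule antisym[OF degree_le le_degree]) (use assms in \<open>auto simp: c\<close>)
  show "lead_coeff (trinomial m b a) = 1" "coeff (trinomial m b a) 0 = a"
    unfolding d using assms by (auto simp: c)
qed

text \<open>The derivative of \<open>X^(m - 1) (X + b)\<close> at \<open>-b\<close> is
  \<open>(-b)^(m - 1)\<close>, whatever the characteristic.\<close>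

lemma pderiv_trinomial_root:
  fixes b x :: "'a::field"
  assumes "m \<ge> 2" "x = - b" "b \<noteq> 0"
  shows "poly (pderiv (trinomial m b 0)) x \<noteq> 0"
proof -
  obtain k where k: "m = Suc (Suc k)" using assms(1) by (metis Suc_le_D numeral_2_eq_2 Suc_le_mono)
  have "poly (pderiv (trinomial m b 0)) x = x ^ k * (of_nat m * x + of_nat (m - 1) * b)"
    by (simp add: k trinomial_def pderiv_add pderiv_monom poly_monom pderiv_pCons algebra_simps)
  also have "of_nat m * x + of_nat (m - 1) * b = x" by (simp add: k assms(2) algebra_simps)
  finally show ?thesis using assms by simp
qed

text \<open>A root \<open>r\<close> satisfies \<open>f = r^(m - 1) (- r - b)\<close>, of order at
  least \<open>m - 1\<close> if \<open>r\<close> has zero residue; that exceeds the order of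
  \<open>f\<close>.\<close>

lemma trinomial_no_root_zero_residue:
  fixes f :: "'a::field fps"
  assumes "f \<noteq> 0" "m > Suc (subdegree f)" "poly (trinomial m b f) r = 0"
  shows "res r \<noteq> 0"
proof
  assume "res r = 0"
  then have "fps_X ^ 1 dvd r" by (subst X_power_dvd_iff) auto
  then have "(fps_X ^ 1) ^ (m - 1) dvd r ^ (m - 1)" by (rule dvd_power_same)
  then have "fps_X ^ (m - 1) dvd r ^ (m - 1) * (- r - b)" by simp
  also have "r ^ (m - 1) * (- r - b) = f"
  proof -
    have "r ^ m = r * r ^ (m - 1)" using assms(2) by (metis Suc_diff_1 less_trans power_Suc zero_less_Suc)
    then have "(r * r ^ (m - 1) + b * r ^ (m - 1)) + f = 0" using assms(3) by (simp add: poly_trinomial)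
    then have "f = - (r * r ^ (m - 1) + b * r ^ (m - 1))" by (rule minus_unique[symmetric])
    also have "\<dots> = r ^ (m - 1) * (- r - b)" by (simp add: algebra_simps)
    finally show ?thesis by (rule sym)
  qed
  finally have "fps_nth f (subdegree f) = 0" using assms(2) by (auto simp: X_power_dvd_iff)
  then show False using assms(1) by simp
qed

lemma rigid_generator:
  fixes T :: "'k::field acl set"
  assumes w: "separable_element w" "w \<noteq> 0" "w \<in> gen T"
    and D: "D \<noteq> 0" "unramified D T"
  obtains z q where "poly_over (gen T) q" "rsquarefree q" "poly q z = 0"
    "\<forall>\<sigma>\<in>Gal {}. \<sigma> w = w \<longrightarrow> (\<exists>\<rho>\<in>Gal (gen T \<union> constant_closure). \<rho> (\<sigma> z) = z)"
    "\<forall>\<sigma>\<in>Gal {}. \<sigma> z \<in> gen (insert z T) \<longrightarrow> \<sigma> w = w \<and> \<sigma> z = z"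
proof -
  obtain p :: "'k poly poly" where p: "rsquarefree (map_poly emb p)" "poly (map_poly emb p) w = 0"
    "\<And>y. poly (map_poly emb p) y = 0 \<Longrightarrow> \<exists>\<sigma>\<in>Gal {}. \<sigma> w = y"
    using separable_integral_poly[OF w(1)] by blast
  have p_conj: "poly (map_poly emb p) (\<sigma> w) = 0" if "\<sigma> \<in> Gal {}" for \<sigma>
    using Gal_root_emb[OF that] p(2) by blast
  have p0: "p \<noteq> 0" using p(1) by (auto simp: rsquarefree_def)
  obtain D1 where D1: "D1 \<noteq> 0"
    "\<And>c. ev c D1 \<noteq> 0 \<Longrightarrow> degree (map_poly (ev c) p) = degree p \<and> rsquarefree (map_poly (ev c) p)"
    using squarefree_reduction[OF p(1)] by blast
  obtain p0' \<psi> where p_eq: "p = pCons p0' \<psi>" by (cases p)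
  have "p0' \<noteq> 0"
  proof
    assume "p0' = 0"
    then have "poly (map_poly emb p) 0 = 0" by (simp add: p_eq map_poly_pCons emb_simps)
    then obtain \<sigma> where "\<sigma> \<in> Gal {}" "\<sigma> w = 0" using p(3) by blast
    then show False using w(2) Gal_simps(10) by blast
  qed
  have "\<psi> \<noteq> 0"
  proof
    assume "\<psi> = 0"
    then have "poly (map_poly emb p) w = emb p0'" by (simp add: p_eq map_poly_pCons emb_simps)
    then show False using p(2) \<open>p0' \<noteq> 0\<close> by simp
  qed
  \<comment> \<open>With \<open>p = p0' + X \<psi>\<close> and \<open>u\<close> a multiple of
    \<open>D * D1 * p0'\<close>, the value \<open>p(u)\<close> is \<open>p0'\<close> times a
    polynomial \<open>S\<close> congruent to 1 modulo \<open>D * D1\<close>. Hence the zeros of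
    \<open>S\<close> are zeros of \<open>p(u)\<close> at which \<open>D\<close> and
    \<open>D1\<close> do not vanish. The power of \<open>T\<close> makes \<open>S\<close>
    nonconstant and leaves infinitely many \<open>u\<close>, so that
    \<open>\<psi>(u) \<noteq> 0\<close> for one of them.\<close>
  define U where "U = (\<lambda>N. D * D1 * p0' * monom 1 (Suc N))"
  have injU: "inj U"
  proof (rule injI)
    fix M N assume "U M = U N"
    then have "monom (1::'k) (Suc M) = monom 1 (Suc N)" using D(1) D1(1) \<open>p0' \<noteq> 0\<close> by (simp add: U_def)
    then show "M = N" by (metis degree_monom_eq one_neq_zero nat.inject)
  qed
  have "\<exists>N. poly \<psi> (U N) \<noteq> 0"
  proof (rule ccontr)
    assume "\<not> ?thesis"
    then have "range U \<subseteq> {x. poly \<psi> x = 0}" by auto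
    then have "finite (range U)" using poly_roots_finite[OF \<open>\<psi> \<noteq> 0\<close>] finite_subset by blast
    then show False using finite_imageD[OF _ injU] infinite_UNIV_nat by blast
  qed
  then obtain N where N: "poly \<psi> (U N) \<noteq> 0" by blast
  define u where "u = U N"
  define S where "S = 1 + D * D1 * monom 1 (Suc N) * poly \<psi> u"
  define R where "R = poly p u"
  have R_eq: "R = p0' * S" by (simp add: R_def p_eq S_def u_def U_def algebra_simps)
  have "degree (D * D1 * monom 1 (Suc N) * poly \<psi> u) > 0"
  proof -
    have "degree (D * D1 * monom 1 (Suc N) * poly \<psi> u) = degree D + degree D1 + Suc N + degree (poly \<psi> u)"
      using N D(1) D1(1) by (simp add: degree_mult_eq u_def degree_monom_eq monom_eq_0_iff)
    then show ?thesis by simp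
  qed
  then have degS: "degree S > 0" unfolding S_def by (subst degree_add_eq_right) auto
  then have "S \<noteq> 0" by auto
  then have R0: "R \<noteq> 0" using R_eq \<open>p0' \<noteq> 0\<close> by simp
  obtain c where c: "ev c S = 0" using ev_root_exists[OF degS] by blast
  have cD: "ev c D \<noteq> 0" "ev c D1 \<noteq> 0" using c by (auto simp: S_def ev_simps)
  have cR: "ev c R = 0" using c by (simp add: R_eq ev_simps)
  have DR: "D * D1 * R \<noteq> 0" using D(1) D1(1) R0 by simp
  obtain P where P: "degree P > 0" "\<And>c. ev c P = 0 \<Longrightarrow> ev c (pderiv P) \<noteq> 0 \<and> ev c (D * D1 * R) \<noteq> 0"
    using separable_poly_avoiding[OF DR] by blast
  have cP: "ev c P \<noteq> 0" using P(2)[of c] cR by (auto simp: ev_simps)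
  have P0: "P \<noteq> 0" using P(1) by auto
  \<comment> \<open>\<open>R = p(u)\<close> cancels the denominator \<open>u - w\<close> at
    \<open>c\<close>, where \<open>P\<close> is a unit; at the roots of \<open>P\<close> the roles
    are exchanged, and \<open>a\<close> has a simple zero.\<close>
  define a where "a = P * R"
  have a0: "a \<noteq> 0" using P0 R0 by (simp add: a_def)
  define B where "B = (\<lambda>x. emb a / (emb u - x))"
  have ux: "emb u \<noteq> x" if "poly (map_poly emb p) x = 0" for x
  proof
    assume "emb u = x"
    then have "emb R = 0" using that hom_poly[OF hom_emb, of p u] by (simp add: R_def)
    then show False using R0 by simp
  qed
  \<comment> \<open>Two more than the order of \<open>a\<close> at \<open>c\<close>: the exponent
    \<open>m - 1\<close> exceeds that order, and \<open>m \<ge> 2\<close>.\<close>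
  define m where "m = subdegree (expand c a) + 2"
  have m2: "m \<ge> 2" by (simp add: m_def)
  define q where "q = (\<lambda>x. trinomial m (B x) (emb a))"
  have Gq: "map_poly \<sigma> (q x) = q (\<sigma> x)" if \<sigma>: "\<sigma> \<in> Gal {}" for \<sigma> x
    unfolding q_def map_trinomial[OF Gal_hom[OF \<sigma>]]
    by (simp add: B_def Gal_simps[OF \<sigma>] emb_def Gal_base[OF \<sigma>])
  have embg: "emb f \<in> gen T" for f using intermediate_base[OF intermediate_gen] by (simp add: emb_def)
  have qT: "poly_over (gen T) (q w)"
  proof -
    note sr = subring_set_gen
    have "B w \<in> gen T" unfolding B_def
      by (intro intermediate_divide intermediate_gen subring_set_diff sr embg w(3))
    then show ?thesis unfolding q_def trinomial_def
      by (intro poly_over_add poly_over_monom poly_over_pCons poly_over_zero sr embg subring_set_one)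
  qed
  have qnz: "q x \<noteq> 0" for x using trinomial_monic(1)[OF m2] m2 unfolding q_def by (metis degree_0 not_numeral_le_zero)

  text \<open>A place above \<open>c\<close>, at which \<open>w\<close> is congruent to \<open>u\<close> and no other conjugate of \<open>w\<close> is.\<close>
  let ?pc = "map_poly (expand c) p"
  have bij: "bij_betw res {r. poly ?pc r = 0} {x. poly (map_poly (ev c) p) x = 0}"
    using unramified_residues[of c p] D1(2)[OF cD(2)] by blast
  have mrp: "map_poly res ?pc = map_poly (ev c) p"
    by (simp add: map_poly_comp[OF hom_res hom_expand] res_expand)
  have "poly (map_poly (ev c) p) (ev c u) = 0"
    using hom_poly[OF hom_ev, of p u c] cR by (simp add: R_def)
  then have "ev c u \<in> res ` {r. poly ?pc r = 0}" using bij by (simp add: bij_betw_def)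
  then obtain r0 where r0: "poly ?pc r0 = 0" "res r0 = ev c u" by auto
  obtain \<iota>0 where \<iota>0: "place c \<iota>0" using place_exists by blast
  have "ser r0 \<in> \<iota>0 ` {x. poly (map_poly emb p) x = 0}"
    unfolding place_roots_lift[OF \<iota>0 p0, symmetric] using r0(1) by (simp add: ser_poly)
  then obtain x0 where x0: "poly (map_poly emb p) x0 = 0" "\<iota>0 x0 = ser r0" by auto
  obtain \<sigma>0 where \<sigma>0: "\<sigma>0 \<in> Gal {}" "\<sigma>0 w = x0" using p(3)[OF x0(1)] by blast
  \<comment> \<open>An arbitrary place sends some conjugate \<open>x0\<close> of \<open>w\<close> to
    the series \<open>r0\<close> congruent to \<open>u\<close>; precomposing with \<sigma>0 makes
    this conjugate \<open>w\<close> itself.\<close>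
  define \<iota> where "\<iota> = (\<lambda>x. \<iota>0 (\<sigma>0 x))"
  have \<iota>: "place c \<iota>" unfolding \<iota>_def by (rule place_Gal[OF \<iota>0 \<sigma>0(1)])
  note h\<iota> = place_hom[OF \<iota>]
  note \<iota>_simps = hom_simps[OF h\<iota>] hom_on_inverse[OF h\<iota>] place_emb[OF \<iota>]
  have \<iota>w: "\<iota> w = ser r0" by (simp add: \<iota>_def \<sigma>0 x0)
  have Tdec: "T \<subseteq> dec \<iota>" using D(2) cD(1) \<iota> by blast
  define A where "A = expand c a"
  have A0: "A \<noteq> 0" "res A = 0" using a0 cR by (simp_all add: A_def res_expand a_def ev_simps)
  have mA: "m > Suc (subdegree A)" by (simp add: m_def A_def)
  have unit_inverse: "ser f * ser (inverse f) = 1" if "res f \<noteq> 0" for f :: "'k acl fps"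
    using inverse_mult_eq_1'[OF that] by (simp flip: ser_simps)
  have \<iota>q: "map_poly \<iota> (q x) = map_poly ser (trinomial m b A)" if "\<iota> (B x) = ser b" for x b
    unfolding q_def map_trinomial[OF h\<iota>] map_trinomial[OF hom_ser] that by (simp add: place_emb[OF \<iota>] A_def)
  \<comment> \<open>Distinct roots of \<open>p\<close> have distinct residues, so the denominator is
    a unit and the coefficient inherits the zero of \<open>a\<close> at \<open>c\<close>.\<close>
  have other: "\<exists>b. \<iota> (B (\<sigma> w)) = ser b \<and> res b = 0" if \<sigma>: "\<sigma> \<in> Gal {}" "\<sigma> w \<noteq> w" for \<sigma>
  proof -
    obtain r where r: "\<iota> (\<sigma> w) = ser r" "poly ?pc r = 0"
      using unramified_roots[OF \<iota>, of p "\<sigma> w"] D1(2)[OF cD(2)] p_conj[OF \<sigma>(1)] by blast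
    have "r \<noteq> r0" using r(1) \<iota>w place_eq_iff(1)[OF \<iota>] \<sigma>(2) by metis
    then have "res r \<noteq> res r0" using bij r(2) r0(1) by (auto simp: bij_betw_def inj_on_def)
    then have d: "res (expand c u - r) \<noteq> 0" using r0(2) by (simp add: res_expand)
    have "\<iota> (B (\<sigma> w)) = ser A * inverse (ser (expand c u - r))"
      unfolding B_def divide_inverse by (simp add: \<iota>_simps r A_def)
    also have "inverse (ser (expand c u - r)) = ser (inverse (expand c u - r))"
      using unit_inverse[OF d] by (metis inverse_unique)
    finally show ?thesis by (intro exI[of _ "A * inverse (expand c u - r)"]) (simp add: A0(2))
  qed
  \<comment> \<open>Locally \<open>p(u) = (u - r0) g(u)\<close>, with \<open>g(u)\<close> a unit
    because the root is simple in the reduction. The factor \<open>u - r0\<close> cancels and the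
    unit \<open>P * g(u)\<close> remains.\<close>
  have this_one: "\<exists>b. \<iota> (B w) = ser b \<and> res b \<noteq> 0"
  proof -
    obtain g where g: "?pc = [:- r0, 1:] * g" using r0(1) unfolding poly_eq_0_iff_dvd by (elim dvdE)
    have "expand c R = poly ?pc (expand c u)"
      unfolding R_def using hom_poly[OF hom_expand, of p u c] by simp
    then have eR: "expand c R = (expand c u - r0) * poly g (expand c u)" by (simp add: g algebra_simps)
    have "map_poly (ev c) p = [:- ev c u, 1:] * map_poly res g"
      using r0(2) unfolding mrp[symmetric] g
      by (subst map_hom_mult[OF hom_res]) (simp_all add: map_poly_pCons)
    then have "poly (pderiv (map_poly (ev c) p)) (ev c u) = poly (map_poly res g) (ev c u)"
      by (simp add: pderiv_mult pderiv_pCons del: mult_pCons_left)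
    moreover have "poly (pderiv (map_poly (ev c) p)) (ev c u) \<noteq> 0"
      using squarefree_iff_pderiv[of "map_poly (ev c) p"] D1(2)[OF cD(2)]
        \<open>poly (map_poly (ev c) p) (ev c u) = 0\<close> by (auto simp: rsquarefree_def)
    ultimately have rg: "res (poly g (expand c u)) \<noteq> 0" by (simp add: res_poly res_expand)
    have nz: "expand c u - r0 \<noteq> 0" using eR R0 by auto
    have "\<iota> (B w) = ser A * inverse (ser (expand c u - r0))"
      unfolding B_def divide_inverse by (simp add: \<iota>_simps \<iota>w A_def)
    also have "A = (expand c P * poly g (expand c u)) * (expand c u - r0)"
      by (simp add: A_def a_def expand_simps eR)
    finally have "\<iota> (B w) = ser (expand c P * poly g (expand c u))" using nz by (simp add: mult.assoc del: ser_simps(7))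
    then show ?thesis using rg cP by (intro exI[of _ "expand c P * poly g (expand c u)"]) (simp add: res_expand)
  qed
  then obtain b where b: "\<iota> (B w) = ser b" "res b \<noteq> 0" by blast
  let ?Q = "trinomial m b A"
  have resQ: "map_poly res ?Q = trinomial m (res b) 0" by (simp add: map_trinomial[OF hom_res] A0)
  \<comment> \<open>The reduction is \<open>X^(m - 1) (X + res b)\<close>, and zero residue is
    excluded by the choice of \<open>m\<close>. Every power series root thus lies over the simple
    root \<open>- res b\<close>, and Hensel's lemma yields exactly one.\<close>
  have root_res: "res r = - res b" if r: "poly ?Q r = 0" for r
  proof -
    have "res r \<noteq> 0" by (rule trinomial_no_root_zero_residue[OF A0(1) mA r])
    moreover have "poly (trinomial m (res b) 0) (res r) = 0"
      using arg_cong[OF r, of res] by (simp add: res_poly resQ)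
    moreover have "res r ^ m = res r * res r ^ (m - 1)" using m2 by (metis One_nat_def Suc_1 Suc_diff_1 Suc_le_lessD less_trans power_Suc zero_less_Suc)
    ultimately have "res r ^ (m - 1) * (res r + res b) = 0" by (simp add: poly_trinomial algebra_simps)
    then have "res r + res b = 0" using \<open>res r \<noteq> 0\<close> by simp
    then show ?thesis by (simp add: eq_neg_iff_add_eq_0)
  qed
  have simple: "poly (pderiv (map_poly res ?Q)) (- res b) \<noteq> 0"
    unfolding resQ by (rule pderiv_trinomial_root[OF m2 refl b(2)])
  have "poly (map_poly res ?Q) (- res b) = 0"
  proof -
    have "(- res b) ^ m = - res b * (- res b) ^ (m - 1)" using m2 by (metis One_nat_def Suc_1 Suc_diff_1 Suc_le_lessD less_trans power_Suc zero_less_Suc)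
    then show ?thesis by (simp add: resQ poly_trinomial)
  qed
  then obtain rz where rz: "poly ?Q rz = 0" using hensel[OF _ simple] by blast
  have uniq: "r = rz" if "poly ?Q r = 0" for r
    by (rule hensel_unique[OF that rz]) (use root_res[OF that] root_res[OF rz] simple in auto)
  have "poly (map_poly \<iota> (q w)) (ser rz) = 0" unfolding \<iota>q[OF b(1)] by (simp add: ser_poly rz)
  then obtain z where z: "ser rz = \<iota> z" "poly (q w) z = 0" using hom_root_lift[OF h\<iota> qnz] by blast
  have zdec: "z \<in> dec \<iota>" using z(1) by (auto simp: dec_def ser_def) (metis rangeI)

  text \<open>A place above a root \<open>c'\<close> of \<open>P\<close>, at which \<open>q w\<close> is an Eisenstein polynomial.\<close>
  obtain c' where c': "ev c' P = 0" using ev_root_exists[OF P(1)] by blast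
  have c'D: "ev c' (pderiv P) \<noteq> 0" "ev c' D \<noteq> 0" "ev c' D1 \<noteq> 0" "ev c' R \<noteq> 0"
    using P(2)[OF c'] by (auto simp: ev_simps)
  obtain \<iota>' where \<iota>': "place c' \<iota>'" using place_exists by blast
  note h\<iota>' = place_hom[OF \<iota>']
  note \<iota>'_simps = hom_simps[OF h\<iota>'] hom_on_inverse[OF h\<iota>'] place_emb[OF \<iota>']
  have sub': "gen T \<union> constant_closure \<subseteq> dec \<iota>'"
    using gen_least[OF intermediate_place[OF \<iota>'], of T] D(2) c'D(2) \<iota>' constants_dec[OF \<iota>'] by blast
  obtain r' where r': "\<iota>' w = ser r'" "poly (map_poly (expand c') p) r' = 0"
    using unramified_roots[OF \<iota>', of p w] D1(2)[OF c'D(3)] p(2) by blast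
  \<comment> \<open>A congruence of \<open>u\<close> and \<open>w\<close> at \<open>c'\<close> would
    make \<open>R = p(u)\<close> vanish there.\<close>
  have d': "res (expand c' u - r') \<noteq> 0"
  proof
    assume "res (expand c' u - r') = 0"
    then have "ev c' u = res r'" by (simp add: res_expand)
    moreover have "poly (map_poly (ev c') p) (res r') = 0"
      using arg_cong[OF r'(2), of res]
      by (simp add: res_poly map_poly_comp[OF hom_res hom_expand] res_expand)
    ultimately have "ev c' R = 0"
      using hom_poly[OF hom_ev, of p u c'] by (simp add: R_def)
    then show False using c'D by simp
  qed
  define A' where "A' = expand c' a"
  define b' where "b' = A' * inverse (expand c' u - r')"
  have \<iota>'B: "\<iota>' (B w) = ser b'"
  proof -
    have "\<iota>' (B w) = ser A' * inverse (ser (expand c' u - r'))"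
      unfolding B_def divide_inverse by (simp add: \<iota>'_simps r' A'_def)
    also have "inverse (ser (expand c' u - r')) = ser (inverse (expand c' u - r'))"
      using unit_inverse[OF d'] by (metis inverse_unique)
    finally show ?thesis by (simp add: b'_def)
  qed
  let ?Q' = "trinomial m b' A'"
  have A': "res A' = 0" "fps_nth A' 1 \<noteq> 0"
    using c' c'D by (simp_all add: A'_def res_expand a_def ev_simps expand_nth_1 pderiv_mult del: One_nat_def)
  then have "res b' = 0" by (simp add: b'_def)
  then have "map_poly res ?Q' = monom 1 m" using A' by (simp add: map_trinomial[OF hom_res]) (simp add: trinomial_def)
  then have irr: "irred (fract_poly ?Q')"
    using m2 A' by (intro eisenstein trinomial_monic(2)[OF m2]) (auto simp: trinomial_monic(1,3)[OF m2])
  have \<iota>'q: "map_poly \<iota>' (q w) = map_poly ser ?Q'"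
    unfolding q_def map_trinomial[OF h\<iota>'] map_trinomial[OF hom_ser] \<iota>'B by (simp add: place_emb[OF \<iota>'] A'_def)
  have trans: "\<exists>\<rho>\<in>Gal (gen T \<union> constant_closure). \<rho> x = y" if xy: "poly (q w) x = 0" "poly (q w) y = 0" for x y
  proof -
    have r: "poly (map_poly ser ?Q') (\<iota>' x) = 0" if "poly (q w) x = 0" for x
      using hom_poly[OF h\<iota>', of "q w" x] that by (simp add: \<iota>'q \<iota>'_simps)
    obtain \<rho> where "\<rho> \<in> Gal (dec \<iota>')" "\<rho> x = y"
      using place_transitive[OF \<iota>' irr r[OF xy(1)] r[OF xy(2)]] .
    then show ?thesis using Gal_mono[OF sub'] by blast
  qed

  \<comment> \<open>All roots of \<open>q w\<close> are conjugate to \<open>z\<close> over a field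
    containing its coefficients, so it is enough that \<open>z\<close> is simple, which its residue
    shows.\<close>
  have "rsquarefree (q w)"
    unfolding squarefree_iff_pderiv[OF qnz]
  proof (intro allI impI)
    fix x assume x: "poly (q w) x = 0"
    obtain \<rho> where \<rho>: "\<rho> \<in> Gal (gen T \<union> constant_closure)" "\<rho> z = x" using trans[OF z(2) x] by blast
    have "poly_over (base_field \<union> (gen T \<union> constant_closure)) (q w)" by (rule poly_over_mono[OF qT]) auto
    then have \<rho>q: "map_poly \<rho> (q w) = q w" by (rule Gal_map_poly[OF \<rho>(1)])
    have "\<rho> (poly (pderiv (q w)) z) = poly (pderiv (q w)) x"
      using Gal_poly[OF \<rho>(1), of "pderiv (q w)" z] by (simp add: map_poly_pderiv[OF Gal_hom[OF \<rho>(1)]] \<rho>q \<rho>(2))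
    moreover have "poly (pderiv (q w)) z \<noteq> 0"
    proof
      assume "poly (pderiv (q w)) z = 0"
      then have "poly (map_poly ser (pderiv ?Q)) (ser rz) = 0"
        using hom_poly[OF h\<iota>, of "pderiv (q w)" z] z(1)
        by (simp add: \<iota>_simps map_poly_pderiv[OF h\<iota>] map_poly_pderiv[OF hom_ser] \<iota>q[OF b(1)])
      then have "poly (pderiv ?Q) rz = 0" by (simp add: ser_poly)
      then have "res (poly (pderiv ?Q) rz) = 0" by simp
      then show False using simple root_res[OF rz] by (simp add: res_poly map_poly_pderiv[OF hom_res])
    qed
    ultimately show "poly (pderiv (q w)) x \<noteq> 0" using Gal_simps(10)[OF \<rho>(1)] by metis
  qed
  moreover have "\<exists>\<rho>\<in>Gal (gen T \<union> constant_closure). \<rho> (\<sigma> z) = z" if \<sigma>: "\<sigma> \<in> Gal {}" "\<sigma> w = w" for \<sigma>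
  proof (rule trans[OF _ z(2)])
    show "poly (q w) (\<sigma> z) = 0" using Gal_poly[OF \<sigma>(1), of "q w" z] Gq[OF \<sigma>(1), of w] \<sigma> z(2) Gal_simps[OF \<sigma>(1)] by simp
  qed
  moreover have "\<sigma> w = w \<and> \<sigma> z = z" if \<sigma>: "\<sigma> \<in> Gal {}" "\<sigma> z \<in> gen (insert z T)" for \<sigma>
  proof -
    have "gen (insert z T) \<subseteq> dec \<iota>" using Tdec zdec by (intro gen_least intermediate_place[OF \<iota>]) auto
    then have dec: "\<iota> (\<sigma> z) \<in> range to_ac" using \<sigma>(2) by (auto simp: dec_def)
    have "poly (q (\<sigma> w)) (\<sigma> z) = 0"
      using Gal_poly[OF \<sigma>(1), of "q w" z] Gq[OF \<sigma>(1), of w] z(2) Gal_simps[OF \<sigma>(1)] by simp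
    then have root: "poly (map_poly \<iota> (q (\<sigma> w))) (\<iota> (\<sigma> z)) = 0"
      using hom_poly[OF h\<iota>, of "q (\<sigma> w)" "\<sigma> z"] by (simp add: \<iota>_simps)
    \<comment> \<open>Otherwise \<open>q (\<sigma> w)\<close> reduces to \<open>X^m\<close>. A root
      in the Laurent series field is a power series, as the polynomial is monic, and would have zero
      residue.\<close>
    have "\<sigma> w = w"
    proof (rule ccontr)
      assume "\<sigma> w \<noteq> w"
      then obtain b1 where b1: "\<iota> (B (\<sigma> w)) = ser b1" "res b1 = 0" using other[OF \<sigma>(1)] by blast
      obtain r where r: "poly (trinomial m b1 A) r = 0"
        using integral_root[OF trinomial_monic(2)[OF m2] _ dec] root unfolding \<iota>q[OF b1(1)] by blast
      have "res r \<noteq> 0" by (rule trinomial_no_root_zero_residue[OF A0(1) mA r])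
      moreover have "res r ^ m = 0"
        using arg_cong[OF r, of res] by (simp add: res_poly map_trinomial[OF hom_res] b1 A0 poly_trinomial)
      ultimately show False by simp
    qed
    moreover have "\<sigma> z = z"
    proof -
      obtain r where r: "\<iota> (\<sigma> z) = ser r" "poly ?Q r = 0"
        using integral_root[OF trinomial_monic(2)[OF m2] _ dec] root unfolding \<open>\<sigma> w = w\<close> \<iota>q[OF b(1)] by blast
      then have "\<iota> (\<sigma> z) = \<iota> z" using uniq z(1) by simp
      then show ?thesis using place_eq_iff(1)[OF \<iota>] by blast
    qed
    ultimately show ?thesis by blast
  qed
  ultimately show ?thesis using that[OF qT _ z(2)] by blast
qed

section \<open>Finite separable extensions and their automorphisms\<close>

abbreviation (input) rta :: "'a::field ring" where
  "rta \<equiv> ring_of_type_algebra"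

lemma rta_simps:
  "carrier (rta :: 'a::field ring) = UNIV"
  "x \<otimes>\<^bsub>(rta :: 'a ring)\<^esub> y = x * y" "x \<oplus>\<^bsub>(rta :: 'a ring)\<^esub> y = x + y"
  "\<one>\<^bsub>(rta :: 'a ring)\<^esub> = 1" "\<zero>\<^bsub>(rta :: 'a ring)\<^esub> = 0"
  by (simp_all add: ring_of_type_algebra_def)

lemma rta_inverses:
  "\<ominus>\<^bsub>(rta :: 'a::field ring)\<^esub> x = - x"
  "x \<noteq> 0 \<Longrightarrow> inv\<^bsub>(rta :: 'a ring)\<^esub> x = inverse x"
proof -
  interpret R: field "rta :: 'a ring" by (rule field_from_type_algebra)
  show "\<ominus>\<^bsub>(rta :: 'a ring)\<^esub> x = - x"
    by (rule R.minus_equality) (simp_all add: rta_simps)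
  show "inv\<^bsub>(rta :: 'a ring)\<^esub> x = inverse x" if "x \<noteq> 0"
    by (rule R.comm_inv_char) (use that in \<open>simp_all add: rta_simps\<close>)
qed

lemma subring_set_iff: "subring F rta \<longleftrightarrow> subring_set F" for F :: "'a::field set"
proof
  interpret R: field "rta :: 'a ring" by (rule field_from_type_algebra)
  assume F: "subring F rta"
  have "x - y \<in> F" if "x \<in> F" "y \<in> F" for x y
    using subringE(5)[OF F that(2)] subringE(7)[OF F that(1), of "- y"]
    by (simp add: rta_simps rta_inverses)
  then show "subring_set F"
    using subringE(3,6)[OF F] by (auto simp: subring_set_def rta_simps)
next
  interpret R: field "rta :: 'a ring" by (rule field_from_type_algebra)
  assume F: "subring_set F"
  show "subring F rta"
    by (rule R.subringI)
       (auto simp: rta_simps rta_inverses intro: subring_set_closed[OF F])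
qed

lemma intermediate_subfield:
  assumes "intermediate F"
  shows "subfield F rta"
proof -
  interpret R: field "rta :: 'a alg_closure ring" by (rule field_from_type_algebra)
  show ?thesis
    by (rule R.subfieldI')
       (use assms in \<open>auto simp: subring_set_iff intermediate_subring rta_simps
         rta_inverses intro: intermediate_inverse\<close>)
qed

lemma algebraic_over_base:
  fixes x :: "'f::field alg_closure"
  shows "ring.algebraic rta base_field x"
proof -
  interpret R: field "rta :: 'f alg_closure ring" by (rule field_from_type_algebra)
  obtain p :: "'f poly" where p: "p \<noteq> 0" "poly (map_poly to_ac p) x = 0" using alg_closure_algebraic .
  have ev: "R.eval (rev as) x = poly (Poly as) x" for as
  proof (induction as)
    case Nil
    then show ?case by (simp add: rta_simps)
  next
    case (Cons a as)
    then show ?case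
      using R.eval_append_aux[of "rev as" a x] by (simp add: rta_simps mult.commute)
  qed
  \<comment> \<open>The list polynomials of the algebra library begin with the leading coefficient,
    hence the reversal.\<close>
  let ?P = "rev (coeffs (map_poly to_ac p))"
  have nz: "map_poly to_ac p \<noteq> 0" using p(1) by (simp add: map_poly_eq_0_iff)
  have mem: "coeff (map_poly to_ac p) i \<in> base_field" for i by (simp add: coeff_map_poly)
  have "lead_coeff (map_poly to_ac p) \<noteq> 0" using nz by simp
  then have "hd ?P \<noteq> 0" using nz by (simp add: hd_rev last_coeffs_eq_coeff_degree)
  moreover have "set ?P \<subseteq> base_field" using mem by (auto simp: coeffs_def)
  ultimately have "?P \<in> carrier (base_field [X]\<^bsub>rta\<^esub>)"
    by (simp add: univ_poly_def polynomial_def rta_simps)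
  moreover have "?P \<noteq> []" using nz by simp
  moreover have "R.eval ?P x = \<zero>\<^bsub>rta\<^esub>"
    unfolding ev using p(2) by (simp add: rta_simps)
  ultimately show ?thesis using R.algebraicI by (simp add: over_def)
qed

lemma finite_dimension_gen:
  fixes T :: "'f::field alg_closure set"
  assumes "finite T"
  shows "ring.finite_dimension rta base_field (gen T)"
proof -
  interpret R: field "rta :: 'f alg_closure ring" by (rule field_from_type_algebra)
  obtain xs where xs: "set xs = T" using finite_list[OF assms] by blast
  have sf: "subfield (base_field :: 'f alg_closure set) rta"
    by (rule intermediate_subfield) simp
  have "R.finite_extension base_field xs = \<Inter> {K'. subring K' rta \<and> base_field \<subseteq> K' \<and> set xs \<subseteq> K'}"
    by (rule R.finite_extension_minimal[OF subfieldE(1)[OF sf]]) (simp add: rta_simps)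
  also have "\<dots> = gen T" unfolding gen_def subring_set_iff intermediate_def xs by (simp add: conj_ac)
  finally have "R.finite_extension base_field xs = gen T" .
  moreover have "R.finite_dimension base_field (R.finite_extension base_field xs)"
    by (rule R.finite_extension_finite_dimension(1)[OF sf])
       (use algebraic_over_base in \<open>simp_all add: rta_simps over_def\<close>)
  ultimately show ?thesis by simp
qed

lemma finite_separable_extension_gen:
  assumes "finite T" "\<And>x. x \<in> gen T \<Longrightarrow> separable_element x"
  shows "finite_separable_extension (gen T)"
  unfolding finite_separable_extension_def
  using assms intermediate_subfield[OF intermediate_gen] finite_dimension_gen intermediate_base[OF intermediate_gen]
  by auto

lemma finite_separable_extensionE:
  fixes L :: "'f::field alg_closure set"
  assumes "finite_separable_extension L"
  obtains T where "finite T" "gen T = L" "intermediate L" "\<And>x. x \<in> L \<Longrightarrow> separable_element x"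
proof -
  interpret R: field "rta :: 'f alg_closure ring" by (rule field_from_type_algebra)
  have L: "subfield L rta" "base_field \<subseteq> L" "R.finite_dimension base_field L"
    "\<And>x. x \<in> L \<Longrightarrow> separable_element x"
    using assms by (auto simp: finite_separable_extension_def)
  have iL: "intermediate L" using subfieldE(1)[OF L(1)] L(2) by (simp add: intermediate_def subring_set_iff)
  have sf: "subfield (base_field :: 'f alg_closure set) rta"
    by (rule intermediate_subfield) simp
  obtain m where "R.dimension m base_field L" using L(3) by (auto simp: R.finite_dimension_def)
  then obtain Us where Us: "R.Span base_field Us = L" "set Us \<subseteq> carrier rta"
    using R.exists_base[OF sf] by blast
  have sub: "set Us \<subseteq> L" using R.Span_base_incl[OF sf Us(2)] Us(1) by simp
  \<comment> \<open>A vector space basis of \<open>L\<close> also generates it as a field, because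
    \<open>gen\<close> is closed under linear combinations over the base field.\<close>
  have "subalgebra base_field (gen (set Us)) rta"
  proof (rule subalgebra.intro)
    have "subring (gen (set Us)) rta" by (simp add: subring_set_iff intermediate_subring)
    then show "subgroup (gen (set Us)) (add_monoid rta)" by (rule subring.axioms(1))
    show "subalgebra_axioms base_field (gen (set Us)) rta"
      by standard (auto simp: rta_simps intermediate_base
        intro: subring_set_mult[OF intermediate_subring])
  qed
  then have "L \<subseteq> gen (set Us)" using R.subalgebra_Span_incl[OF sf _ gen_incl] Us(1) by blast
  moreover have "gen (set Us) \<subseteq> L" by (rule gen_least[OF iL sub])
  ultimately have "gen (set Us) = L" by blast
  then show ?thesis using that iL L(4) by blast
qed

lemma galois_containing:
  assumes "finite T" "\<And>t. t \<in> T \<Longrightarrow> separable_element t"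
  shows "\<exists>N. galois N \<and> T \<subseteq> N"
  using assms
proof (induction T)
  case empty
  then show ?case using galois_base_field by blast
next
  case (insert t T)
  then obtain N where N: "galois N" "T \<subseteq> N" by auto
  obtain q where q: "poly_over base_field q" "rsquarefree q" "poly q t = 0"
    using insert.prems[of t] by (auto simp: separable_element_iff separable_over_def)
  have "base_field \<subseteq> N" using N(1) by (simp add: galois_def intermediate_def)
  then obtain N' where "galois N'" "N \<subseteq> N'" "{x. poly q x = 0} \<subseteq> N'"
    using galois_adjoin[OF N(1) poly_over_mono[OF q(1)] q(2)] by metis
  then show ?case using N(2) q(3) by blast
qed

text \<open>The field is enclosed in a \<open>galois\<close> one, obtained first for
  \<open>T\<close> and then enlarged by the roots of \<open>q\<close>; there every element is
  separable.\<close>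

lemma separable_gen:
  assumes T: "finite T" "\<And>t. t \<in> T \<Longrightarrow> separable_element t"
    and q: "poly_over (gen T) q" "rsquarefree q" "poly q z = 0" and x: "x \<in> gen (insert z T)"
  shows "separable_element x"
proof -
  obtain N where N: "galois N" "T \<subseteq> N" using galois_containing[OF T] by blast
  have "gen T \<subseteq> N" by (rule gen_least) (use N in \<open>auto simp: galois_def\<close>)
  then obtain N' where N': "galois N'" "N \<subseteq> N'" "{x. poly q x = 0} \<subseteq> N'"
    using galois_adjoin[OF N(1) poly_over_mono[OF q(1)] q(2)] by metis
  have "gen (insert z T) \<subseteq> N'" by (rule gen_least) (use N N' q(3) in \<open>auto simp: galois_def\<close>)
  then show ?thesis using galois_separable[OF N'(1)] x by blast
qed

section \<open>Automorphisms of an intermediate field as restrictions of elements of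
  \<open>Gal {}\<close>\<close>

lemma carrier_Aut [simp]: "carrier (Aut F K) = field_auts F K"
  by (simp add: Aut_def)

lemma mult_Aut: "\<sigma> \<in> field_auts F K \<Longrightarrow> \<tau> \<in> field_auts F K \<Longrightarrow> \<sigma> \<otimes>\<^bsub>Aut F K\<^esub> \<tau> = compose F \<sigma> \<tau>"
  by (simp add: Aut_def BijGroup_def field_auts_iff)

lemma group_Aut_base: "intermediate F \<Longrightarrow> group (Aut F base_field)"
  by (rule group_Aut) (auto simp: intermediate_subfield intermediate_def)

lemma field_auts_extend:
  assumes E: "intermediate E" and \<sigma>: "\<sigma> \<in> field_auts E base_field"
  obtains \<tau> where "\<tau> \<in> Gal {}" "\<And>x. x \<in> E \<Longrightarrow> \<tau> x = \<sigma> x"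
proof -
  have "hom_on E \<sigma>" using \<sigma> by (auto simp: field_auts_iff hom_on_def)
  then obtain \<tau> where \<tau>: "hom_on UNIV \<tau>" "\<And>a. a \<in> E \<Longrightarrow> \<tau> a = \<sigma> a" using hom_extend[OF E] by blast
  have "\<tau> (to_ac c) = to_ac c" for c
    using \<tau>(2)[OF intermediate_base[OF E]] \<sigma> by (auto simp: field_auts_iff)
  then have "\<tau> \<in> Gal {}" using \<tau>(1) by (auto simp: Gal_def)
  then show ?thesis using that \<tau>(2) by blast
qed

lemma restrict_field_auts:
  assumes E: "intermediate E" and \<sigma>: "\<sigma> \<in> Gal {}" "\<sigma> ` E = E"
  shows "restrict \<sigma> E \<in> field_auts E base_field"
proof -
  have "inj_on \<sigma> E" using Gal_simps(11)[OF \<sigma>(1)] by (auto simp: inj_on_def)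
  then have "restrict \<sigma> E \<in> Bij E" using \<sigma>(2) by (auto simp: Bij_def bij_betw_def)
  then show ?thesis
    using intermediate_subring[OF E] E Gal_base[OF \<sigma>(1)]
    by (auto simp: field_auts_iff Gal_simps[OF \<sigma>(1)] subring_set_add subring_set_mult subring_set_one intermediate_def)
qed

theorem theorem4p1:
  fixes G :: "('g, 'm) monoid_scheme"
    and L :: "'k::field poly fract alg_closure set"
    and \<alpha> :: "'g \<Rightarrow> ('k poly fract alg_closure \<Rightarrow> 'k poly fract alg_closure)"
  assumes "finite_embedding_problem G L \<alpha>"
  shows "\<exists>E \<beta>. regular_solution G L \<alpha> E \<beta>"
proof -
  let ?C = "constant_closure :: 'k acl set"
  have G: "group G" "finite (carrier G)" and fL: "finite_separable_extension L"
    and \<alpha>: "\<alpha> \<in> epi G (Aut L base_field)"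
    using assms by (auto simp: finite_embedding_problem_def)
  interpret G: group G by (rule G(1))
  obtain TL where TL: "finite TL" "gen TL = L" "intermediate L" "\<And>x. x \<in> L \<Longrightarrow> separable_element x"
    using finite_separable_extensionE[OF fL] by metis
  have TL_sub: "TL \<subseteq> L" using gen_incl[of TL] TL(2) by simp
  have \<alpha>_aut: "\<alpha> h \<in> field_auts L base_field" if "h \<in> carrier G" for h
    using \<alpha> that by (auto simp: epi_def hom_def)
  have \<alpha>_mult: "\<alpha> (h \<otimes>\<^bsub>G\<^esub> g) x = \<alpha> h (\<alpha> g x)" if "h \<in> carrier G" "g \<in> carrier G" "x \<in> L" for h g x
  proof -
    have "\<alpha> \<in> hom G (Aut L base_field)" using \<alpha> by (simp add: epi_def)
    from hom_mult[OF this that(1,2)] show ?thesis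
      using that by (simp add: mult_Aut \<alpha>_aut compose_eq)
  qed
  have \<alpha>_one: "\<alpha> \<one>\<^bsub>G\<^esub> x = x" if "x \<in> L" for x
  proof -
    have "\<alpha> \<one>\<^bsub>G\<^esub> = \<one>\<^bsub>Aut L base_field\<^esub>"
      using \<alpha> by (intro hom_one[OF _ G(1) group_Aut_base[OF TL(3)]]) (simp add: epi_def)
    then show ?thesis using that by (simp add: Aut_def BijGroup_def)
  qed
  have \<alpha>_L: "\<alpha> h ` L = L" if "h \<in> carrier G" for h
    using \<alpha>_aut[OF that] by (simp add: field_auts_iff Bij_def bij_betw_def)
  obtain D where D: "D \<noteq> 0" "unramified D TL"
    using finite_unramified[OF TL(1)] TL(4) TL_sub by (meson subsetD)
  have DL: "unramified D L"
    using gen_least[OF intermediate_place, of _ _ TL] D(2) TL(2) by blast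
  have n: "card (carrier G) > 0" using G by (auto simp: card_gt_0_iff)
  obtain Z where Z': "finite Z" "card Z = card (carrier G)" "\<forall>z\<in>Z. separable_element z"
    "\<forall>\<sigma>\<in>Gal {}. \<sigma> ` Z \<subseteq> Z"
    "\<forall>\<phi>. inj_on \<phi> Z \<longrightarrow> \<phi> ` Z \<subseteq> Z \<longrightarrow> (\<exists>\<sigma>\<in>Gal (L \<union> ?C). \<forall>z\<in>Z. \<sigma> z = \<phi> z)"
    by (rule symmetric_splitting[OF D(1) DL n])
  note Z = Z'(1,2) Z'(3-5)[rule_format]
  obtain y where y: "bij_betw y (carrier G) Z" using finite_same_card_bij[OF G(2) Z(1)] Z(2) by auto
  have yZ: "y ` carrier G = Z" and yinj: "inj_on y (carrier G)" using y by (auto simp: bij_betw_def)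
  define T where "T = TL \<union> Z"
  have T: "finite T" "\<And>t. t \<in> T \<Longrightarrow> separable_element t"
    using TL Z TL_sub by (auto simp: T_def)
  have LT: "L \<subseteq> gen T" unfolding TL(2)[symmetric] T_def by (rule gen_mono) auto
  have ZT: "Z \<subseteq> gen T" using gen_incl[of T] by (auto simp: T_def)
  have "\<exists>s\<in>Gal {}. (\<forall>x\<in>L. s x = \<alpha> h x) \<and> (\<forall>g\<in>carrier G. s (y g) = y (h \<otimes>\<^bsub>G\<^esub> g))"
    if h: "h \<in> carrier G" for h
  proof -
    obtain \<sigma> where \<sigma>: "\<sigma> \<in> Gal {}" "\<And>x. x \<in> L \<Longrightarrow> \<sigma> x = \<alpha> h x"
      using field_auts_extend[OF TL(3) \<alpha>_aut[OF h]] by blast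
    \<comment> \<open>An arbitrary extension \<sigma> of \<open>\<alpha> h\<close> permutes
      \<open>Z\<close> in an uncontrolled way. This permutation sends \<open>\<sigma> (y g)\<close>
      to \<open>y\<close> of the product of \<open>h\<close> and \<open>g\<close>; realised by some
      \<rho> fixing \<open>L\<close>, it corrects \<sigma> without changing it on
      \<open>L\<close>.\<close>
    define \<phi> where "\<phi> = (\<lambda>x. y (h \<otimes>\<^bsub>G\<^esub> inv_into (carrier G) y (inv_into UNIV \<sigma> x)))"
    have inv\<sigma>: "inv_into UNIV \<sigma> x \<in> Z" if "x \<in> Z" for x using Z(4)[OF Gal_inv(1)[OF \<sigma>(1)]] that by auto
    have mem: "inv_into (carrier G) y (inv_into UNIV \<sigma> x) \<in> carrier G" if "x \<in> Z" for x
      using inv\<sigma>[OF that] yZ by (simp add: inv_into_into)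
    have "inj_on \<phi> Z"
    proof (rule inj_onI)
      fix a b assume ab: "a \<in> Z" "b \<in> Z" "\<phi> a = \<phi> b"
      then have "inv_into (carrier G) y (inv_into UNIV \<sigma> a) = inv_into (carrier G) y (inv_into UNIV \<sigma> b)"
        using yinj mem h by (simp add: \<phi>_def inj_on_eq_iff)
      then have "inv_into UNIV \<sigma> a = inv_into UNIV \<sigma> b" using inv\<sigma> ab yZ by (metis f_inv_into_f)
      then show "a = b" using Gal_inv(3)[OF \<sigma>(1)] by metis
    qed
    moreover have "\<phi> ` Z \<subseteq> Z" using mem h yZ by (auto simp: \<phi>_def)
    ultimately obtain \<rho> where \<rho>: "\<rho> \<in> Gal (L \<union> ?C)" "\<forall>z\<in>Z. \<rho> z = \<phi> z" using Z(5) by blast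
    have "\<rho> \<circ> \<sigma> \<in> Gal {}" by (rule Gal_comp[OF Gal_empty[OF \<rho>(1)] \<sigma>(1)])
    moreover have "(\<rho> \<circ> \<sigma>) x = \<alpha> h x" if "x \<in> L" for x
      using \<sigma>(2)[OF that] Gal_fixes[OF \<rho>(1), of "\<alpha> h x"] \<alpha>_L[OF h] that by auto
    moreover have "(\<rho> \<circ> \<sigma>) (y g) = y (h \<otimes>\<^bsub>G\<^esub> g)" if g: "g \<in> carrier G" for g
    proof -
      have "\<sigma> (y g) \<in> Z" using Z(4)[OF \<sigma>(1)] yZ g by blast
      then show ?thesis using \<rho>(2) by (simp add: \<phi>_def Gal_inv(2)[OF \<sigma>(1)] inv_into_f_f[OF yinj g])
    qed
    ultimately show ?thesis by blast
  qed
  then obtain s where s: "\<And>h. h \<in> carrier G \<Longrightarrow> s h \<in> Gal {}"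
    "\<And>h x. h \<in> carrier G \<Longrightarrow> x \<in> L \<Longrightarrow> s h x = \<alpha> h x"
    "\<And>h g. h \<in> carrier G \<Longrightarrow> g \<in> carrier G \<Longrightarrow> s h (y g) = y (h \<otimes>\<^bsub>G\<^esub> g)" by metis
  \<comment> \<open>The lifts to \<open>A\<close> were chosen independently of each other, so the
    law of an action holds only where their values are prescribed.\<close>
  have s_mult: "s h (s g t) = s (h \<otimes>\<^bsub>G\<^esub> g) t" if hg: "h \<in> carrier G" "g \<in> carrier G" and t: "t \<in> L \<union> Z" for h g t
  proof (cases "t \<in> L")
    case True
    then have "\<alpha> g t \<in> L" using \<alpha>_L[OF hg(2)] by blast
    then show ?thesis using True hg by (simp add: s(2) \<alpha>_mult)
  next
    case False
    then obtain k where "k \<in> carrier G" "t = y k" using t yZ by auto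
    then show ?thesis using hg by (simp add: s(3) G.m_assoc)
  qed
  have s_gen: "s h t \<in> gen T" if h: "h \<in> carrier G" and t: "t \<in> T" for h t
  proof (cases "t \<in> L")
    case True
    then show ?thesis using \<alpha>_L[OF h] LT by (auto simp: s(2)[OF h])
  next
    case False
    then have "t \<in> Z" using t TL_sub by (auto simp: T_def)
    then show ?thesis using Z(4)[OF s(1)[OF h]] ZT by blast
  qed
  have s_one: "s \<one>\<^bsub>G\<^esub> t = t" if t: "t \<in> L \<union> Z" for t
  proof (cases "t \<in> L")
    case False
    then obtain k where "k \<in> carrier G" "t = y k" using t yZ by auto
    then show ?thesis by (simp add: s(3))
  qed (simp add: s(2) \<alpha>_one)
  have TLZ: "T \<subseteq> L \<union> Z" using TL_sub by (auto simp: T_def)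
  obtain w where w': "w \<in> gen T" "w \<noteq> 0" "\<forall>h\<in>carrier G. s h w = w"
    "\<forall>\<sigma>\<in>Gal {}. \<sigma> w = w \<longrightarrow> (\<exists>h\<in>carrier G. \<forall>t\<in>T. \<sigma> t = s h t)"
  proof (rule invariant_element[OF T(1) G(2) G.one_closed s(1) s_gen])
    show "s \<one>\<^bsub>G\<^esub> t = t" if "t \<in> T" for t using s_one that TLZ by blast
    show "\<exists>b. bij_betw b (carrier G) (carrier G) \<and> (\<forall>g\<in>carrier G. \<forall>t\<in>T. s h (s g t) = s (b g) t)"
      if h: "h \<in> carrier G" for h
    proof (intro exI conjI ballI)
      have "inj_on (\<lambda>g. h \<otimes>\<^bsub>G\<^esub> g) (carrier G)" using h by (auto simp: inj_on_def)
      moreover have "(\<lambda>g. h \<otimes>\<^bsub>G\<^esub> g) ` carrier G \<subseteq> carrier G" using h by auto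
      ultimately show "bij_betw (\<lambda>g. h \<otimes>\<^bsub>G\<^esub> g) (carrier G) (carrier G)"
        using endo_inj_surj[OF G(2)] by (simp add: bij_betw_def)
      show "s h (s g t) = s (h \<otimes>\<^bsub>G\<^esub> g) t" if "g \<in> carrier G" "t \<in> T" for g t
        using s_mult[OF h that(1)] that(2) TLZ by blast
    qed
  qed
  note w = w'(1,2) w'(3,4)[rule_format]
  have w_sep: "separable_element w"
  proof -
    obtain N where N: "galois N" "T \<subseteq> N" using galois_containing[OF T] by blast
    have "gen T \<subseteq> N" by (rule gen_least) (use N in \<open>auto simp: galois_def\<close>)
    then show ?thesis using galois_separable[OF N(1)] w(1) by blast
  qed
  obtain D' where D': "D' \<noteq> 0" "unramified D' T"
    using finite_unramified[OF T] by blast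
  obtain z q where q: "poly_over (gen T) q" "rsquarefree q" "poly q z = 0"
    and z: "\<forall>\<sigma>\<in>Gal {}. \<sigma> w = w \<longrightarrow> (\<exists>\<rho>\<in>Gal (gen T \<union> ?C). \<rho> (\<sigma> z) = z)"
      "\<forall>\<sigma>\<in>Gal {}. \<sigma> z \<in> gen (insert z T) \<longrightarrow> \<sigma> w = w \<and> \<sigma> z = z"
    by (rule rigid_generator[OF w_sep w(2,1) D'])
  note z_conj = z(1)[rule_format] and z_rigid = z(2)[rule_format]
  define E where "E = gen (insert z T)"
  have iE: "intermediate E" by (simp add: E_def)
  have sE: "separable_element x" if "x \<in> E" for x
    using separable_gen[OF T q] that by (simp add: E_def)
  have fE: "finite_separable_extension E"
    unfolding E_def using T(1) sE by (intro finite_separable_extension_gen) (auto simp: E_def)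
  have TE: "gen T \<subseteq> E" unfolding E_def by (rule gen_mono) auto
  have LE: "L \<subseteq> E" using LT TE by blast
  have zE: "z \<in> E" unfolding E_def using gen_incl by blast
  have E_agree: "\<sigma> x = \<tau> x" if "\<sigma> \<in> Gal {}" "\<tau> \<in> Gal {}" "\<And>t. t \<in> L \<union> Z \<Longrightarrow> \<sigma> t = \<tau> t" "\<sigma> z = \<tau> z" "x \<in> E" for \<sigma> \<tau> x
    using Gal_agree_gen[OF that(1,2), of "insert z T" x] that(3-5) TLZ by (auto simp: E_def)
  \<comment> \<open>Since \<open>s h\<close> fixes \<open>w\<close>, it moves \<open>z\<close> to a
    conjugate that some \<rho>, trivial on \<open>gen T\<close>, brings back to \<open>z\<close>;
    composing leaves the values on \<open>L\<close> and \<open>Z\<close> intact.\<close>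
  have "\<exists>S\<in>Gal {}. (\<forall>t\<in>L \<union> Z. S t = s h t) \<and> S z = z" if h: "h \<in> carrier G" for h
  proof -
    obtain \<rho> where \<rho>: "\<rho> \<in> Gal (gen T \<union> ?C)" "\<rho> (s h z) = z" using z_conj[OF s(1)[OF h] w(3)[OF h]] by blast
    have "s h t \<in> gen T" if "t \<in> L \<union> Z" for t
    proof (cases "t \<in> L")
      case True
      then show ?thesis using \<alpha>_L[OF h] LT by (auto simp: s(2)[OF h])
    next
      case False
      then show ?thesis using that Z(4)[OF s(1)[OF h]] ZT by blast
    qed
    then have "\<forall>t\<in>L \<union> Z. (\<rho> \<circ> s h) t = s h t" using Gal_fixes[OF \<rho>(1)] by auto
    moreover have "\<rho> \<circ> s h \<in> Gal {}" by (rule Gal_comp[OF Gal_empty[OF \<rho>(1)] s(1)[OF h]])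
    ultimately show ?thesis using \<rho>(2) by (intro bexI[of _ "\<rho> \<circ> s h"]) auto
  qed
  then obtain S where S: "\<And>h. h \<in> carrier G \<Longrightarrow> S h \<in> Gal {}"
    "\<And>h t. h \<in> carrier G \<Longrightarrow> t \<in> L \<union> Z \<Longrightarrow> S h t = s h t" "\<And>h. h \<in> carrier G \<Longrightarrow> S h z = z" by metis
  have S_closed: "S h x \<in> E" if h: "h \<in> carrier G" and x: "x \<in> E" for h x
  proof -
    have "S h t \<in> E" if "t \<in> T" for t
    proof -
      have "t \<in> L \<union> Z" using that TLZ by blast
      then show ?thesis using S(2)[OF h] s_gen[OF h that] TE by auto
    qed
    then have "insert z T \<subseteq> {x. S h x \<in> E}" using S(3)[OF h] zE by auto
    then have "E \<subseteq> {x. S h x \<in> E}"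
      unfolding E_def by (rule gen_least[OF intermediate_preimage[OF S(1)[OF h] intermediate_gen]])
    then show ?thesis using x by blast
  qed
  have S_LZ: "S h t \<in> L \<union> Z" if h: "h \<in> carrier G" and t: "t \<in> L \<union> Z" for h t
  proof (cases "t \<in> L")
    case True
    then show ?thesis using S(2)[OF h t] s(2)[OF h] \<alpha>_L[OF h] by auto
  next
    case False
    then have "s h t \<in> Z" using t Z(4)[OF s(1)[OF h]] by blast
    then show ?thesis using S(2)[OF h t] by simp
  qed
  have S_mult: "S (h \<otimes>\<^bsub>G\<^esub> g) x = S h (S g x)" if hg: "h \<in> carrier G" "g \<in> carrier G" and x: "x \<in> E" for h g x
  proof -
    have "S (h \<otimes>\<^bsub>G\<^esub> g) x = (S h \<circ> S g) x"
    proof (rule E_agree[OF S(1) Gal_comp[OF S(1) S(1)] _ _ x])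
      show "S (h \<otimes>\<^bsub>G\<^esub> g) t = (S h \<circ> S g) t" if t: "t \<in> L \<union> Z" for t
        using S_LZ[OF hg(2) t] S(2) s_mult hg t by (metis G.m_closed comp_apply)
    qed (use hg S(3) in auto)
    then show ?thesis by simp
  qed
  have S_one: "S \<one>\<^bsub>G\<^esub> x = x" if x: "x \<in> E" for x
    using E_agree[OF S(1)[OF G.one_closed] Gal_id, of x] S(2,3)[OF G.one_closed] s_one x by auto
  have S_image: "S h ` E = E" if h: "h \<in> carrier G" for h
  proof
    show "S h ` E \<subseteq> E" using S_closed[OF h] by blast
    show "E \<subseteq> S h ` E"
    proof
      fix x assume x: "x \<in> E"
      have "x = S h (S (inv\<^bsub>G\<^esub> h) x)" using S_mult[OF h G.inv_closed[OF h] x] h S_one[OF x] by simp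
      then show "x \<in> S h ` E" using S_closed[OF G.inv_closed[OF h] x] by blast
    qed
  qed
  define \<Psi> where "\<Psi> = (\<lambda>h. restrict (S h) E)"
  have \<Psi>_aut: "\<Psi> h \<in> field_auts E base_field" if "h \<in> carrier G" for h
    unfolding \<Psi>_def by (rule restrict_field_auts[OF iE S(1) S_image]) (rule that)+
  have "\<Psi> \<in> iso G (Aut E base_field)"
  proof (rule isoI)
    show "\<Psi> \<in> hom G (Aut E base_field)"
    proof (rule homI)
      fix h g assume hg: "h \<in> carrier G" "g \<in> carrier G"
      have "\<Psi> (h \<otimes>\<^bsub>G\<^esub> g) = compose E (\<Psi> h) (\<Psi> g)"
        using S_mult[OF hg] S_closed[OF hg(2)] by (auto simp: \<Psi>_def compose_def restrict_def fun_eq_iff)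
      then show "\<Psi> (h \<otimes>\<^bsub>G\<^esub> g) = \<Psi> h \<otimes>\<^bsub>Aut E base_field\<^esub> \<Psi> g" using hg by (simp add: mult_Aut \<Psi>_aut)
    qed (simp add: \<Psi>_aut)
    show "bij_betw \<Psi> (carrier G) (carrier (Aut E base_field))"
      unfolding bij_betw_def carrier_Aut
    proof
      show "inj_on \<Psi> (carrier G)"
      proof (rule inj_onI)
        fix h g assume hg: "h \<in> carrier G" "g \<in> carrier G" "\<Psi> h = \<Psi> g"
        \<comment> \<open>Faithfulness comes from the regular action on \<open>Z\<close>: the root
          of index 1 is sent to the root of index \<open>h\<close>, even if \<alpha> has a
          kernel.\<close>
        have y1: "y \<one>\<^bsub>G\<^esub> \<in> Z" using yZ by auto
        then have "S h (y \<one>\<^bsub>G\<^esub>) = S g (y \<one>\<^bsub>G\<^esub>)" using fun_cong[OF hg(3), of "y \<one>\<^bsub>G\<^esub>"] ZT TE by (auto simp: \<Psi>_def)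
        then have "y h = y g" using hg S(2) y1 by (simp add: s(3))
        then show "h = g" using yinj hg by (simp add: inj_on_eq_iff)
      qed
      show "\<Psi> ` carrier G = field_auts E base_field"
      proof
        show "field_auts E base_field \<subseteq> \<Psi> ` carrier G"
        proof
          fix \<sigma> assume \<sigma>: "\<sigma> \<in> field_auts E base_field"
          obtain \<tau> where \<tau>: "\<tau> \<in> Gal {}" "\<And>x. x \<in> E \<Longrightarrow> \<tau> x = \<sigma> x" using field_auts_extend[OF iE \<sigma>] by blast
          \<comment> \<open>Here rigidity applies: an automorphism of \<open>E\<close> keeps
            \<open>z\<close> inside \<open>E\<close>, hence fixes \<open>z\<close> and
            \<open>w\<close>; fixing \<open>w\<close>, it acts on \<open>T\<close> like an element
            of \<open>G\<close>.\<close>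
          have "\<sigma> z \<in> E" using \<sigma> zE by (auto simp: field_auts_iff Bij_def bij_betw_def)
          then have \<tau>w: "\<tau> w = w" "\<tau> z = z" using z_rigid[OF \<tau>(1)] \<tau>(2)[OF zE] by (auto simp: E_def)
          obtain h where h: "h \<in> carrier G" "\<forall>t\<in>T. \<tau> t = s h t" using w(4)[OF \<tau>(1) \<tau>w(1)] by blast
          have "\<tau> t = S h t" if t: "t \<in> insert z T" for t
          proof (cases "t = z")
            case False
            then have "t \<in> T" "t \<in> L \<union> Z" using t TLZ by auto
            then show ?thesis using h S(2)[OF h(1)] by simp
          qed (simp add: \<tau>w S(3)[OF h(1)])
          then have "\<tau> x = S h x" if "x \<in> E" for x
            using Gal_agree_gen[OF \<tau>(1) S(1)[OF h(1)], of "insert z T" x] that by (simp add: E_def)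
          then have "\<sigma> x = \<Psi> h x" for x
            using \<tau>(2) \<sigma> by (cases "x \<in> E") (auto simp: \<Psi>_def field_auts_iff Bij_def extensional_def)
          then show "\<sigma> \<in> \<Psi> ` carrier G" using h(1) by (auto simp: fun_eq_iff)
        qed
      qed (use \<Psi>_aut in blast)
    qed
  qed
  then have \<Psi>: "\<Psi> \<in> iso G (Aut E base_field)" .
  define \<beta> where "\<beta> = inv_into (carrier G) \<Psi>"
  have \<beta>: "\<beta> \<in> iso (Aut E base_field) G" unfolding \<beta>_def by (rule G.iso_set_sym[OF \<Psi>])
  have restr: "\<sigma> ` L = L \<and> \<alpha> (\<beta> \<sigma>) = restrict \<sigma> L" if \<sigma>: "\<sigma> \<in> carrier (Aut E base_field)" for \<sigma>
  proof -
    have bij: "bij_betw \<Psi> (carrier G) (carrier (Aut E base_field))" using \<Psi> by (simp add: iso_def)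
    have h: "\<beta> \<sigma> \<in> carrier G" "\<Psi> (\<beta> \<sigma>) = \<sigma>"
      using \<sigma> bij by (auto simp: \<beta>_def bij_betw_def inv_into_into f_inv_into_f)
    have eq: "\<sigma> x = \<alpha> (\<beta> \<sigma>) x" if x: "x \<in> L" for x
    proof -
      have "\<Psi> (\<beta> \<sigma>) x = S (\<beta> \<sigma>) x" using x LE by (auto simp: \<Psi>_def)
      then show ?thesis using h x S(2)[OF h(1)] s(2)[OF h(1)] by simp
    qed
    then have "\<sigma> ` L = \<alpha> (\<beta> \<sigma>) ` L" by (auto simp: image_iff)
    moreover have "\<alpha> (\<beta> \<sigma>) = restrict \<sigma> L"
      using \<alpha>_aut[OF h(1)] eq by (auto simp: field_auts_iff Bij_def extensional_def restrict_def fun_eq_iff)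
    ultimately show ?thesis using \<alpha>_L[OF h(1)] by simp
  qed
  \<comment> \<open>\<open>E\<close> is separable over \<open>L\<close>, so it suffices that a
    constant in \<open>E\<close> is fixed by every \<sigma> over \<open>L\<close>. On
    \<open>E\<close> such a \<sigma> is imitated by automorphisms that fix all constants.\<close>
  have "x \<in> L" if x: "x \<in> E" "x \<in> ?C" for x
  proof (rule fixed_separable[of "insert z Z" L])
    show "finite (insert z Z)" using Z(1) by simp
    show "intermediate L" by (rule TL(3))
    show "separable_over L t" if "t \<in> insert z Z" for t
    proof -
      have "separable_element t" using that sE zE ZT TE by blast
      moreover have "base_field \<subseteq> L" using TL(3) by (simp add: intermediate_def)
      ultimately show ?thesis unfolding separable_element_iff by (rule separable_over_mono)
    qed
    have "insert z T \<subseteq> L \<union> insert z Z" using TLZ by blast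
    then show "x \<in> gen (L \<union> insert z Z)" using x(1) gen_mono unfolding E_def by blast
    fix \<sigma> assume \<sigma>: "\<sigma> \<in> Gal L"
    have "inj_on \<sigma> Z" using Gal_simps(11)[OF \<sigma>] by (auto simp: inj_on_def)
    then obtain \<rho> where \<rho>: "\<rho> \<in> Gal (L \<union> ?C)" "\<forall>t\<in>Z. \<rho> t = \<sigma> t"
      using Z(5)[of \<sigma>] Z(4)[OF Gal_empty[OF \<sigma>]] by blast
    have \<rho>L: "\<rho> \<in> Gal L" using \<rho>(1) Gal_mono[of L "L \<union> ?C"] by auto
    \<comment> \<open>\<rho> fixes the constants and acts on \<open>Z\<close> like \<sigma>; the
      quotient \<tau> is trivial on \<open>gen T\<close>, hence fixes \<open>w\<close>, and can
      differ from the identity of \<open>E\<close> only through the image of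
      \<open>z\<close>.\<close>
    define \<tau> where "\<tau> = inv_into UNIV \<rho> \<circ> \<sigma>"
    have \<tau>L: "\<tau> \<in> Gal L" unfolding \<tau>_def by (rule Gal_comp[OF Gal_inv(1)[OF \<rho>L] \<sigma>])
    have \<tau>Z: "\<tau> t = t" if "t \<in> Z" for t
      using \<rho>(2) that by (metis Gal_inv(2)[OF \<rho>L] \<tau>_def comp_apply)
    have \<tau>LZ: "\<tau> t = t" if "t \<in> L \<union> Z" for t using \<tau>Z Gal_fixes[OF \<tau>L] that by blast
    have "\<tau> \<in> Gal T" using \<tau>L \<tau>LZ TLZ by (auto simp: Gal_def)
    then have "\<tau> w = w" using w(1) unfolding Gal_gen[of T, symmetric] by (auto dest: Gal_fixes)
    then obtain \<omega> where \<omega>: "\<omega> \<in> Gal (gen T \<union> ?C)" "\<omega> (\<tau> z) = z" using z_conj[OF Gal_empty[OF \<tau>L]] by blast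
    have "(\<omega> \<circ> \<tau>) x = id x"
    proof (rule E_agree[OF Gal_comp[OF Gal_empty[OF \<omega>(1)] Gal_empty[OF \<tau>L]] Gal_id _ _ x(1)])
      show "(\<omega> \<circ> \<tau>) t = id t" if "t \<in> L \<union> Z" for t
        using \<tau>LZ[OF that] Gal_fixes[OF \<omega>(1), of t] that LT ZT by auto
    qed (simp add: \<omega>(2))
    \<comment> \<open>\<omega> fixes the constant \<open>x\<close> and undoes \<tau> on
      \<open>E\<close>. So \<tau> fixes \<open>x\<close>, and \<sigma> agrees at \<open>x\<close>
      with \<rho>, which fixes constants.\<close>
    then have "\<omega> (\<tau> x) = \<omega> x" using Gal_fixes[OF \<omega>(1), of x] x(2) by simp
    then have "\<tau> x = x" using Gal_simps(11)[OF \<omega>(1)] by blast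
    then have "\<sigma> x = \<rho> x" using Gal_inv(3)[OF \<rho>L, of "\<sigma> x"] by (simp add: \<tau>_def)
    then show "\<sigma> x = x" using Gal_fixes[OF \<rho>(1), of x] x(2) by simp
  qed
  then have "E \<inter> ?C = L \<inter> ?C" using LE by blast
  then have "regular_solution G L \<alpha> E \<beta>"
    unfolding regular_solution_def embedding_problem_solution_def using fE LE \<beta> restr by blast
  then show ?thesis by blast
qed

end
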